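(* Let $G=(A\cup P,E)$ be a bipartite graph in which every applicant $a\in A$ ranks its neighbours in $P$ in a preference list (ties allowed), every vertex $u\in A\cup P$ has a positive integer quota $q(u)$, and every vertex $u\in A\cup P$ has a classification $\mathcal{C}_u$ over its neighbourhood $N(u)$ that is a laminar family, each class $C\in\mathcal{C}_u$ having a quota $q(C)$. Then there is an algorithm running in time $O(|E|^2)$ that computes a feasible matching of $G$ that is rank-maximal among all feasible matchings of $G$.
   Context: An edge $(a,p)\in E$ has rank $k$ if $p$ is a $k$-th choice of $a$; let $r$ be the largest rank. A matching is a subset $M\subseteq E$; $M(u)$ denotes the set of neighbours of $u$ in $M$ (vertices may have several partners). $M$ is feasible if for every vertex $u$, $|M(u)|\le q(u)$ and for every class $C\in\mathcal{C}_u$, $|M(u)\cap C|\le q(C)$. The signature of $M$ is $(x_1,\dots,x_r)$ where $x_k$ is the number of rank-$k$ edges in $M$; signatures are compared lexicographically ($M\succ M'$ if for some $k$, $x_i=x'_i$ for $i<k$ and $x_k>x'_k$). A feasible matching is rank-maximal among feasible matchings if no feasible matching has a lexicographically larger signature. A family $\mathcal{F}$ of sets is laminar if for all $X,Y\in\mathcal{F}$, $X\subseteq Y$, $Y\subseteq X$ or $X\cap Y=\emptyset$. *)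

theory Defs
  imports Complex_Main "HOL-Library.Landau_Symbols"
begin

section \<open>Rank-maximal matchings under classifications\<close>

text \<open>
  Vertices are named by arbitrary natural numbers.  \<open>pref I a\<close> is the preference list of \<open>a\<close>: a list
  of tie groups, most preferred first.  \<open>class_quota I u C\<close> also takes the owner \<open>u\<close> of the
  class, since the same set can be a class of several vertices, with different quotas.
\<close>

record cm_instance =
  applicants :: "nat set"
  posts :: "nat set"
  edges :: "(nat \<times> nat) set"
  pref :: "nat \<Rightarrow> nat set list"
  quota :: "nat \<Rightarrow> nat"
  classes :: "nat \<Rightarrow> nat set set"
  class_quota :: "nat \<Rightarrow> nat set \<Rightarrow> nat"

definition vertices :: "cm_instance \<Rightarrow> nat set" where
  "vertices I = applicants I \<union> posts I"

definition partners :: "(nat \<times> nat) set \<Rightarrow> nat \<Rightarrow> nat set" where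
  "partners M u = {v. (u, v) \<in> M \<or> (v, u) \<in> M}"

definition laminar :: "'a set set \<Rightarrow> bool" where
  "laminar F \<longleftrightarrow> (\<forall>X\<in>F. \<forall>Y\<in>F. X \<subseteq> Y \<or> Y \<subseteq> X \<or> X \<inter> Y = {})"

definition preference_list :: "nat set list \<Rightarrow> nat set \<Rightarrow> bool" where
  "preference_list gs X \<longleftrightarrow>
     \<Union> (set gs) = X \<and> {} \<notin> set gs \<and>
     (\<forall>i<length gs. \<forall>j<length gs. i \<noteq> j \<longrightarrow> gs ! i \<inter> gs ! j = {})"

definition valid_instance :: "cm_instance \<Rightarrow> bool" where
  "valid_instance I \<longleftrightarrow>
     finite (applicants I) \<and> finite (posts I) \<and> applicants I \<inter> posts I = {} \<and>
     edges I \<subseteq> applicants I \<times> posts I \<and>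
     (\<forall>a\<in>applicants I. preference_list (pref I a) (partners (edges I) a)) \<and>
     (\<forall>u\<in>vertices I. 0 < quota I u \<and>
        (\<forall>C\<in>classes I u. C \<subseteq> partners (edges I) u) \<and> laminar (classes I u))"

definition has_rank :: "cm_instance \<Rightarrow> nat \<times> nat \<Rightarrow> nat \<Rightarrow> bool" where
  "has_rank I e k \<longleftrightarrow>
     1 \<le> k \<and> k \<le> length (pref I (fst e)) \<and> snd e \<in> pref I (fst e) ! (k - 1)"

text \<open>The \<open>0\<close> only matters for an instance without edges.\<close>

definition max_rank :: "cm_instance \<Rightarrow> nat" where
  "max_rank I = Max (insert 0 {k. \<exists>e\<in>edges I. has_rank I e k})"

definition feasible :: "cm_instance \<Rightarrow> (nat \<times> nat) set \<Rightarrow> bool" where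
  "feasible I M \<longleftrightarrow>
     M \<subseteq> edges I \<and>
     (\<forall>u\<in>vertices I. card (partners M u) \<le> quota I u \<and>
        (\<forall>C\<in>classes I u. card (partners M u \<inter> C) \<le> class_quota I u C))"

definition signature :: "cm_instance \<Rightarrow> (nat \<times> nat) set \<Rightarrow> nat list" where
  "signature I M = map (\<lambda>k. card {e \<in> M. has_rank I e k}) [1..<Suc (max_rank I)]"

definition lex_larger :: "nat list \<Rightarrow> nat list \<Rightarrow> bool" where
  "lex_larger xs ys \<longleftrightarrow> (\<exists>k<length xs. (\<forall>i<k. xs ! i = ys ! i) \<and> xs ! k > ys ! k)"

definition rank_maximal :: "cm_instance \<Rightarrow> (nat \<times> nat) set \<Rightarrow> bool" where
  "rank_maximal I M \<longleftrightarrow>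
     feasible I M \<and> (\<nexists>M'. feasible I M' \<and> lex_larger (signature I M') (signature I M))"


section \<open>Machine model\<close>

text \<open>
  A random access machine with uniform cost, presented as a structured language: the memory consists
  of named arrays of natural numbers, a scalar being cell \<open>0\<close> of an array.  A program
  mentions finitely many arrays, so interleaving them in one address space costs a constant
  factor.  The operations are addition, truncated subtraction, comparison and indirect
  access; multiplication is left out, because together with unit cost it
  would make the model unrealistically strong.  Every expression node, every write and every test
  takes one time unit.
\<close>

type_synonym vname = string
type_synonym state = "vname \<Rightarrow> nat \<Rightarrow> nat"

datatype aexp = Num nat | Read vname aexp | Add aexp aexp | Sub aexp aexp

datatype bexp = Less aexp aexp | Equal aexp aexp | Neg bexp | And bexp bexp

datatype com =
    Skip
  | Write vname aexp aexp
  | Seq com com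
  | Cond bexp com com
  | While bexp com

fun aval :: "aexp \<Rightarrow> state \<Rightarrow> nat" where
  "aval (Num n) s = n"
| "aval (Read x a) s = s x (aval a s)"
| "aval (Add a b) s = aval a s + aval b s"
| "aval (Sub a b) s = aval a s - aval b s"

fun acost :: "aexp \<Rightarrow> nat" where
  "acost (Num n) = 1"
| "acost (Read x a) = 1 + acost a"
| "acost (Add a b) = 1 + acost a + acost b"
| "acost (Sub a b) = 1 + acost a + acost b"

fun bval :: "bexp \<Rightarrow> state \<Rightarrow> bool" where
  "bval (Less a b) s \<longleftrightarrow> aval a s < aval b s"
| "bval (Equal a b) s \<longleftrightarrow> aval a s = aval b s"
| "bval (Neg b) s \<longleftrightarrow> \<not> bval b s"
| "bval (And b c) s \<longleftrightarrow> bval b s \<and> bval c s"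

fun bcost :: "bexp \<Rightarrow> nat" where
  "bcost (Less a b) = 1 + acost a + acost b"
| "bcost (Equal a b) = 1 + acost a + acost b"
| "bcost (Neg b) = 1 + bcost b"
| "bcost (And b c) = 1 + bcost b + bcost c"

text \<open>\<open>exec c s t s'\<close>: program \<open>c\<close> started in \<open>s\<close> halts after \<open>t\<close> time units in \<open>s'\<close>.\<close>

inductive exec :: "com \<Rightarrow> state \<Rightarrow> nat \<Rightarrow> state \<Rightarrow> bool" where
  Skip: "exec Skip s 1 s"
| Write: "exec (Write x i a) s (1 + acost i + acost a) (s(x := (s x)(aval i s := aval a s)))"
| Seq: "exec c s t s' \<Longrightarrow> exec d s' t' s'' \<Longrightarrow> exec (Seq c d) s (t + t') s''"
| CondTrue: "bval b s \<Longrightarrow> exec c s t s' \<Longrightarrow> exec (Cond b c d) s (1 + bcost b + t) s'"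
| CondFalse: "\<not> bval b s \<Longrightarrow> exec d s t s' \<Longrightarrow> exec (Cond b c d) s (1 + bcost b + t) s'"
| WhileFalse: "\<not> bval b s \<Longrightarrow> exec (While b c) s (1 + bcost b) s"
| WhileTrue: "bval b s \<Longrightarrow> exec c s t s' \<Longrightarrow> exec (While b c) s' t' s'' \<Longrightarrow>
    exec (While b c) s (1 + bcost b + t + t') s''"

lemma exec_deterministic:
  "exec c s t s' \<Longrightarrow> exec c s u s'' \<Longrightarrow> t = u \<and> s' = s''"
proof (induction arbitrary: u s'' rule: exec.induct)
  case (Skip s)
  then show ?case by cases auto
next
  case (Write x i a s)
  then show ?case by cases auto
next
  case (Seq c s t s' d t' sa)
  from Seq.prems obtain t1 s1 t2 where "exec c s t1 s1" "exec d s1 t2 s''" "u = t1 + t2"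
    by cases auto
  with Seq.IH(1)[of t1 s1] Seq.IH(2)[of t2 s''] show ?case by simp
next
  case (CondTrue b s c t s' d)
  from CondTrue.prems CondTrue.hyps(1) obtain t1 where "exec c s t1 s''" "u = 1 + bcost b + t1"
    by cases auto
  with CondTrue.IH[of t1 s''] show ?case by simp
next
  case (CondFalse b s d t s' c)
  from CondFalse.prems CondFalse.hyps(1) obtain t1 where "exec d s t1 s''" "u = 1 + bcost b + t1"
    by cases auto
  with CondFalse.IH[of t1 s''] show ?case by simp
next
  case (WhileFalse b s c)
  from WhileFalse.prems WhileFalse.hyps show ?case by cases auto
next
  case (WhileTrue b s c t s' t' sa)
  from WhileTrue.prems WhileTrue.hyps(1) obtain t1 s1 t2
    where "exec c s t1 s1" "exec (While b c) s1 t2 s''" "u = 1 + bcost b + t1 + t2"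
    by cases auto
  with WhileTrue.IH(1)[of t1 s1] WhileTrue.IH(2)[of t2 s''] show ?case by simp
qed


section \<open>Input and output\<close>

definition stores :: "state \<Rightarrow> vname \<Rightarrow> nat \<Rightarrow> nat list \<Rightarrow> bool" where
  "stores s x k xs \<longleftrightarrow> (\<forall>i<length xs. s x (k + i) = xs ! i)"

definition input_arrays :: "vname set" where
  "input_arrays =
     {''edge_count'', ''edge_applicant'', ''edge_post'', ''edge_rank'', ''quota'',
      ''class_count'', ''class_start'', ''class_quota'',
      ''member_count'', ''member_start'', ''member''}"

text \<open>
  The edges are listed, each once and in any order, with endpoints and rank.  The quotas and
  classes are accessed through the vertex: the classes of \<open>u\<close>, each listed once and in any
  order, occupy consecutive class numbers beginning at \<open>class_start[u]\<close>, and the elements of the class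
  with number \<open>c\<close>, each listed once and in any order, occupy consecutive cells of
  \<open>member\<close> beginning at \<open>member_start[c]\<close>.  So a program can ignore isolated vertices, whose number
  is not bounded by the number of edges.  All non-input arrays are initially zero; input cells not
  mentioned have arbitrary contents.
\<close>

definition encodes :: "cm_instance \<Rightarrow> state \<Rightarrow> bool" where
  "encodes I s \<longleftrightarrow>
     (\<exists>es. distinct es \<and> set es = edges I \<and>
        s ''edge_count'' 0 = length es \<and>
        stores s ''edge_applicant'' 0 (map fst es) \<and>
        stores s ''edge_post'' 0 (map snd es) \<and>
        (\<forall>i<length es. has_rank I (es ! i) (s ''edge_rank'' i))) \<and>
     (\<forall>u\<in>vertices I. s ''quota'' u = quota I u) \<and>
     (\<forall>u\<in>vertices I. \<exists>Cs. distinct Cs \<and> set Cs = classes I u \<and>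
        s ''class_count'' u = length Cs \<and>
        (\<forall>j<length Cs. let c = s ''class_start'' u + j in
           s ''class_quota'' c = class_quota I u (Cs ! j) \<and>
           (\<exists>xs. distinct xs \<and> set xs = Cs ! j \<and>
              s ''member_count'' c = length xs \<and>
              stores s ''member'' (s ''member_start'' c) xs))) \<and>
     (\<forall>x i. x \<notin> input_arrays \<longrightarrow> s x i = 0)"

definition output_edges :: "state \<Rightarrow> (nat \<times> nat) set" where
  "output_edges s =
     {(s ''out_applicant'' i, s ''out_post'' i) | i. i < s ''out_count'' 0}"

lemma encoding_exists:
  assumes "valid_instance I"
  shows "\<exists>s. encodes I s"
proof -
  let ?V = "vertices I"
  have finV: "finite ?V" using assms by (simp add: valid_instance_def vertices_def)
  have "finite (edges I)"
    using assms by (meson finite_cartesian_product finite_subset valid_instance_def)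
  then obtain es where es: "set es = edges I" "distinct es"
    using finite_distinct_list by blast
  have sub: "C \<subseteq> ?V" if "u \<in> ?V" "C \<in> classes I u" for u C
  proof -
    have "C \<subseteq> partners (edges I) u" using assms that by (simp add: valid_instance_def)
    moreover have "edges I \<subseteq> applicants I \<times> posts I" using assms by (simp add: valid_instance_def)
    ultimately show ?thesis unfolding partners_def vertices_def by blast
  qed
  define L where "L = (\<lambda>X::nat set. SOME xs. distinct xs \<and> set xs = X)"
  have L: "distinct (L X) \<and> set (L X) = X" if "finite X" for X
    unfolding L_def
    by (rule someI_ex[of "\<lambda>xs. distinct xs \<and> set xs = X"]) (use finite_distinct_list[OF that] in blast)
  define D where "D = (\<lambda>F::nat set set. SOME xs. distinct xs \<and> set xs = F)"
  have D: "distinct (D F) \<and> set (D F) = F" if "finite F" for F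
    unfolding D_def
    by (rule someI_ex[of "\<lambda>xs. distinct xs \<and> set xs = F"]) (use finite_distinct_list[OF that] in blast)
  define N where "N = Suc (2 ^ card ?V)"
  define K where "K = Suc (card ?V)"
  have finC: "finite (classes I u)" if "u \<in> ?V" for u
    by (rule finite_subset[of _ "Pow ?V"]) (use sub that finV in auto)
  have lenC: "length (D (classes I u)) < N" if "u \<in> ?V" for u
  proof -
    have "card (classes I u) \<le> card (Pow ?V)"
      using sub that finV by (intro card_mono) auto
    then show ?thesis
      using D[OF finC[OF that]] by (metis N_def card_Pow distinct_card finV less_Suc_eq_le)
  qed
  have lenL: "length (L C) < K" if "u \<in> ?V" "C \<in> classes I u" for u C
    using L[of C] sub[OF that] finV
    by (metis K_def card_mono distinct_card finite_subset less_Suc_eq_le)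
  have rank: "\<exists>k. has_rank I e k" if e: "e \<in> edges I" for e
  proof -
    obtain a p where ap: "e = (a, p)" by (cases e)
    then have "a \<in> applicants I" "p \<in> partners (edges I) a"
      using assms e by (auto simp: valid_instance_def partners_def)
    then have "p \<in> \<Union> (set (pref I a))"
      using assms by (simp add: valid_instance_def preference_list_def)
    then obtain i where "i < length (pref I a)" "p \<in> pref I a ! i"
      by (auto simp: in_set_conv_nth)
    then have "has_rank I e (Suc i)" by (simp add: ap has_rank_def)
    then show ?thesis ..
  qed
  define cl where "cl = (\<lambda>c. D (classes I (c div N)) ! (c mod N))"
  define s :: state where "s = (\<lambda>x i.
     if x = ''edge_count'' then length es
     else if x = ''edge_applicant'' then fst (es ! i)
     else if x = ''edge_post'' then snd (es ! i)
     else if x = ''edge_rank'' then (SOME k. has_rank I (es ! i) k)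
     else if x = ''quota'' then quota I i
     else if x = ''class_count'' then length (D (classes I i))
     else if x = ''class_start'' then i * N
     else if x = ''class_quota'' then class_quota I (i div N) (cl i)
     else if x = ''member_count'' then length (L (cl i))
     else if x = ''member_start'' then i * K
     else if x = ''member'' then L (cl (i div K)) ! (i mod K)
     else 0)"
  have E: "\<exists>es. distinct es \<and> set es = edges I \<and> s ''edge_count'' 0 = length es \<and>
        stores s ''edge_applicant'' 0 (map fst es) \<and> stores s ''edge_post'' 0 (map snd es) \<and>
        (\<forall>i<length es. has_rank I (es ! i) (s ''edge_rank'' i))"
  proof (intro exI[of _ es] conjI allI impI)
    fix i assume "i < length es"
    then have "\<exists>k. has_rank I (es ! i) k" using rank es(1) nth_mem by blast
    then show "has_rank I (es ! i) (s ''edge_rank'' i)"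
      by (simp add: s_def someI_ex)
  qed (use es in \<open>simp_all add: s_def stores_def\<close>)
  have C: "\<exists>Cs. distinct Cs \<and> set Cs = classes I u \<and> s ''class_count'' u = length Cs \<and>
        (\<forall>j<length Cs. let c = s ''class_start'' u + j in
           s ''class_quota'' c = class_quota I u (Cs ! j) \<and>
           (\<exists>xs. distinct xs \<and> set xs = Cs ! j \<and> s ''member_count'' c = length xs \<and>
              stores s ''member'' (s ''member_start'' c) xs))" if u: "u \<in> ?V" for u
  proof (intro exI[of _ "D (classes I u)"] conjI allI impI)
    fix j assume j: "j < length (D (classes I u))"
    then have jN: "j < N" using lenC[OF u] by simp
    let ?C = "D (classes I u) ! j"
    have mem: "?C \<in> classes I u" using j D[OF finC[OF u]] nth_mem by blast
    have finX: "finite ?C" using sub[OF u mem] finV finite_subset by blast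
    have div: "(u * N + j) div N = u" "(u * N + j) mod N = j" using jN by simp_all
    have cl: "cl (u * N + j) = ?C" by (simp only: cl_def div)
    have "stores s ''member'' ((u * N + j) * K) (L ?C)"
      unfolding stores_def
    proof (intro allI impI)
      fix i assume "i < length (L ?C)"
      then have "i < K" using lenL[OF u mem] by simp
      then have "((u * N + j) * K + i) div K = u * N + j" "((u * N + j) * K + i) mod K = i"
        by simp_all
      then show "s ''member'' ((u * N + j) * K + i) = L ?C ! i"
        by (simp add: s_def cl)
    qed
    then show "let c = s ''class_start'' u + j in
           s ''class_quota'' c = class_quota I u ?C \<and>
           (\<exists>xs. distinct xs \<and> set xs = ?C \<and> s ''member_count'' c = length xs \<and>
              stores s ''member'' (s ''member_start'' c) xs)"
      unfolding Let_def using L[OF finX]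
      by (intro conjI exI[of _ "L ?C"]) (simp_all add: s_def cl div(1))
  qed (use D[OF finC[OF u]] in \<open>simp_all add: s_def\<close>)
  have "encodes I s"
    unfolding encodes_def
  proof (intro conjI ballI allI impI)
    show "s ''quota'' u = quota I u" for u by (simp add: s_def)
    show "s x i = 0" if "x \<notin> input_arrays" for x i
      using that by (auto simp: input_arrays_def s_def)
  qed (use E C in auto)
  then show ?thesis by blast
qed

end

theory Submission
  imports Defs
begin

text \<open>
  A matching is a flow: for each vertex the root (its quota) and its classes form a forest ordered by
  inclusion, and an edge of the instance is a unit link from the smallest class of its applicant to
  the smallest class of its post.  Ranks are treated one after the other.  In stage \<open>k\<close> the flow is
  augmented along the links that are not frozen, using edges of rank at most \<open>k\<close>.  When the
  sink is out of reach, every link that crosses the boundary of the reachable set is frozen; an edge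
  of rank above \<open>k\<close> is frozen unless it leaves the reachable set.  This keeps the counts
  of the ranks up to \<open>k\<close> maximal for ever.

  The reason is linear programming duality.  With \<open>\<beta>\<close> larger than every count, the weights
  \<open>w\<^sub>k e = \<beta> * w\<^sub>k\<^sub>-\<^sub>1 e + (if rank e \<le> k then 1 else 0)\<close> order matchings lexicographically, and
  the potentials \<open>\<pi>' z = \<beta> * \<pi> z + (if z is reachable then 0 else 1)\<close> are an optimal dual solution at
  the end of stage \<open>k\<close>.  Exactly the links with nonzero reduced cost are frozen, and scaling
  by \<open>\<beta>\<close> preserves their signs, so the program needs the flags only, not the potentials.

  A laminar family of nonempty subsets of an \<open>n\<close>-set has at most \<open>2 * n\<close> members, so the network has
  size \<open>O(m)\<close>.  There are at most \<open>m\<close> augmentations and \<open>m\<close> stages, and each takes one search.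
\<close>

section \<open>Total correctness with running times\<close>

text \<open>The base \<beta> is \<open>m + 3\<close>. Besides exceeding every count it is at least
  3, while the end of a stage changes a reduced cost, apart from the scaling, by at most 2: one unit
  for the reachability of the ends, one for the rank. So a nonzero reduced cost keeps its sign, and
  frozen links never have to be released. An edge of rank above the current stage loses a unit
  through the new weight and regains it exactly when it leaves the reachable set; hence the
  asymmetric rule for it. Its reduced cost never becomes positive, so raising its capacity from 0 to
  1 later cannot break slackness. The obstacle to the time bound is the construction of the network:
  vertex names are unbounded, classes come in no order, and inserting them by size nests loops over
  sizes, classes and members. The cost stays quadratic because each insertion is charged to the node
  that it creates, and the scans over the classes of a vertex to the nodes of that vertex.\<close>

definition wp :: "com \<Rightarrow> (nat \<Rightarrow> state \<Rightarrow> bool) \<Rightarrow> state \<Rightarrow> bool" where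
  "wp c Q s \<longleftrightarrow> (\<exists>t s'. exec c s t s' \<and> Q t s')"

fun writes :: "com \<Rightarrow> vname set" where
  "writes Skip = {}"
| "writes (Write x i a) = {x}"
| "writes (Seq c d) = writes c \<union> writes d"
| "writes (Cond b c d) = writes c \<union> writes d"
| "writes (While b c) = writes c"

fun straight :: "com \<Rightarrow> bool" where
  "straight Skip = True"
| "straight (Write x i a) = True"
| "straight (Seq c d) = (straight c \<and> straight d)"
| "straight (Cond b c d) = (straight c \<and> straight d)"
| "straight (While b c) = False"

fun step :: "com \<Rightarrow> state \<Rightarrow> state" where
  "step Skip s = s"
| "step (Write x i a) s = s(x := (s x)(aval i s := aval a s))"
| "step (Seq c d) s = step d (step c s)"
| "step (Cond b c d) s = (if bval b s then step c s else step d s)"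
| "step (While b c) s = s"

text \<open>Both branches of a conditional are added, so that the bound simplifies to plain sums
  without a maximum. The value for loops is a dummy, as \<open>straight\<close> excludes
  them.\<close>

fun tmax :: "com \<Rightarrow> nat" where
  "tmax Skip = 1"
| "tmax (Write x i a) = 1 + acost i + acost a"
| "tmax (Seq c d) = tmax c + tmax d"
| "tmax (Cond b c d) = 1 + bcost b + tmax c + tmax d"
| "tmax (While b c) = 0"

lemma exec_frame: "exec c s t s' \<Longrightarrow> x \<notin> writes c \<Longrightarrow> s' x = s x"
  by (induction rule: exec.induct) auto

lemma exec_straight: "straight c \<Longrightarrow> \<exists>t\<le>tmax c. exec c s t (step c s)"
proof (induction c arbitrary: s)
  case (Seq c d)
  then obtain t t' where "t \<le> tmax c" "exec c s t (step c s)"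
    "t' \<le> tmax d" "exec d (step c s) t' (step d (step c s))" by fastforce
  then show ?case by (auto intro!: exI[of _ "t + t'"] exec.Seq)
next
  case (Cond b c d)
  then obtain t t' where "t \<le> tmax c" "exec c s t (step c s)"
    "t' \<le> tmax d" "exec d s t' (step d s)" by fastforce
  then show ?case
    using exec.CondTrue[of b s c t "step c s" d] exec.CondFalse[of b s d t' "step d s" c]
    by (cases "bval b s")
      (intro exI[of _ "1 + bcost b + t"], simp, intro exI[of _ "1 + bcost b + t'"], simp)
next
  case Skip
  show ?case using exec.Skip[of s] by (intro exI[of _ 1]) simp
next
  case (Write x i a)
  show ?case using exec.Write[of x i a s]
    by (intro exI[of _ "1 + acost i + acost a"]) (simp only: step.simps tmax.simps order_refl simp_thms)
qed simp

lemma wp_straight: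
  assumes "straight c" "\<And>t. t \<le> tmax c \<Longrightarrow> Q t (step c s)"
  shows "wp c Q s"
  using exec_straight[OF assms(1)] assms(2) unfolding wp_def by blast

lemma wp_mono: "wp c Q s \<Longrightarrow> (\<And>t s'. Q t s' \<Longrightarrow> R t s') \<Longrightarrow> wp c R s"
  unfolding wp_def by blast

lemma wp_frame:
  assumes "wp c Q s"
    and "\<And>t s'. Q t s' \<Longrightarrow> (\<And>x. x \<notin> writes c \<Longrightarrow> s' x = s x) \<Longrightarrow> R t s'"
  shows "wp c R s"
  using assms exec_frame unfolding wp_def by blast

lemma wp_Seq:
  assumes "wp c (\<lambda>t s'. wp d (\<lambda>t' s''. Q (t + t') s'') s') s"
  shows "wp (Seq c d) Q s"
  using assms exec.Seq unfolding wp_def by blast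

lemma wp_straight_Seq:
  assumes "straight c" "\<And>t. t \<le> tmax c \<Longrightarrow> wp d (\<lambda>t' s'. Q (t + t') s') (step c s)"
  shows "wp (Seq c d) Q s"
  by (intro wp_Seq wp_straight assms)

lemma wp_Cond:
  assumes "bval b s \<Longrightarrow> wp c (\<lambda>t s'. Q (1 + bcost b + t) s') s"
    and "\<not> bval b s \<Longrightarrow> wp d (\<lambda>t s'. Q (1 + bcost b + t) s') s"
  shows "wp (Cond b c d) Q s"
  using assms exec.CondTrue exec.CondFalse unfolding wp_def by (cases "bval b s"; blast)

text \<open>\<Phi> is time paid in advance: body and successful test of a round are paid out of its
  decrease, and \<open>1 + bcost b\<close> is the final failing test. As every round costs at least
  one unit, the same \<Phi> proves termination.\<close>

lemma wp_While:
  fixes \<Phi> :: "state \<Rightarrow> nat"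
  assumes J: "J s"
    and body: "\<And>s'. J s' \<Longrightarrow> bval b s' \<Longrightarrow> (\<And>x. x \<notin> writes c \<Longrightarrow> s' x = s x) \<Longrightarrow>
      wp c (\<lambda>t s''. J s'' \<and> t + 1 + bcost b + \<Phi> s'' \<le> \<Phi> s') s'"
    and post: "\<And>t s'. J s' \<Longrightarrow> \<not> bval b s' \<Longrightarrow> (\<And>x. x \<notin> writes c \<Longrightarrow> s' x = s x) \<Longrightarrow>
      t \<le> \<Phi> s + 1 + bcost b \<Longrightarrow> Q t s'"
  shows "wp (While b c) Q s"
proof -
  have "\<exists>t s''. exec (While b c) s' t s'' \<and> J s'' \<and> \<not> bval b s'' \<and>
      (\<forall>x. x \<notin> writes c \<longrightarrow> s'' x = s x) \<and> t \<le> \<Phi> s' + 1 + bcost b"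
    if "J s'" "\<forall>x. x \<notin> writes c \<longrightarrow> s' x = s x" for s'
    using that
  proof (induction "\<Phi> s'" arbitrary: s' rule: less_induct)
    case less
    show ?case
    proof (cases "bval b s'")
      case False
      then show ?thesis using less.prems exec.WhileFalse by fastforce
    next
      case True
      then obtain t s1 where 1: "exec c s' t s1" "J s1" "t + 1 + bcost b + \<Phi> s1 \<le> \<Phi> s'"
        using body[of s'] less.prems unfolding wp_def by blast
      have "\<forall>x. x \<notin> writes c \<longrightarrow> s1 x = s x" using exec_frame[OF 1(1)] less.prems by simp
      then obtain t' s2 where 2: "exec (While b c) s1 t' s2" "J s2" "\<not> bval b s2"
        "\<forall>x. x \<notin> writes c \<longrightarrow> s2 x = s x" "t' \<le> \<Phi> s1 + 1 + bcost b"
        using less.hyps[of s1] 1 by auto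
      show ?thesis
        using exec.WhileTrue[OF True 1(1) 2(1)] 2 1(3)
        by (intro exI[of _ "1 + bcost b + t + t'"] exI[of _ s2]) auto
    qed
  qed
  then show ?thesis using J post unfolding wp_def by blast
qed

section \<open>Notation and counting loops\<close>

abbreviation V :: "vname \<Rightarrow> aexp" where "V x \<equiv> Read x (Num 0)"
abbreviation assign :: "vname \<Rightarrow> aexp \<Rightarrow> com" (infix "::=" 61) where
  "x ::= a \<equiv> Write x (Num 0) a"
notation Seq (infixr ";;" 60)

definition For :: "vname \<Rightarrow> aexp \<Rightarrow> com \<Rightarrow> com" where
  "For x e c = (x ::= Num 0;; While (Less (V x) e) (c;; x ::= Add (V x) (Num 1)))"

lemma writes_For [simp]: "writes (For x e c) = insert x (writes c)"
  by (auto simp: For_def)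

text \<open>The invariant carries the time spent so far, so that rounds of different cost can be
  amortised. A round adds the test, \<open>acost e + 4\<close>, and the increment, 6, to the cost of
  the body; the initialisation and the last test together fit into the same
  \<open>acost e + 10\<close>.\<close>

lemma wp_For:
  assumes fresh: "x \<notin> writes c"
    and e: "\<And>s'. (\<And>y. y \<notin> insert x (writes c) \<Longrightarrow> s' y = s y) \<Longrightarrow> aval e s' = n"
    and init: "I 0 0 (s(x := (s x)(0 := 0)))"
    and body: "\<And>k t s'. k < n \<Longrightarrow> I k t s' \<Longrightarrow> s' x 0 = k \<Longrightarrow>
      (\<And>y. y \<notin> insert x (writes c) \<Longrightarrow> s' y = s y) \<Longrightarrow>
      wp c (\<lambda>t' s''. I (Suc k) (t + t' + acost e + 10) (s''(x := (s'' x)(0 := Suc k)))) s'"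
    and post: "\<And>t t' s'. I n t s' \<Longrightarrow> (\<And>y. y \<notin> insert x (writes c) \<Longrightarrow> s' y = s y) \<Longrightarrow>
      t' \<le> t + acost e + 10 \<Longrightarrow> Q t' s'"
  shows "wp (For x e c) Q s"
proof -
  let ?W = "While (Less (V x) e) (c;; x ::= Add (V x) (Num 1))"
  have "\<exists>t' s''. exec ?W s' t' s'' \<and> (\<forall>y. y \<notin> insert x (writes c) \<longrightarrow> s'' y = s y) \<and>
     (\<exists>t''. I n t'' s'' \<and> t + t' \<le> t'' + acost e + 4)"
    if "I k t s'" "s' x 0 = k" "k \<le> n" "\<forall>y. y \<notin> insert x (writes c) \<longrightarrow> s' y = s y" for s' k t
    using that
  proof (induction "n - k" arbitrary: k t s')
    case 0
    then have "\<not> bval (Less (V x) e) s'" using e[of s'] by simp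
    from exec.WhileFalse[OF this] have "exec ?W s' (4 + acost e) s'" by (simp add: eval_nat_numeral)
    then show ?case using 0 by (intro exI[of _ "4 + acost e"] exI[of _ s']) auto
  next
    case (Suc d)
    then have k: "k < n" by simp
    have d: "d = n - Suc k" using Suc.hyps(2) by simp
    have b: "bval (Less (V x) e) s'" using e[of s'] Suc.prems k by simp
    obtain t1 s1 where 1: "exec c s' t1 s1"
        "I (Suc k) (t + t1 + acost e + 10) (s1(x := (s1 x)(0 := Suc k)))"
      using body[OF k Suc.prems(1,2)] Suc.prems(4) unfolding wp_def by blast
    let ?s2 = "s1(x := (s1 x)(0 := Suc k))"
    have "s1 x = s' x" using exec_frame[OF 1(1) fresh] .
    then have "exec (x ::= Add (V x) (Num 1)) s1 6 ?s2"
      using exec.Write[of x "Num 0" "Add (V x) (Num 1)" s1] Suc.prems(2)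
      by (simp add: eval_nat_numeral)
    from exec.Seq[OF 1(1) this] have 2: "exec (c;; x ::= Add (V x) (Num 1)) s' (t1 + 6) ?s2" .
    have "\<forall>y. y \<notin> insert x (writes c) \<longrightarrow> ?s2 y = s y"
      using exec_frame[OF 1(1)] Suc.prems(4) by auto
    then obtain t' s3 t'' where 3: "exec ?W ?s2 t' s3"
      "\<forall>y. y \<notin> insert x (writes c) \<longrightarrow> s3 y = s y" "I n t'' s3"
      "t + t1 + acost e + 10 + t' \<le> t'' + acost e + 4"
      using Suc.hyps(1)[OF d 1(2)] k by (auto simp del: fun_upd_apply simp: fun_upd_same)
    have "exec ?W s' (1 + bcost (Less (V x) e) + (t1 + 6) + t') s3"
      using exec.WhileTrue[OF b 2 3(1)] .
    then show ?case using 3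
      by (intro exI[of _ "1 + bcost (Less (V x) e) + (t1 + 6) + t'"] exI[of _ s3]) auto
  qed
  from this[OF init] obtain t' s'' t'' where r: "exec ?W (s(x := (s x)(0 := 0))) t' s''"
    "\<forall>y. y \<notin> insert x (writes c) \<longrightarrow> s'' y = s y" "I n t'' s''" "t' \<le> t'' + acost e + 4"
    by auto
  have "exec (x ::= Num 0) s 3 (s(x := (s x)(0 := 0)))"
    using exec.Write[of x "Num 0" "Num 0" s] by (simp add: eval_nat_numeral)
  from exec.Seq[OF this r(1)] have "exec (For x e c) s (3 + t') s''" unfolding For_def .
  then show ?thesis using post[OF r(3), of "3 + t'"] r unfolding wp_def by fastforce
qed

lemma wp_For_const:
  assumes fresh: "x \<notin> writes c"
    and e: "\<And>s'. (\<And>y. y \<notin> insert x (writes c) \<Longrightarrow> s' y = s y) \<Longrightarrow> aval e s' = n"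
    and init: "I 0 (s(x := (s x)(0 := 0)))"
    and body: "\<And>k s'. k < n \<Longrightarrow> I k s' \<Longrightarrow> s' x 0 = k \<Longrightarrow>
      (\<And>y. y \<notin> insert x (writes c) \<Longrightarrow> s' y = s y) \<Longrightarrow>
      wp c (\<lambda>t' s''. t' \<le> b \<and> I (Suc k) (s''(x := (s'' x)(0 := Suc k)))) s'"
    and post: "\<And>t s'. I n s' \<Longrightarrow> (\<And>y. y \<notin> insert x (writes c) \<Longrightarrow> s' y = s y) \<Longrightarrow>
      t \<le> Suc n * (b + acost e + 10) \<Longrightarrow> Q t s'"
  shows "wp (For x e c) Q s"
proof (rule wp_For[OF fresh e, where I = "\<lambda>k t s. I k s \<and> t \<le> k * (b + acost e + 10)"])
  fix k t s' assume "k < n" "I k s' \<and> t \<le> k * (b + acost e + 10)" "s' x 0 = k"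
    and "\<And>y. y \<notin> insert x (writes c) \<Longrightarrow> s' y = s y"
  then show "wp c (\<lambda>t' s''. I (Suc k) (s''(x := (s'' x)(0 := Suc k))) \<and>
      t + t' + acost e + 10 \<le> Suc k * (b + acost e + 10)) s'"
    by (intro wp_mono[OF body]) auto
qed (use init post in auto)

section \<open>Flow networks of edges and laminar classes\<close>

declare add_2_eq_Suc [simp del] add_2_eq_Suc' [simp del]

text \<open>The path from \<open>z\<close> towards the root, which lies below \<open>n\<close> and
  is left out. The guard \<open>C z < z\<close> makes the recursion terminate for arbitrary array
  contents; in the forests parents have smaller numbers, so it never cuts a path short.\<close>

function anc :: "nat \<Rightarrow> (nat \<Rightarrow> nat) \<Rightarrow> nat \<Rightarrow> nat set" where
  "anc n C z = (if n \<le> z \<and> C z < z then insert z (anc n C (C z)) else {})"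
  by pat_completeness auto
termination by (relation "measure (\<lambda>(n, C, z). z)") auto

declare anc.simps [simp del]

lemma anc_cong: "(\<And>y. n \<le> y \<Longrightarrow> y \<le> z \<Longrightarrow> C y = C' y) \<Longrightarrow> anc n C z = anc n C' z"
proof (induction z rule: less_induct)
  case (less z)
  have "anc n C (C z) = anc n C' (C z)" if "n \<le> z" "C z < z"
    using less.prems that by (intro less.IH) auto
  then show ?case using less.prems[of z] by (subst (1 2) anc.simps) auto
qed

lemma anc_bounds: "x \<in> anc n C z \<Longrightarrow> n \<le> x \<and> x \<le> z"
proof (induction z rule: less_induct)
  case (less z)
  from less.prems have "n \<le> z \<and> C z < z \<and> (x = z \<or> x \<in> anc n C (C z))"
    by (subst (asm) anc.simps) (auto split: if_splits)
  then show ?case using less.IH[of "C z"] by auto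
qed

lemma finite_anc [simp]: "finite (anc n C z)"
  by (rule finite_subset[of _ "{..z}"]) (use anc_bounds in auto)

lemma anc_telescope:
  fixes \<pi> :: "nat \<Rightarrow> int"
  assumes "\<And>x. n \<le> x \<Longrightarrow> x \<le> z \<Longrightarrow> C x = r \<or> n \<le> C x \<and> C x < x" "r < n" "n \<le> z"
  shows "(\<Sum>x\<in>anc n C z. \<pi> x - \<pi> (C x)) = \<pi> z - \<pi> r"
  using assms
proof (induction z rule: less_induct)
  case (less z)
  have lt: "C z < z" using less.prems(1)[of z] less.prems(2,3) by auto
  have notin: "z \<notin> anc n C (C z)" using anc_bounds[of z n C "C z"] lt by auto
  have "(\<Sum>x\<in>anc n C (C z). \<pi> x - \<pi> (C x)) = \<pi> (C z) - \<pi> r"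
  proof (cases "C z = r")
    case True
    then show ?thesis using less.prems(2) by (subst anc.simps) simp
  next
    case False
    then have "n \<le> C z" using less.prems(1)[of z] less.prems(2,3) by auto
    then show ?thesis using less.IH[OF lt] less.prems lt by auto
  qed
  then show ?case using lt notin less.prems(3) by (subst anc.simps) simp
qed

text \<open>
  Link \<open>j < m\<close> is the \<open>j\<close>-th edge of the instance; \<open>m\<close> and \<open>m + 1\<close> are the source and the sink.  Every
  other node \<open>x\<close> has exactly one link towards its root, also called \<open>x\<close>: it enters \<open>x\<close> in the
  forest of the applicants (\<open>x < n1\<close>) and leaves \<open>x\<close> in the forest of the posts.
\<close>

locale net =
  fixes m n1 n2 :: nat and tl hd :: "nat \<Rightarrow> nat" and Q rank :: "nat \<Rightarrow> nat"
  assumes n1: "m + 2 \<le> n1" and n2: "n1 \<le> n2"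
    and left: "\<And>x. m + 2 \<le> x \<Longrightarrow> x < n1 \<Longrightarrow> hd x = x \<and> (tl x = m \<or> m + 2 \<le> tl x \<and> tl x < x)"
    and right: "\<And>x. n1 \<le> x \<Longrightarrow> x < n2 \<Longrightarrow> tl x = x \<and> (hd x = m + 1 \<or> n1 \<le> hd x \<and> hd x < x)"
    and edge: "\<And>j. j < m \<Longrightarrow> m + 2 \<le> tl j \<and> tl j < n1 \<and> n1 \<le> hd j \<and> hd j < n2"
    and rank: "\<And>j. j < m \<Longrightarrow> 1 \<le> rank j \<and> rank j \<le> m"
begin

definition "tree = {m + 2..<n2}"
definition "links = {..<m} \<union> tree"

definition below :: "nat \<Rightarrow> nat \<Rightarrow> bool" where
  "below x z \<longleftrightarrow> (if x < n1 then x \<in> anc (m + 2) tl z else x \<in> anc n1 hd z)"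

definition L :: "nat \<Rightarrow> nat set" where
  "L x = {j. j < m \<and> (if x < n1 then x \<in> anc (m + 2) tl (tl j) else x \<in> anc n1 hd (hd j))}"

lemma anc_left_outside:
  assumes "z \<le> m + 1 \<or> n1 \<le> z \<and> z < n2"
  shows "anc (m + 2) tl z = {}"
  using assms right[of z] by (subst anc.simps) auto

lemma anc_right_outside:
  assumes "z < n1"
  shows "anc n1 hd z = {}"
  using assms by (subst anc.simps) auto

text \<open>Value of the cut around the subtree of \<open>x\<close>, signed so that link \<open>x\<close> itself counts \<open>1\<close>.\<close>

definition g :: "nat \<Rightarrow> nat \<Rightarrow> int" where
  "g x z = (if below x z then (if x < n1 then - 1 else 1) else 0)"

text \<open>The only links crossing the boundary of the subtree of \<open>x\<close> are
  \<open>x\<close> itself and the edges in \<open>L x\<close>, in opposite directions; every other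
  link has both ends inside or both outside.\<close>

lemma g_link:
  assumes j: "j \<in> links" and x: "x \<in> tree"
  shows "g x (tl j) - g x (hd j) = (if j = x then 1 else if j \<in> L x then - 1 else 0)"
proof -
  consider (E) "j < m" | (LL) "m + 2 \<le> j" "j < n1" | (RR) "n1 \<le> j" "j < n2"
    using j n1 n2 by (fastforce simp: links_def tree_def)
  then show ?thesis
  proof cases
    case E
    then have "j \<noteq> x" using x by (auto simp: tree_def)
    moreover have "anc (m + 2) tl (hd j) = {}" using edge[OF E] by (intro anc_left_outside) auto
    moreover have "anc n1 hd (tl j) = {}" using edge[OF E] by (intro anc_right_outside) auto
    ultimately show ?thesis using E by (auto simp: g_def below_def L_def)
  next
    case LL
    note l = left[OF LL]
    have "anc (m + 2) tl (hd j) = insert j (anc (m + 2) tl (tl j))"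
      using l LL by (subst anc.simps) auto
    moreover have "j \<notin> anc (m + 2) tl (tl j)" using l LL anc_bounds[of j "m + 2" tl "tl j"] by auto
    moreover have "anc n1 hd (tl j) = {}" "anc n1 hd (hd j) = {}"
      using l LL n1 by (auto intro!: anc_right_outside)
    ultimately show ?thesis using LL by (auto simp: g_def below_def L_def)
  next
    case RR
    note r = right[OF RR]
    have "anc n1 hd (tl j) = insert j (anc n1 hd (hd j))"
      using r RR n1 by (subst anc.simps) auto
    moreover have "j \<notin> anc n1 hd (hd j)" using r RR n1 anc_bounds[of j n1 hd "hd j"] by auto
    moreover have "anc (m + 2) tl (tl j) = {}" "anc (m + 2) tl (hd j) = {}"
      using r RR n1 by (auto intro!: anc_left_outside)
    ultimately show ?thesis using RR n1 by (auto simp: g_def below_def L_def)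
  qed
qed

lemma g_ends: "g x m = 0" "g x (m + 1) = 0"
  using n1 by (auto simp: g_def below_def anc_left_outside anc_right_outside)

text \<open>Indicator of the cut that only the edges of the instance cross. It ties the number of
  edges in use to the value of the flow.\<close>

definition appl_side :: "nat \<Rightarrow> int" where
  "appl_side z = (if z = m \<or> m + 2 \<le> z \<and> z < n1 then 1 else 0)"

lemma appl_side_link:
  assumes "j \<in> links"
  shows "appl_side (tl j) - appl_side (hd j) = (if j < m then 1 else 0)"
proof -
  consider (edge) "j < m" | (left) "m + 2 \<le> j" "j < n1" | (right) "n1 \<le> j" "j < n2"
    using assms n1 n2 by (fastforce simp: links_def tree_def)
  then show ?thesis
    using edge[of j] left[of j] right[of j] n1 by cases (auto simp: appl_side_def)
qed

definition chosen :: "(nat \<Rightarrow> nat) \<Rightarrow> nat set" where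
  "chosen f = {j. j < m \<and> f j = 1}"

definition fits :: "nat set \<Rightarrow> bool" where
  "fits X \<longleftrightarrow> X \<subseteq> {..<m} \<and> (\<forall>x\<in>tree. card (X \<inter> L x) \<le> Q x)"

text \<open>\<open>f\<close> becomes a flow when one unit is sent from the source to \<open>y\<close>.\<close>

definition balanced :: "(nat \<Rightarrow> nat) \<Rightarrow> nat \<Rightarrow> bool" where
  "balanced f y \<longleftrightarrow> (\<forall>x\<in>tree. int (f x) = 1 + (\<Sum>j\<in>L x. int (f j)) + g x y)"

lemma finite_L [simp]: "finite (L x)" by (simp add: L_def)

lemma L_less: "j \<in> L x \<Longrightarrow> j < m" by (simp add: L_def)

lemma sum_upd:
  fixes f :: "nat \<Rightarrow> nat"
  assumes "finite A"
  shows "(\<Sum>i\<in>A. int ((f(j := v)) i)) = (\<Sum>i\<in>A. int (f i)) + (if j \<in> A then int v - int (f j) else 0)"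
proof (cases "j \<in> A")
  case True
  then show ?thesis using assms by (simp add: sum.remove)
next
  case False
  then have "(\<Sum>i\<in>A. int ((f(j := v)) i)) = (\<Sum>i\<in>A. int (f i))" by (intro sum.cong) auto
  then show ?thesis using False by simp
qed

text \<open>Changing one link by one unit affects just the cuts that it crosses, and by
  \<open>g_link\<close> in the same way as moving the end of the missing unit along the
  link.\<close>

lemma balanced_step:
  assumes bal: "balanced f y" and j: "j \<in> links"
    and s: "y = hd j \<and> y' = tl j \<and> v = f j + 1 \<or> y = tl j \<and> y' = hd j \<and> f j > 0 \<and> v = f j - 1"
  shows "balanced (f(j := v)) y'"
    and "(\<Sum>i<m. int ((f(j := v)) i)) - appl_side y' = (\<Sum>i<m. int (f i)) - appl_side y"
proof -
  show "balanced (f(j := v)) y'"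
    unfolding balanced_def
  proof
    fix x assume x: "x \<in> tree"
    then have xm: "x \<notin> L x" by (auto simp: tree_def L_def)
    have "int (f x) = 1 + (\<Sum>j\<in>L x. int (f j)) + g x y" using bal x by (simp add: balanced_def)
    moreover have "(\<Sum>i\<in>L x. int ((f(j := v)) i)) = (\<Sum>i\<in>L x. int (f i)) + (if j \<in> L x then int v - int (f j) else 0)"
      by (rule sum_upd) simp
    ultimately show "int ((f(j := v)) x) = 1 + (\<Sum>i\<in>L x. int ((f(j := v)) i)) + g x y'"
      using g_link[OF j x] s xm by (auto simp del: fun_upd_apply simp: fun_upd_same fun_upd_other split: if_splits)
  qed
  have "(\<Sum>i<m. int ((f(j := v)) i)) = (\<Sum>i<m. int (f i)) + (if j \<in> {..<m} then int v - int (f j) else 0)"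
    by (rule sum_upd) simp
  then show "(\<Sum>i<m. int ((f(j := v)) i)) - appl_side y' = (\<Sum>i<m. int (f i)) - appl_side y"
    using appl_side_link[OF j] s by (auto simp del: fun_upd_apply split: if_splits)
qed

text \<open>Reduced cost for potential \<pi> and edge lengths \<open>d\<close>, with the sign chosen
  so that a positive value calls for a full link and a negative one for an empty link.\<close>

definition \<rho> :: "(nat \<Rightarrow> int) \<Rightarrow> (nat \<Rightarrow> int) \<Rightarrow> nat \<Rightarrow> int" where
  "\<rho> \<pi> d j = \<pi> (hd j) - \<pi> (tl j) - (if j < m then d j else 0)"

text \<open>Exactly one path from source to sink uses edge \<open>j\<close>: the nodes
  \<open>x\<close> with \<open>j \<in> L x\<close> are those on the root paths of its two ends.
  Along this path the potentials telescope.\<close>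

lemma \<rho>_chain:
  assumes "j < m"
  shows "\<pi> (m + 1) - \<pi> m - d j = \<rho> \<pi> d j + (\<Sum>x\<in>{x\<in>tree. j \<in> L x}. \<rho> \<pi> d x)"
proof -
  note e = edge[OF assms]
  have A: "(\<Sum>x\<in>anc (m + 2) tl (tl j). \<pi> x - \<pi> (tl x)) = \<pi> (tl j) - \<pi> m"
    by (rule anc_telescope) (use left e in auto)
  have "(\<Sum>x\<in>anc n1 hd (hd j). \<pi> x - \<pi> (hd x)) = \<pi> (hd j) - \<pi> (m + 1)"
    by (rule anc_telescope) (use right e n1 in auto)
  then have B: "(\<Sum>x\<in>anc n1 hd (hd j). \<pi> (hd x) - \<pi> x) = \<pi> (m + 1) - \<pi> (hd j)"
    by (simp add: sum_subtractf)
  have bl: "m + 2 \<le> x \<and> x < n1" if "x \<in> anc (m + 2) tl (tl j)" for x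
    using anc_bounds[OF that] e by auto
  have br: "n1 \<le> x \<and> x < n2" if "x \<in> anc n1 hd (hd j)" for x
    using anc_bounds[OF that] e by auto
  have split: "{x\<in>tree. j \<in> L x} = anc (m + 2) tl (tl j) \<union> anc n1 hd (hd j)"
  proof (rule set_eqI)
    show "x \<in> {x\<in>tree. j \<in> L x} \<longleftrightarrow> x \<in> anc (m + 2) tl (tl j) \<union> anc n1 hd (hd j)" for x
      using bl[of x] br[of x] assms n1 n2 by (auto simp: tree_def L_def)
  qed
  have "(\<Sum>x\<in>{x\<in>tree. j \<in> L x}. \<rho> \<pi> d x) =
      (\<Sum>x\<in>anc (m + 2) tl (tl j). \<rho> \<pi> d x) + (\<Sum>x\<in>anc n1 hd (hd j). \<rho> \<pi> d x)"
    unfolding split using bl br by (intro sum.union_disjoint) fastforce+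
  also have "(\<Sum>x\<in>anc (m + 2) tl (tl j). \<rho> \<pi> d x) = (\<Sum>x\<in>anc (m + 2) tl (tl j). \<pi> x - \<pi> (tl x))"
    using bl left by (intro sum.cong) (fastforce simp: \<rho>_def)+
  also have "(\<Sum>x\<in>anc n1 hd (hd j). \<rho> \<pi> d x) = (\<Sum>x\<in>anc n1 hd (hd j). \<pi> (hd x) - \<pi> x)"
    using br right n1 by (intro sum.cong) (fastforce simp: \<rho>_def)+
  finally show ?thesis using A B assms by (simp add: \<rho>_def)
qed

lemma sum_\<rho>_swap:
  assumes "finite X"
  shows "(\<Sum>j\<in>X. \<Sum>x\<in>{x\<in>tree. j \<in> L x}. r x) = (\<Sum>x\<in>tree. r x * int (card (X \<inter> L x)))"
proof -
  have [simp]: "finite tree" by (simp add: tree_def)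
  have "(\<Sum>j\<in>X. \<Sum>x\<in>{x\<in>tree. j \<in> L x}. r x) = (\<Sum>j\<in>X. \<Sum>x\<in>tree. if j \<in> L x then r x else 0)"
    by (simp add: sum.inter_filter)
  also have "\<dots> = (\<Sum>x\<in>tree. \<Sum>j\<in>X. if j \<in> L x then r x else 0)"
    by (rule sum.swap)
  also have "\<dots> = (\<Sum>x\<in>tree. \<Sum>j\<in>X \<inter> L x. r x)"
    using assms by (intro sum.cong refl sum.inter_restrict[symmetric])
  finally show ?thesis by (simp add: mult.commute)
qed

text \<open>Linear programming duality: \<open>\<rho>\<close> is a dual solution that satisfies complementary slackness.\<close>

lemma optimal:
  assumes X: "fits X" and M: "M \<subseteq> {..<m}"
    and tree: "\<And>x. x \<in> tree \<Longrightarrow> \<rho> \<pi> d x \<ge> 0 \<and> (\<rho> \<pi> d x > 0 \<longrightarrow> card (M \<inter> L x) = Q x)"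
    and edges: "\<And>j. j < m \<Longrightarrow> (\<rho> \<pi> d j > 0 \<longrightarrow> j \<in> M) \<and> (\<rho> \<pi> d j < 0 \<longrightarrow> j \<notin> M)"
  shows "(\<Sum>j\<in>X. \<pi> (m + 1) - \<pi> m - d j) \<le> (\<Sum>j\<in>M. \<pi> (m + 1) - \<pi> m - d j)"
proof -
  have XM: "X \<subseteq> {..<m}" using X by (simp add: fits_def)
  have fin: "finite X" "finite M" using XM M finite_subset by blast+
  \<comment> \<open>The weight of an edge is spread over its path, so a set of edges is worth its
    own reduced costs plus, for every node, reduced cost times load.\<close>
  have eq: "(\<Sum>j\<in>Y. \<pi> (m + 1) - \<pi> m - d j) =
      (\<Sum>j\<in>Y. \<rho> \<pi> d j) + (\<Sum>x\<in>local.tree. \<rho> \<pi> d x * int (card (Y \<inter> L x)))"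
    if "Y \<subseteq> {..<m}" for Y
  proof -
    have "finite Y" using that finite_subset by blast
    then have "(\<Sum>x\<in>local.tree. \<rho> \<pi> d x * int (card (Y \<inter> L x))) =
        (\<Sum>j\<in>Y. \<Sum>x\<in>{x\<in>local.tree. j \<in> L x}. \<rho> \<pi> d x)"
      using sum_\<rho>_swap by simp
    moreover have "(\<Sum>j\<in>Y. \<pi> (m + 1) - \<pi> m - d j) =
        (\<Sum>j\<in>Y. \<rho> \<pi> d j + (\<Sum>x\<in>{x\<in>local.tree. j \<in> L x}. \<rho> \<pi> d x))"
      using that \<rho>_chain by (intro sum.cong) auto
    ultimately show ?thesis by (simp add: sum.distrib)
  qed
  \<comment> \<open>Where the multiplier is positive, \<open>M\<close> attains the quota that bounds
    the load of \<open>X\<close>.\<close>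
  have "(\<Sum>x\<in>local.tree. \<rho> \<pi> d x * int (card (X \<inter> L x))) \<le>
      (\<Sum>x\<in>local.tree. \<rho> \<pi> d x * int (card (M \<inter> L x)))"
  proof (rule sum_mono)
    fix x assume x: "x \<in> local.tree"
    have "card (X \<inter> L x) \<le> Q x" using X x by (simp add: fits_def)
    then show "\<rho> \<pi> d x * int (card (X \<inter> L x)) \<le> \<rho> \<pi> d x * int (card (M \<inter> L x))"
      using tree[OF x] by (cases "\<rho> \<pi> d x = 0") (auto intro!: mult_left_mono)
  qed
  moreover have "(\<Sum>j\<in>X. \<rho> \<pi> d j) \<le> (\<Sum>j\<in>M. \<rho> \<pi> d j)"
  proof -
    have "(\<Sum>j\<in>X. \<rho> \<pi> d j) = (\<Sum>j<m. if j \<in> X then \<rho> \<pi> d j else 0)"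
      "(\<Sum>j\<in>M. \<rho> \<pi> d j) = (\<Sum>j<m. if j \<in> M then \<rho> \<pi> d j else 0)"
      using XM M by (simp_all add: sum.If_cases Int_absorb1)
    moreover have "(\<Sum>j<m. if j \<in> X then \<rho> \<pi> d j else 0) \<le> (\<Sum>j<m. if j \<in> M then \<rho> \<pi> d j else 0)"
    proof (rule sum_mono)
      fix j assume "j \<in> {..<m}"
      then show "(if j \<in> X then \<rho> \<pi> d j else 0) \<le> (if j \<in> M then \<rho> \<pi> d j else 0)"
        using edges[of j] by (cases "\<rho> \<pi> d j" "0::int" rule: linorder_cases) auto
    qed
    ultimately show ?thesis by simp
  qed
  ultimately show ?thesis using eq[OF XM] eq[OF M] by simp
qed

section \<open>Lexicographic weights\<close>

text \<open>\<open>horizon k - delay k j\<close> is the weight of edge \<open>j\<close> after stage \<open>k\<close>.\<close>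

fun delay :: "nat \<Rightarrow> nat \<Rightarrow> int" where
  "delay 0 j = 0"
| "delay (Suc k) j = int (m + 3) * delay k j + (if rank j > Suc k then 1 else 0)"

text \<open>At the end of every stage the sink is unreachable, so the update of the potentials adds
  1 to its scaled value. With the source kept at 0, this recursion gives its potential.\<close>

fun horizon :: "nat \<Rightarrow> int" where
  "horizon 0 = 0"
| "horizon (Suc k) = int (m + 3) * horizon k + 1"

definition count :: "nat \<Rightarrow> nat set \<Rightarrow> nat" where
  "count k X = card {j \<in> X. rank j = k}"

lemma weight_Suc:
  assumes "X \<subseteq> {..<m}"
  shows "(\<Sum>j\<in>X. horizon (Suc k) - delay (Suc k) j) =
    int (m + 3) * (\<Sum>j\<in>X. horizon k - delay k j) + int (card {j\<in>X. rank j \<le> Suc k})"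
proof -
  have "finite X" using assms finite_subset by blast
  then have "int (card {j\<in>X. rank j \<le> Suc k}) = (\<Sum>j\<in>X. if rank j \<le> Suc k then 1 else 0)"
    by (simp add: sum.If_cases Int_def)
  then have "int (m + 3) * (\<Sum>j\<in>X. horizon k - delay k j) + int (card {j\<in>X. rank j \<le> Suc k}) =
      (\<Sum>j\<in>X. int (m + 3) * (horizon k - delay k j) + (if rank j \<le> Suc k then 1 else 0))"
    by (simp only: sum_distrib_left sum.distrib)
  also have "\<dots> = (\<Sum>j\<in>X. horizon (Suc k) - delay (Suc k) j)"
    by (intro sum.cong) (auto simp: algebra_simps)
  finally show ?thesis by simp
qed

lemma card_rank_le:
  assumes "X \<subseteq> {..<m}"
  shows "card {j\<in>X. rank j \<le> k} = (\<Sum>i=1..k. count i X)"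
proof -
  have "finite X" using assms finite_subset by blast
  have "{j\<in>X. rank j \<le> k} = (\<Union>i\<in>{1..k}. {j\<in>X. rank j = i})" using rank assms by force
  also have "card \<dots> = (\<Sum>i=1..k. card {j\<in>X. rank j = i})"
    using \<open>finite X\<close> by (intro card_UN_disjoint) auto
  finally show ?thesis by (simp add: count_def)
qed

text \<open>The weights \<open>horizon - delay\<close> order matchings lexicographically since \<open>m + 3\<close> exceeds every count.\<close>

lemma weight_lex:
  assumes X: "X \<subseteq> {..<m}" and Y: "Y \<subseteq> {..<m}" and \<kappa>: "1 \<le> \<kappa>" "\<kappa> \<le> m"
    and eq: "\<And>i. 1 \<le> i \<Longrightarrow> i < \<kappa> \<Longrightarrow> count i X = count i Y" and gt: "count \<kappa> X > count \<kappa> Y"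
  shows "(\<Sum>j\<in>X. horizon m - delay m j) > (\<Sum>j\<in>Y. horizon m - delay m j)"
proof -
  let ?w = "\<lambda>k Z. (\<Sum>j\<in>Z. horizon k - delay k j)"
  have same: "?w k X = ?w k Y" if "k < \<kappa>" for k
    using that
  proof (induction k)
    case (Suc k)
    have "(\<Sum>i=1..Suc k. count i X) = (\<Sum>i=1..Suc k. count i Y)"
      using Suc.prems eq by (intro sum.cong) auto
    then show ?case using Suc weight_Suc[OF X, of k] weight_Suc[OF Y, of k] card_rank_le[OF X] card_rank_le[OF Y]
      by simp
  qed simp
  \<comment> \<open>Once there is a lead of at least 1, scaling turns it into at least
    \<open>m + 3\<close>, while a later count can win back at most \<open>m\<close>.\<close>
  have "?w k X \<ge> ?w k Y + 1" if "\<kappa> \<le> k" for k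
    using that
  proof (induction k rule: dec_induct)
    case base
    obtain l where l: "\<kappa> = Suc l" using \<kappa> by (cases \<kappa>) auto
    have "(\<Sum>i=1..l. count i X) = (\<Sum>i=1..l. count i Y)"
      using eq l by (intro sum.cong) auto
    then have "card {j\<in>X. rank j \<le> Suc l} > card {j\<in>Y. rank j \<le> Suc l}"
      using gt l unfolding card_rank_le[OF X] card_rank_le[OF Y] by simp
    then show ?case using same[of l] weight_Suc[OF X, of l] weight_Suc[OF Y, of l] l by simp
  next
    case (step k)
    have "card {j\<in>Y. rank j \<le> Suc k} \<le> card {..<m}"
      using Y by (intro card_mono) auto
    moreover have "int (m + 3) * (?w k Y + 1) \<le> int (m + 3) * ?w k X"
      using step.IH by (intro mult_left_mono) auto
    ultimately show ?case using weight_Suc[OF X, of k] weight_Suc[OF Y, of k]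
      by (simp add: distrib_left)
  qed
  from this[OF \<kappa>(2)] show ?thesis by simp
qed

section \<open>Residual links and the invariant of a stage\<close>

definition trav :: "(nat \<Rightarrow> nat) \<Rightarrow> (nat \<Rightarrow> nat) \<Rightarrow> (nat \<Rightarrow> nat) \<Rightarrow> nat \<Rightarrow> nat \<Rightarrow> nat \<Rightarrow> bool" where
  "trav f cap fr j x y \<longleftrightarrow> j \<in> links \<and> fr j = 0 \<and>
     (tl j = x \<and> hd j = y \<and> f j < cap j \<or> hd j = x \<and> tl j = y \<and> 0 < f j)"

text \<open>Dual feasibility and complementary slackness, with the potentials from the end of stage
  \<open>k - 1\<close>. A negative value is confined to edges because the reduced cost of a tree
  link is the multiplier of a quota. The last clause looks ahead: an edge of later rank is empty at
  capacity 0, and a positive value would demand it to be full once its capacity is 1.\<close>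

definition dual_ok where
  "dual_ok \<pi> k f cap fr j \<longleftrightarrow> (let r = \<rho> \<pi> (delay (k - 1)) j in
     (fr j = (0 :: nat) \<longleftrightarrow> r = 0) \<and> (r > 0 \<longrightarrow> f j = (cap j :: nat)) \<and> (r < 0 \<longrightarrow> j < m \<and> f j = 0) \<and>
     (j < m \<and> rank j > k \<longrightarrow> r \<le> 0))"

text \<open>
  The existentially quantified potential never appears in the program.  The flow of a tree link is
  stored plus one, with its capacity, so that tree links can always be used backwards.
\<close>

definition stage :: "nat \<Rightarrow> (nat \<Rightarrow> nat) \<Rightarrow> (nat \<Rightarrow> nat) \<Rightarrow> (nat \<Rightarrow> nat) \<Rightarrow> bool" where
  "stage k f cap fr \<longleftrightarrow>
     (\<forall>j<m. cap j = (if rank j \<le> k then 1 else 0)) \<and> (\<forall>x\<in>tree. cap x = Q x + 1) \<and>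
     (\<forall>j\<in>links. f j \<le> cap j) \<and> balanced f m \<and>
     (\<exists>\<pi>. \<pi> m = 0 \<and> \<pi> (m + 1) = horizon (k - 1) \<and>
       (\<forall>j\<in>links. dual_ok \<pi> k f cap fr j))"

text \<open>The old potentials remain a witness: slackness restricts only links with nonzero reduced
  cost, and these are frozen.\<close>

lemma stage_augment:
  assumes "stage k f cap fr" "balanced f' m" "\<And>j. j \<in> links \<Longrightarrow> f' j \<le> cap j"
    "\<And>j. j \<in> links \<Longrightarrow> fr j \<noteq> 0 \<Longrightarrow> f' j = f j"
  shows "stage k f' cap fr"
proof -
  obtain \<pi> where \<pi>: "\<pi> m = 0" "\<pi> (m + 1) = horizon (k - 1)"
    "\<forall>j\<in>links. dual_ok \<pi> k f cap fr j"
    using assms(1) unfolding stage_def by blast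
  have "\<forall>j\<in>links. dual_ok \<pi> k f' cap fr j"
    using \<pi>(3) assms(4) unfolding dual_ok_def Let_def by (metis less_irrefl)
  then show ?thesis using assms \<pi>(1,2) unfolding stage_def by blast
qed

text \<open>Holds iff the reduced cost changes beyond the scaling: an unreached head contributes 1,
  an unreached tail -1, and a rank above \<open>k\<close> a further -1.\<close>

definition freeze :: "nat \<Rightarrow> (nat \<Rightarrow> nat) \<Rightarrow> nat \<Rightarrow> bool" where
  "freeze k vis j \<longleftrightarrow> (if j < m \<and> rank j > k then \<not> (vis (tl j) \<noteq> 0 \<and> vis (hd j) = 0)
     else (vis (tl j) = 0) \<noteq> (vis (hd j) = 0))"

text \<open>The reason for adding 3 to \<open>m\<close> in the base: an increment of absolute value
  at most 2 cannot overturn the sign of a scaled nonzero integer.\<close>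

lemma scaled_sign:
  fixes r \<delta> B :: int
  assumes "B \<ge> 3" "\<bar>\<delta>\<bar> \<le> 2"
  shows "r > 0 \<Longrightarrow> B * r + \<delta> > 0" "r < 0 \<Longrightarrow> B * r + \<delta> < 0"
proof -
  assume "r > 0"
  then have "B * 1 \<le> B * r" using assms by (intro mult_left_mono) auto
  then show "B * r + \<delta> > 0" using assms by linarith
next
  assume "r < 0"
  then have "B * r \<le> B * (- 1)" using assms by (intro mult_left_mono) auto
  then show "B * r + \<delta> < 0" using assms by linarith
qed

text \<open>Links with nonzero reduced cost keep its sign. For the others the new reduced cost is
  the increment alone, and slackness is read off the cut: since no unfrozen link can be traversed
  out of the reachable set, those leaving it are full and those entering it are empty.\<close>

lemma stage_freeze:
  assumes st: "stage k f cap fr" and k: "1 \<le> k"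
    and closed: "\<And>j x y. trav f cap fr j x y \<Longrightarrow> vis x \<noteq> 0 \<Longrightarrow> vis y \<noteq> 0"
    and src: "vis m \<noteq> 0" and snk: "vis (m + 1) = 0"
    and cap': "\<And>j. j \<in> links \<Longrightarrow> cap' j = (if j < m \<and> rank j = Suc k then 1 else cap j)"
    and fr': "\<And>j. j \<in> links \<Longrightarrow> (fr' j = 0 \<longleftrightarrow> fr j = 0 \<and> \<not> freeze k vis j)"
  shows "stage (Suc k) f cap' fr'"
proof -
  obtain \<pi> where \<pi>: "\<pi> m = 0" "\<pi> (m + 1) = horizon (k - 1)"
    "\<And>j. j \<in> links \<Longrightarrow> dual_ok \<pi> k f cap fr j"
    using st unfolding stage_def by blast
  have capm: "\<And>j. j < m \<Longrightarrow> cap j = (if rank j \<le> k then 1 else 0)"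
    and capt: "\<And>x. x \<in> tree \<Longrightarrow> cap x = Q x + 1"
    and le: "\<And>j. j \<in> links \<Longrightarrow> f j \<le> cap j" and bal: "balanced f m"
    using st unfolding stage_def by auto
  obtain l where l: "k = Suc l" using k by (cases k) auto
  define \<pi>' where "\<pi>' z = int (m + 3) * \<pi> z + (if vis z = 0 then 1 else 0)" for z
  define \<delta> where "\<delta> j = (if vis (hd j) = 0 then 1 else 0) - (if vis (tl j) = 0 then 1 else 0)
     - (if j < m \<and> rank j > k then 1 else 0 :: int)" for j
  have r': "\<rho> \<pi>' (delay k) j = int (m + 3) * \<rho> \<pi> (delay (k - 1)) j + \<delta> j" for j
    unfolding \<rho>_def \<pi>'_def \<delta>_def l by (simp add: algebra_simps)
  have \<delta>2: "\<bar>\<delta> j\<bar> \<le> 2" for j by (auto simp: \<delta>_def)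
  \<comment> \<open>This is where the plus one in the stored flow is used.\<close>
  have ftree: "f x > 0" if "x \<in> tree" for x
  proof -
    have "int (f x) = 1 + (\<Sum>j\<in>L x. int (f j))" using bal that g_ends unfolding balanced_def by simp
    moreover have "(\<Sum>j\<in>L x. int (f j)) \<ge> 0" by (intro sum_nonneg) auto
    ultimately show ?thesis by linarith
  qed
  have main: "dual_ok \<pi>' (Suc k) f cap' fr' j" if j: "j \<in> links" for j
  proof -
    note p = \<pi>(3)[OF j, unfolded dual_ok_def Let_def]
    let ?r = "\<rho> \<pi> (delay (k - 1)) j"
    note sg = scaled_sign[of "int (m + 3)" "\<delta> j" ?r]
    show ?thesis
    proof (cases ?r "0::int" rule: linorder_cases)
      case less
      then show ?thesis using p sg \<delta>2[of j] fr'[OF j] by (simp add: r' dual_ok_def Let_def)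
    next
      case greater
      \<comment> \<open>So the capacity of this link is not changed, and the link stays
        full.\<close>
      then have "\<not> (j < m \<and> rank j > k)" using p by auto
      then show ?thesis using greater p sg \<delta>2[of j] fr'[OF j] cap'[OF j] by (auto simp: r' dual_ok_def Let_def)
    next
      case equal
      then have fr0: "fr j = 0" using p by simp
      have fwd: "vis (hd j) \<noteq> 0" if "vis (tl j) \<noteq> 0" "f j < cap j"
        using closed[of j "tl j" "hd j"] that j fr0 by (auto simp: trav_def)
      have bwd: "vis (tl j) \<noteq> 0" if "vis (hd j) \<noteq> 0" "0 < f j"
        using closed[of j "hd j" "tl j"] that j fr0 by (auto simp: trav_def)
      have f1: "(fr' j = 0) = (\<delta> j = 0)"
        using fr'[OF j] fr0 by (auto simp: freeze_def \<delta>_def)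
      show ?thesis
      proof (cases "j < m \<and> rank j > k")
        case True
        \<comment> \<open>An edge without capacity so far. It may receive capacity 1 now, which is
          harmless because it is empty and its new reduced cost is not positive.\<close>
        then have "f j = 0" using le[OF j] capm[of j] by auto
        moreover have "\<delta> j \<le> 0" using True by (auto simp: \<delta>_def)
        ultimately show ?thesis using True equal f1 by (simp add: r' dual_ok_def Let_def)
      next
        case False
        then have c: "cap' j = cap j" using cap'[OF j] by auto
        have "\<delta> j > 0 \<longrightarrow> \<not> f j < cap j"
          using False fwd by (auto simp: \<delta>_def)
        then have "\<delta> j > 0 \<longrightarrow> f j = cap j" using le[OF j] by auto
        moreover have "\<delta> j < 0 \<longrightarrow> \<not> 0 < f j"
          using False bwd by (cases "f j = 0") (auto simp: \<delta>_def)
        \<comment> \<open>A tree link is never empty, so its increment cannot be negative and the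
          multiplier of its quota stays nonnegative.\<close>
        moreover have "f j = 0 \<longrightarrow> j < m" using j ftree[of j] by (auto simp: links_def)
        ultimately show ?thesis using False equal f1 c by (auto simp: r' dual_ok_def Let_def)
      qed
    qed
  qed
  have "\<pi>' m = 0" "\<pi>' (m + 1) = horizon k" using \<pi> src snk by (auto simp: \<pi>'_def l)
  moreover have "\<forall>j<m. cap' j = (if rank j \<le> Suc k then 1 else 0)"
    using capm cap' by (auto simp: links_def)
  moreover have "\<forall>x\<in>tree. cap' x = Q x + 1"
    using capt cap' by (auto simp: links_def tree_def)
  moreover have "\<forall>j\<in>links. f j \<le> cap' j"
    using le cap' capm by (fastforce simp: links_def)
  ultimately show ?thesis
    unfolding stage_def using bal main by auto
qed

lemma chosen_card_L:
  assumes "stage k f cap fr" "x \<in> tree"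
  shows "f x = 1 + card (chosen f \<inter> L x)" "card (chosen f \<inter> L x) \<le> Q x"
proof -
  have f01: "f j \<le> 1" if "j < m" for j
    using assms that unfolding stage_def links_def by (metis UnI1 lessThan_iff order_trans zero_le_one order_refl)
  have "(\<Sum>j\<in>L x. int (f j)) = (\<Sum>j\<in>L x. if j \<in> chosen f then 1 else 0)"
  proof (rule sum.cong)
    fix j assume "j \<in> L x"
    then show "int (f j) = (if j \<in> chosen f then 1 else 0)"
      using f01[of j] L_less[of j x] by (auto simp: chosen_def)
  qed simp
  also have "\<dots> = int (card (chosen f \<inter> L x))"
    by (simp add: sum.If_cases Int_commute)
  finally have s: "(\<Sum>j\<in>L x. int (f j)) = int (card (chosen f \<inter> L x))" .
  have "balanced f m" using assms by (simp add: stage_def)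
  then have "int (f x) = 1 + (\<Sum>j\<in>L x. int (f j)) + g x m" using assms(2) unfolding balanced_def by blast
  then show "f x = 1 + card (chosen f \<inter> L x)" using s g_ends by simp
  moreover have "f x \<le> Q x + 1" using assms unfolding stage_def links_def by (metis UnI2)
  ultimately show "card (chosen f \<inter> L x) \<le> Q x" by simp
qed

lemma stage_fits: "stage k f cap fr \<Longrightarrow> fits (chosen f)"
  using chosen_card_L by (auto simp: fits_def chosen_def)

text \<open>Stage \<open>Suc m\<close> carries the potentials from the end of stage
  \<open>m\<close>, and all edges have capacity 1 by then. So \<open>chosen f\<close> has maximum
  weight for the final weights, under which a lexicographically better \<open>X\<close> would weigh
  more.\<close>

lemma stage_final:
  assumes st: "stage (Suc m) f cap fr" and X: "fits X"
    and \<kappa>: "1 \<le> \<kappa>" "\<kappa> \<le> m" "\<And>i. 1 \<le> i \<Longrightarrow> i < \<kappa> \<Longrightarrow> count i X = count i (chosen f)"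
  shows "count \<kappa> X \<le> count \<kappa> (chosen f)"
proof (rule ccontr)
  assume "\<not> ?thesis"
  then have gt: "count \<kappa> X > count \<kappa> (chosen f)" by simp
  have sub: "X \<subseteq> {..<m}" "chosen f \<subseteq> {..<m}" using X by (auto simp: fits_def chosen_def)
  obtain \<pi> where \<pi>: "\<pi> m = 0" "\<pi> (m + 1) = horizon m"
    "\<And>j. j \<in> links \<Longrightarrow> dual_ok \<pi> (Suc m) f cap fr j"
    using st unfolding stage_def by auto
  have cap: "\<forall>j<m. cap j = 1" "\<forall>x\<in>tree. cap x = Q x + 1"
    using st rank unfolding stage_def by (auto simp: le_SucI)
  have "(\<Sum>j\<in>X. \<pi> (m + 1) - \<pi> m - delay m j) \<le> (\<Sum>j\<in>chosen f. \<pi> (m + 1) - \<pi> m - delay m j)"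
  proof (rule optimal[OF X sub(2)])
    fix x assume x: "x \<in> tree"
    then have "\<not> x < m" by (auto simp: tree_def)
    then show "0 \<le> \<rho> \<pi> (delay m) x \<and> (0 < \<rho> \<pi> (delay m) x \<longrightarrow> card (chosen f \<inter> L x) = Q x)"
      using \<pi>(3)[of x] x cap(2) chosen_card_L(1)[OF st x] by (auto simp: dual_ok_def Let_def links_def)
  next
    fix j assume j: "j < m"
    then show "(0 < \<rho> \<pi> (delay m) j \<longrightarrow> j \<in> chosen f) \<and> (\<rho> \<pi> (delay m) j < 0 \<longrightarrow> j \<notin> chosen f)"
      using \<pi>(3)[of j] cap(1) by (auto simp: dual_ok_def Let_def links_def chosen_def)
  qed
  then show False using weight_lex[OF sub \<kappa> gt] \<pi> by simp
qed

lemma stage_init: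
  assumes "\<And>j. j < m \<Longrightarrow> f j = 0" "\<And>x. x \<in> tree \<Longrightarrow> f x = 1" "\<And>j. j \<in> links \<Longrightarrow> fr j = 0"
    "\<And>j. j < m \<Longrightarrow> cap j = (if rank j \<le> 1 then 1 else 0)" "\<And>x. x \<in> tree \<Longrightarrow> cap x = Q x + 1"
  shows "stage 1 f cap fr"
proof -
  have "balanced f m"
    unfolding balanced_def using assms(1,2) g_ends L_less by (simp add: sum.neutral)
  moreover have "\<forall>j\<in>links. f j \<le> cap j" using assms by (auto simp: links_def)
  ultimately show ?thesis
    using assms unfolding stage_def by (auto simp: \<rho>_def dual_ok_def intro!: exI[of _ "\<lambda>_. 0"])
qed

end

section \<open>Forests of laminar classes\<close>

lemma laminarD: "laminar F \<Longrightarrow> X \<in> F \<Longrightarrow> Y \<in> F \<Longrightarrow> X \<subseteq> Y \<or> Y \<subseteq> X \<or> X \<inter> Y = {}"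
  unfolding laminar_def by blast

text \<open>Deleting \<open>x\<close> from all members loses at most two of them: \<open>{x}\<close>
  becomes empty, and a member \<open>C\<close> containing \<open>x\<close> may collide with
  \<open>C - {x}\<close>. The latter happens for at most one \<open>C\<close>: if
  \<open>C \<subseteq> D\<close> both collide, then \<open>C\<close> is neither inside
  \<open>D - {x}\<close>, because of \<open>x\<close>, nor disjoint from it, because
  \<open>C - {x}\<close> is nonempty, so \<open>D - {x} \<subseteq> C\<close> and
  \<open>C = D\<close>.\<close>

lemma laminar_card:
  assumes "finite X" "F \<subseteq> Pow X" "laminar F" "{} \<notin> F"
  shows "card F \<le> 2 * card X"
  using assms
proof (induction X arbitrary: F rule: finite_induct)
  case empty
  then have "F = {}" by auto
  then show ?case by simp
next
  case (insert x X)
  have finF: "finite F" using insert.prems insert.hyps by (meson finite.insertI finite_Pow_iff finite_subset)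
  define G where "G = (\<lambda>C. C - {x}) ` F - {{}}"
  define H where "H = {C \<in> F. x \<in> C \<and> (C = {x} \<or> C - {x} \<in> F)}"
  have "card G \<le> 2 * card X"
  proof (rule insert.IH)
    show "G \<subseteq> Pow X" using insert.prems(1) by (auto simp: G_def)
    show "{} \<notin> G" by (simp add: G_def)
    show "laminar G" using insert.prems(2) unfolding laminar_def G_def by blast
  qed
  moreover have "card (F - H) \<le> card G"
  proof (rule card_inj_on_le[of "\<lambda>C. C - {x}"])
    show "inj_on (\<lambda>C. C - {x}) (F - H)"
    proof (rule inj_onI)
      fix C D assume "C \<in> F - H" "D \<in> F - H" "C - {x} = D - {x}"
      then show "C = D" unfolding H_def
        by (cases "x \<in> C"; cases "x \<in> D") (auto simp: insert_absorb Diff_insert_absorb)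
    qed
    show "(\<lambda>C. C - {x}) ` (F - H) \<subseteq> G"
    proof (rule image_subsetI)
      fix C assume C: "C \<in> F - H"
      then have "C \<noteq> {}" "C \<noteq> {x}" using insert.prems(3) by (auto simp: H_def)
      then have "C - {x} \<noteq> {}" by auto
      then show "C - {x} \<in> G" using C by (simp add: G_def)
    qed
    show "finite G" using finF by (simp add: G_def)
  qed
  moreover have "card H \<le> 2"
  proof -
    have "C = D" if "C \<in> H - {{x}}" "D \<in> H - {{x}}" for C D
    proof -
      have C: "C \<in> F" "x \<in> C" "C - {x} \<in> F" "C - {x} \<noteq> {}" using that by (auto simp: H_def)
      have D: "D \<in> F" "x \<in> D" "D - {x} \<in> F" "D - {x} \<noteq> {}" using that by (auto simp: H_def)
      have "C \<subseteq> D \<or> D \<subseteq> C" using laminarD[OF insert.prems(2) C(1) D(1)] C(2) D(2) by blast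
      moreover have "D \<subseteq> C" if "C \<subseteq> D"
      proof -
        note laminarD[OF insert.prems(2) C(1) D(3)]
        then show ?thesis using that C D by blast
      qed
      moreover have "C \<subseteq> D" if "D \<subseteq> C"
      proof -
        note laminarD[OF insert.prems(2) D(1) C(3)]
        then show ?thesis using that C D by blast
      qed
      ultimately show "C = D" by blast
    qed
    then have "card (H - {{x}}) \<le> 1"
      by (metis card_le_Suc0_iff_eq card.infinite One_nat_def zero_le)
    then show ?thesis by (cases "{x} \<in> H") (auto simp: card_Diff_singleton_if)
  qed
  moreover have "card F = card (F - H) + card H"
    using finF by (metis (no_types, lifting) H_def card_Diff_subset card_mono finite_subset
        le_add_diff_inverse2 mem_Collect_eq subsetI)
  ultimately show ?case using insert.hyps by simp
qed

section \<open>The forest of one side and its invariant\<close>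

text \<open>
  One side of the bipartite graph: edge \<open>j\<close> joins the vertex \<open>U j\<close> of this side to \<open>W j\<close>.  The key
  \<open>(u, None)\<close> stands for the whole neighbourhood of \<open>u\<close>, with its quota, and \<open>(u, Some c)\<close> for the
  class with number \<open>c\<close>.  Class numbers alone would not do: two vertices may share them.
\<close>

locale side =
  fixes m n0 r :: nat and U W qu cc cs cq mc ms mem C0 B0 cap0 f0 :: "nat \<Rightarrow> nat"
  assumes r: "r < n0" and n0: "m \<le> n0"
    and inj: "inj_on (\<lambda>j. (U j, W j)) {..<m}"
    and mem_inj: "\<And>u c. u \<in> U ` {..<m} \<Longrightarrow> cs u \<le> c \<Longrightarrow> c < cs u + cc u \<Longrightarrow> inj_on mem {ms c..<ms c + mc c}"
    and mem_nbr: "\<And>u c. u \<in> U ` {..<m} \<Longrightarrow> cs u \<le> c \<Longrightarrow> c < cs u + cc u \<Longrightarrow>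
      mem ` {ms c..<ms c + mc c} \<subseteq> W ` {j. j < m \<and> U j = u}"
    and Mem_inj: "\<And>u. u \<in> U ` {..<m} \<Longrightarrow> inj_on (\<lambda>c. mem ` {ms c..<ms c + mc c}) {cs u..<cs u + cc u}"
    and Mem_laminar: "\<And>u. u \<in> U ` {..<m} \<Longrightarrow> laminar ((\<lambda>c. mem ` {ms c..<ms c + mc c}) ` {cs u..<cs u + cc u})"
begin

definition Mem :: "nat \<Rightarrow> nat set" where "Mem c = mem ` {ms c..<ms c + mc c}"
definition Cls :: "nat \<Rightarrow> nat set" where "Cls u = {cs u..<cs u + cc u}"

fun E :: "nat \<times> nat option \<Rightarrow> nat set" where
  "E (u, None) = {j. j < m \<and> U j = u}"
| "E (u, Some c) = {j. j < m \<and> U j = u \<and> W j \<in> Mem c}"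

fun Qk :: "nat \<times> nat option \<Rightarrow> nat" where
  "Qk (u, None) = qu u"
| "Qk (u, Some c) = cq c"

text \<open>The empty class is left out: its quota always holds, and there is no member edge from
  which its parent could be read.\<close>

definition keys :: "nat set \<Rightarrow> (nat \<times> nat option) set" where
  "keys A = {(u, None) | u. u \<in> A} \<union> {(u, Some c) | u c. u \<in> A \<and> c \<in> Cls u \<and> 0 < mc c}"

lemma card_Mem:
  assumes "u \<in> U ` {..<m}" "c \<in> Cls u"
  shows "card (Mem c) = mc c"
  using mem_inj assms unfolding Mem_def Cls_def by (subst card_image) auto

lemma Mem_lam:
  assumes "u \<in> U ` {..<m}" "c \<in> Cls u" "d \<in> Cls u"
  shows "Mem c \<subseteq> Mem d \<or> Mem d \<subseteq> Mem c \<or> Mem c \<inter> Mem d = {}"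
  by (rule laminarD[OF Mem_laminar[OF assms(1)]]) (use assms in \<open>auto simp: Cls_def Mem_def\<close>)

lemma mc_le:
  assumes "u \<in> U ` {..<m}" "c \<in> Cls u"
  shows "mc c \<le> m"
proof -
  have "Mem c \<subseteq> W ` {..<m}" using mem_nbr[of u c] assms unfolding Mem_def Cls_def by fastforce
  then have "card (Mem c) \<le> card {..<m}" by (meson card_image_le card_mono finite_imageI finite_lessThan order_trans)
  then show ?thesis using card_Mem[OF assms] by simp
qed

lemma E_less: "j \<in> E k \<Longrightarrow> j < m \<and> U j = fst k"
  by (cases k; cases "snd k") auto

lemma finite_E [simp]: "finite (E k)"
  by (rule finite_subset[of _ "{..<m}"]) (use E_less[of _ k] in auto)

text \<open>
  The nodes \<open>n0, ..., n - 1\<close> represent the keys in \<open>K\<close>.  \<open>C x\<close> is the parent of the node \<open>x \<ge> n0\<close>,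
  and for \<open>j < m\<close> it is the node of the smallest inserted class containing edge \<open>j\<close>; so \<open>C\<close> and \<open>B\<close> are the
  two end points of the links, in one order for the applicants and in the other for the posts.
\<close>

definition P :: "(nat \<times> nat option) set \<Rightarrow> nat \<Rightarrow> (nat \<Rightarrow> nat) \<Rightarrow> (nat \<Rightarrow> nat) \<Rightarrow> (nat \<Rightarrow> nat) \<Rightarrow> (nat \<Rightarrow> nat) \<Rightarrow> bool" where
  "P K n C B cap f \<longleftrightarrow> n0 \<le> n \<and>
     (\<forall>y. m \<le> y \<and> y < n0 \<longrightarrow> C y = C0 y) \<and> (\<forall>y<n0. B y = B0 y \<and> cap y = cap0 y \<and> f y = f0 y) \<and>
     (\<exists>lab. bij_betw lab {n0..<n} K \<and>
       (\<forall>x. n0 \<le> x \<and> x < n \<longrightarrow> (C x = r \<or> n0 \<le> C x \<and> C x < x) \<and> B x = x \<and> f x = 1 \<and> cap x = Qk (lab x) + 1) \<and>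
       (\<forall>j. j < m \<and> U j \<in> fst ` K \<longrightarrow> n0 \<le> C j \<and> C j < n \<and>
          (\<forall>x. n0 \<le> x \<and> x < n \<longrightarrow> (x \<in> anc n0 C (C j) \<longleftrightarrow> j \<in> E (lab x)))))"

lemma bij_betw_extend:
  assumes "bij_betw lab {n0..<n} K" "n0 \<le> n" "k \<notin> K"
  shows "bij_betw (lab(n := k)) {n0..<Suc n} (insert k K)"
proof -
  have "bij_betw (lab(n := k)) {n0..<n} K"
    using assms(1) by (subst bij_betw_cong[of _ _ lab]) auto
  moreover have "bij_betw (lab(n := k)) {n} {k}" by (simp add: bij_betw_def)
  ultimately have "bij_betw (lab(n := k)) ({n0..<n} \<union> {n}) (K \<union> {k})"
    using assms by (intro bij_betw_combine) auto
  moreover have "{n0..<n} \<union> {n} = {n0..<Suc n}" using assms by auto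
  ultimately show ?thesis by simp
qed

text \<open>The new node \<open>n\<close> becomes a leaf. Just the edges of its key are hung under
  it; all others keep their root paths. By \<open>par\<close>, the ancestors of the chosen parent
  are the older keys containing the edges of the new one, whichever edge is asked.\<close>

lemma P_extend:
  assumes P: "P K n C B cap f" and k: "(u, k) \<notin> K"
    and new: "\<And>j. j \<in> E (u, k) \<Longrightarrow> C' j = n"
    and old: "\<And>y. y \<noteq> n \<Longrightarrow> y \<notin> E (u, k) \<Longrightarrow> C' y = C y"
    and k_old: "k \<noteq> None \<Longrightarrow> u \<in> fst ` K" and k_None: "k = None \<Longrightarrow> u \<notin> fst ` K"
    and n: "C' n = r \<or> n0 \<le> C' n \<and> C' n < n"
    and par: "\<And>lab. \<lbrakk>lab ` {n0..<n} = K;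
       \<And>j x. j < m \<Longrightarrow> U j \<in> fst ` K \<Longrightarrow> n0 \<le> x \<Longrightarrow> x < n \<Longrightarrow> (x \<in> anc n0 C (C j) \<longleftrightarrow> j \<in> E (lab x))\<rbrakk> \<Longrightarrow>
       \<forall>j\<in>E (u, k). \<forall>x. n0 \<le> x \<and> x < n \<longrightarrow> (x \<in> anc n0 C (C' n) \<longleftrightarrow> j \<in> E (lab x))"
  shows "P (insert (u, k) K) (Suc n) C' (B(n := n)) (cap(n := Qk (u, k) + 1)) (f(n := 1))"
proof -
  obtain lab where nn: "n0 \<le> n" and reg': "\<forall>y. m \<le> y \<and> y < n0 \<longrightarrow> C y = C0 y"
      "\<forall>y<n0. B y = B0 y \<and> cap y = cap0 y \<and> f y = f0 y"
    and bij: "bij_betw lab {n0..<n} K"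
    and nodes': "\<forall>x. n0 \<le> x \<and> x < n \<longrightarrow> (C x = r \<or> n0 \<le> C x \<and> C x < x) \<and> B x = x \<and> f x = 1 \<and> cap x = Qk (lab x) + 1"
    and edges': "\<forall>j. j < m \<and> U j \<in> fst ` K \<longrightarrow> n0 \<le> C j \<and> C j < n \<and>
          (\<forall>x. n0 \<le> x \<and> x < n \<longrightarrow> (x \<in> anc n0 C (C j) \<longleftrightarrow> j \<in> E (lab x)))"
    using P unfolding P_def by (elim conjE exE) (rule that)
  note reg = reg'(1)[rule_format, OF conjI] reg'(2)[rule_format]
  note nodes = nodes'[rule_format, OF conjI] and edges = edges'[rule_format, OF conjI]
  have img: "lab ` {n0..<n} = K" using bij by (simp add: bij_betw_def)
  have Eu: "y < n0" if "y \<in> E (u, k)" for y using E_less[OF that] n0 by simp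
  have Cold: "C' y = C y" if "n0 \<le> y" "y < n" for y using old[of y] Eu[of y] that by auto
  have anc: "anc n0 C' z = anc n0 C z" if "z < n" for z
    by (rule anc_cong) (use Cold that in auto)
  have "C' n < n" using n r nn by auto
  then have ancn: "anc n0 C' n = insert n (anc n0 C (C' n))" using nn anc[of "C' n"] by (subst anc.simps) simp
  have par': "\<forall>j\<in>E (u, k). \<forall>x. n0 \<le> x \<and> x < n \<longrightarrow> (x \<in> anc n0 C (C' n) \<longleftrightarrow> j \<in> E (lab x))"
    by (rule par[OF img]) (use edges in blast)
  let ?lab = "lab(n := (u, k))"
  have "n0 \<le> C' j \<and> C' j < Suc n \<and> (\<forall>x. n0 \<le> x \<and> x < Suc n \<longrightarrow> (x \<in> anc n0 C' (C' j) \<longleftrightarrow> j \<in> E (?lab x)))"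
    if j: "j < m" "U j \<in> fst ` insert (u, k) K" for j
  proof (cases "j \<in> E (u, k)")
    case True
    then have "x \<in> anc n0 C' n \<longleftrightarrow> j \<in> E (?lab x)" if "n0 \<le> x" "x < Suc n" for x
      using par' that ancn by (cases "x = n") auto
    then show ?thesis using new[OF True] nn by simp
  next
    case False
    have inK: "U j \<in> fst ` K"
    proof (cases "U j = u")
      case True
      then have "k \<noteq> None" using False j(1) by (cases k) auto
      then show ?thesis using k_old True by simp
    next
      case neq: False
      then show ?thesis using j(2) by auto
    qed
    have "j \<noteq> n" using j(1) n0 nn by simp
    then have c: "C' j = C j" using old False by simp
    note e = edges[OF j(1) inK]
    have "n \<notin> anc n0 C (C j)" using anc_bounds[of n n0 C "C j"] e by auto
    then show ?thesis using e c anc[of "C j"] False by (auto simp: less_Suc_eq)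
  qed
  moreover have "(C' x = r \<or> n0 \<le> C' x \<and> C' x < x) \<and> (B(n := n)) x = x \<and> (f(n := 1)) x = 1 \<and>
      (cap(n := Qk (u, k) + 1)) x = Qk (?lab x) + 1" if "n0 \<le> x" "x < Suc n" for x
    using that nodes[of x] Cold[of x] n by (cases "x = n") auto
  moreover have "C' y = C0 y" if "m \<le> y" "y < n0" for y
    using old[of y] that reg(1) nn E_less[of y "(u, k)"] by fastforce
  ultimately show ?thesis
    unfolding P_def using nn reg(2) bij_betw_extend[OF bij nn k]
    by (intro conjI exI[of _ ?lab]) auto
qed

text \<open>No older key concerns \<open>u\<close>, and the parent \<open>r\<close> lies below
  \<open>n0\<close>, so both sides of the ancestor condition are false.\<close>

lemma P_root:
  assumes P: "P K n C B cap f" and u: "u \<notin> fst ` K"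
    and new: "\<And>j. j < m \<Longrightarrow> U j = u \<Longrightarrow> C' j = n" "C' n = r"
    and old: "\<And>y. y \<noteq> n \<Longrightarrow> \<not> (y < m \<and> U y = u) \<Longrightarrow> C' y = C y"
  shows "P (insert (u, None) K) (Suc n) C' (B(n := n)) (cap(n := qu u + 1)) (f(n := 1))"
proof -
  have "P (insert (u, None) K) (Suc n) C' (B(n := n)) (cap(n := Qk (u, None) + 1)) (f(n := 1))"
  proof (rule P_extend[OF P])
    fix lab assume img: "lab ` {n0..<n} = K"
    have "anc n0 C (C' n) = {}" using new(2) r by (subst anc.simps) simp
    moreover have "j \<notin> E (lab x)" if "j \<in> E (u, None)" "n0 \<le> x" "x < n" for j x
    proof
      assume "j \<in> E (lab x)"
      then have "fst (lab x) = u" using E_less[of j "lab x"] that(1) by simp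
      moreover have "lab x \<in> K" using img that by auto
      ultimately show False using u by force
    qed
    ultimately show "\<forall>j\<in>E (u, None). \<forall>x. n0 \<le> x \<and> x < n \<longrightarrow> (x \<in> anc n0 C (C' n)) = (j \<in> E (lab x))"
      by blast
  qed (use assms in force)+
  then show ?thesis by simp
qed

text \<open>As classes arrive by decreasing size, laminarity leaves two cases for an older class of
  \<open>u\<close>: it contains the new one or is disjoint from it. Hence all edges of the new class
  lie in the same older keys, and any of them, here \<open>j0\<close>, shows the parent.\<close>

lemma P_class:
  assumes P: "P K n C B cap f" and u: "u \<in> U ` {..<m}" "(u, None) \<in> K" and c: "c \<in> Cls u" "(u, Some c) \<notin> K"
    and size: "\<And>c'. (u, Some c') \<in> K \<Longrightarrow> c' \<in> Cls u \<and> mc c \<le> mc c'"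
    and j0: "j0 \<in> E (u, Some c)"
    and new: "\<And>j. j \<in> E (u, Some c) \<Longrightarrow> C' j = n" "C' n = C j0"
    and old: "\<And>y. y \<noteq> n \<Longrightarrow> y \<notin> E (u, Some c) \<Longrightarrow> C' y = C y"
  shows "P (insert (u, Some c) K) (Suc n) C' (B(n := n)) (cap(n := cq c + 1)) (f(n := 1))"
proof -
  have uK: "u \<in> fst ` K" using u by force
  have j0': "j0 < m" "U j0 = u" "W j0 \<in> Mem c" using j0 by auto
  have "P (insert (u, Some c) K) (Suc n) C' (B(n := n)) (cap(n := Qk (u, Some c) + 1)) (f(n := 1))"
  proof (rule P_extend[OF P c(2)])
    have "n0 \<le> C j0 \<and> C j0 < n" using P j0' uK unfolding P_def by auto
    then show "C' n = r \<or> n0 \<le> C' n \<and> C' n < n" using new by simp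
    fix lab assume img: "lab ` {n0..<n} = K"
      and lab: "\<And>j x. j < m \<Longrightarrow> U j \<in> fst ` K \<Longrightarrow> n0 \<le> x \<Longrightarrow> x < n \<Longrightarrow> (x \<in> anc n0 C (C j) \<longleftrightarrow> j \<in> E (lab x))"
    show "\<forall>j\<in>E (u, Some c). \<forall>x. n0 \<le> x \<and> x < n \<longrightarrow> (x \<in> anc n0 C (C' n)) = (j \<in> E (lab x))"
    proof (intro ballI allI impI)
      fix j x assume j: "j \<in> E (u, Some c)" and x: "n0 \<le> x \<and> x < n"
      then have xK: "lab x \<in> K" using img by auto
      have "j0 \<in> E (lab x) \<longleftrightarrow> j \<in> E (lab x)"
      proof (cases "fst (lab x) = u")
        case False
        then show ?thesis using E_less[of j0 "lab x"] E_less[of j "lab x"] j j0' by auto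
      next
        case True
        show ?thesis
        proof (cases "snd (lab x)")
          case None
          then have "lab x = (u, None)" using True by (cases "lab x") auto
          then show ?thesis using j j0' by auto
        next
          case (Some c')
          then have l: "lab x = (u, Some c')" using True by (cases "lab x") auto
          then have c': "c' \<in> Cls u" "mc c \<le> mc c'" "c' \<noteq> c" using size[of c'] xK c(2) by auto
          \<comment> \<open>Two classes may have equal size, so size alone excludes only proper
            inclusion; equality is excluded by injectivity.\<close>
          have "Mem c' \<noteq> Mem c"
            using inj_onD[OF Mem_inj[OF u(1)], of c' c] c' c(1) by (auto simp: Cls_def Mem_def)
          moreover have "\<not> Mem c' \<subset> Mem c"
            using card_Mem[OF u(1) c(1)] card_Mem[OF u(1) c'(1)] c'(2) psubset_card_mono[of "Mem c" "Mem c'"]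
            by (auto simp: Mem_def)
          moreover have "Mem c' \<subseteq> Mem c \<or> Mem c \<subseteq> Mem c' \<or> Mem c' \<inter> Mem c = {}"
            by (rule Mem_lam[OF u(1) c'(1) c(1)])
          ultimately have "Mem c \<subseteq> Mem c' \<or> Mem c' \<inter> Mem c = {}" by blast
          then show ?thesis using l j j0' by auto
        qed
      qed
      then show "(x \<in> anc n0 C (C' n)) = (j \<in> E (lab x))"
        using lab[of j0 x] j0' x uK new(2) by simp
    qed
  qed (use assms uK in auto)
  then show ?thesis by simp
qed

lemma P_card: "P K n C B cap f \<Longrightarrow> n = n0 + card K"
  unfolding P_def using bij_betw_same_card by fastforce

lemma finite_keys: "finite A \<Longrightarrow> finite (keys A)"
proof -
  assume "finite A"
  moreover have "keys A \<subseteq> (\<lambda>u. (u, None)) ` A \<union> (\<Union>u\<in>A. (\<lambda>c. (u, Some c)) ` Cls u)"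
    by (auto simp: keys_def)
  ultimately show ?thesis by (rule_tac finite_subset) (auto simp: Cls_def)
qed

text \<open>The classes of a vertex are distinct sets, so at most one of them is empty.\<close>

lemma cc_le:
  assumes "u \<in> U ` {..<m}"
  shows "cc u \<le> card {c \<in> Cls u. 0 < mc c} + 1"
proof -
  have "c = d" if "c \<in> Cls u" "d \<in> Cls u" "mc c = 0" "mc d = 0" for c d
    by (rule inj_onD[OF Mem_inj[OF assms]]) (use that in \<open>auto simp: Cls_def\<close>)
  then have "card {c \<in> Cls u. mc c = 0} \<le> 1"
    by (simp add: card_le_Suc0_iff_eq Cls_def)
  moreover have "Cls u = {c \<in> Cls u. 0 < mc c} \<union> {c \<in> Cls u. mc c = 0}" by auto
  then have "card (Cls u) \<le> card {c \<in> Cls u. 0 < mc c} + card {c \<in> Cls u. mc c = 0}"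
    using card_Un_le[of "{c \<in> Cls u. 0 < mc c}" "{c \<in> Cls u. mc c = 0}"] by simp
  ultimately show ?thesis by (simp add: Cls_def)
qed

text \<open>The key for the whole neighbourhood makes up for the possibly omitted empty class. Thus
  scanning all \<open>cc u\<close> class numbers can be charged to the new nodes.\<close>

lemma card_keys_insert:
  assumes "u \<in> U ` {..<m}" "u \<notin> A" "finite A"
  shows "card (keys (insert u A)) \<ge> card (keys A) + cc u"
proof -
  have eq: "keys (insert u A) = keys A \<union> insert (u, None) ((\<lambda>c. (u, Some c)) ` {c \<in> Cls u. 0 < mc c})"
    by (auto simp: keys_def)
  have "card (insert (u, None) ((\<lambda>c. (u, Some c)) ` {c \<in> Cls u. 0 < mc c})) = card {c \<in> Cls u. 0 < mc c} + 1"
    by (subst card_insert_disjoint) (auto simp: Cls_def card_image inj_on_def)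
  moreover have "card (keys (insert u A)) = card (keys A) + card (insert (u, None) ((\<lambda>c. (u, Some c)) ` {c \<in> Cls u. 0 < mc c}))"
    unfolding eq using assms finite_keys[of A] by (intro card_Un_disjoint) (auto simp: Cls_def keys_def)
  ultimately show ?thesis using cc_le[OF assms(1)] by simp
qed

text \<open>Viewed as sets of edges, the nonempty classes of all vertices of this side form a single
  laminar family, since different vertices have disjoint edge sets. This gives \<open>2 * m\<close>;
  the whole neighbourhoods add at most \<open>m\<close>.\<close>

lemma card_keys_le: "card (keys (U ` {..<m})) \<le> 3 * m"
proof -
  let ?A = "U ` {..<m}"
  define S where "S = {(u, Some c) | u c. u \<in> ?A \<and> c \<in> Cls u \<and> 0 < mc c}"
  have img: "W ` E (u, Some c) = Mem c" if "u \<in> ?A" "c \<in> Cls u" for u c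
    using mem_nbr[OF that(1), of c] that(2) unfolding Cls_def Mem_def[symmetric] by fastforce
  have ne: "Mem c \<noteq> {}" if "0 < mc c" for c using that by (simp add: Mem_def)
  have "inj_on E S"
  proof (rule inj_onI)
    fix k k' assume "k \<in> S" "k' \<in> S" and eq: "E k = E k'"
    then obtain u c u' c' where k: "k = (u, Some c)" "u \<in> ?A" "c \<in> Cls u" "0 < mc c"
      and k': "k' = (u', Some c')" "u' \<in> ?A" "c' \<in> Cls u'" "0 < mc c'" by (auto simp: S_def)
    have "E k \<noteq> {}" using img[OF k(2,3)] ne[OF k(4)] k(1) by (metis image_empty)
    then obtain j where "j \<in> E k" by blast
    then have "U j = fst k" "U j = fst k'" using E_less[of j k] E_less[of j k'] eq by blast+
    then have "u = u'" using k(1) k'(1) by simp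
    moreover have "Mem c = Mem c'" using img[OF k(2,3)] img[OF k'(2,3)] eq k(1) k'(1) by metis
    ultimately show "k = k'"
      using inj_onD[OF Mem_inj[OF k(2)], of c c'] k k' by (simp add: Cls_def Mem_def)
  qed
  moreover have "card (E ` S) \<le> 2 * card {..<m}"
  proof (rule laminar_card)
    show "E ` S \<subseteq> Pow {..<m}" using E_less by auto
    show "{} \<notin> E ` S"
    proof
      assume "{} \<in> E ` S"
      then obtain u c where "u \<in> ?A" "c \<in> Cls u" "0 < mc c" "E (u, Some c) = {}"
        unfolding S_def by blast
      then show False using img ne by (metis image_empty)
    qed
    show "laminar (E ` S)"
      unfolding laminar_def
    proof (intro ballI)
      fix X Y assume "X \<in> E ` S" "Y \<in> E ` S"
      then obtain u c u' c' where k: "X = E (u, Some c)" "u \<in> ?A" "c \<in> Cls u"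
        and k': "Y = E (u', Some c')" "u' \<in> ?A" "c' \<in> Cls u'"
        unfolding S_def by blast
      show "X \<subseteq> Y \<or> Y \<subseteq> X \<or> X \<inter> Y = {}"
      proof (cases "u = u'")
        case False
        then show ?thesis using k k' by auto
      next
        case True
        have "Mem c' \<subseteq> Mem c \<or> Mem c \<subseteq> Mem c' \<or> Mem c' \<inter> Mem c = {}"
          using Mem_lam[OF k(2), of c' c] k k' True by simp
        then show ?thesis using k k' True by auto
      qed
    qed
  qed simp
  ultimately have "card S \<le> 2 * m" by (simp add: card_image)
  moreover have "card ((\<lambda>u. (u, None :: nat option)) ` ?A) \<le> m"
    by (metis card_image_le card_lessThan finite_imageI finite_lessThan order_trans)
  moreover have "keys ?A = (\<lambda>u. (u, None)) ` ?A \<union> S" by (auto simp: keys_def S_def)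
  ultimately show ?thesis using card_Un_le[of "(\<lambda>u. (u, None)) ` ?A" S] by simp
qed

end

section \<open>Constructing the forests\<close>

definition node_com :: "vname \<Rightarrow> vname \<Rightarrow> aexp \<Rightarrow> aexp \<Rightarrow> com" where
  "node_com C B p q = (Write C (V ''n'') p;; Write B (V ''n'') (V ''n'');;
     Write ''cap'' (V ''n'') (Add q (Num 1));; Write ''flow'' (V ''n'') (Num 1))"

text \<open>\<open>idx\<close> takes a neighbour of \<open>u\<close> to the edge joining it to
  \<open>u\<close>. Entries of earlier vertices are not erased, but classes of \<open>u\<close>
  contain only neighbours of \<open>u\<close>, whose entries have been rewritten.\<close>

definition root_com :: "vname \<Rightarrow> vname \<Rightarrow> vname \<Rightarrow> vname \<Rightarrow> aexp \<Rightarrow> com" where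
  "root_com U W C B R =
     (For ''j'' (V ''edge_count'')
        (Cond (Equal (Read U (V ''j'')) (V ''u''))
          (Write ''idx'' (Read W (V ''j'')) (V ''j'');; Write C (V ''j'') (V ''n'')) Skip);;
      node_com C B R (Read ''quota'' (V ''u''));;
      ''n'' ::= Add (V ''n'') (Num 1))"

text \<open>The parent is read from the first member before the loop redirects the members to the
  new node.\<close>

definition class_com :: "vname \<Rightarrow> vname \<Rightarrow> com" where
  "class_com C B =
     (node_com C B (Read C (Read ''idx'' (Read ''member'' (Read ''member_start'' (V ''c'')))))
        (Read ''class_quota'' (V ''c''));;
      For ''j'' (Read ''member_count'' (V ''c''))
        (Write C (Read ''idx'' (Read ''member'' (Add (Read ''member_start'' (V ''c'')) (V ''j'')))) (V ''n''));;
      ''n'' ::= Add (V ''n'') (Num 1))"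

text \<open>The classes of a vertex are inserted by decreasing size, so that every class is below the ones containing it.\<close>

definition classes_com :: "vname \<Rightarrow> vname \<Rightarrow> com" where
  "classes_com C B =
     For ''z'' (V ''edge_count'')
       (For ''l'' (Read ''class_count'' (V ''u''))
         (''c'' ::= Add (Read ''class_start'' (V ''u'')) (V ''l'');;
          Cond (Equal (Add (Read ''member_count'' (V ''c'')) (V ''z'')) (V ''edge_count''))
            (class_com C B) Skip))"

text \<open>Vertices are discovered through the edges, so isolated ones cost nothing;
  \<open>seen\<close> prevents a second treatment.\<close>

definition side_com :: "vname \<Rightarrow> vname \<Rightarrow> vname \<Rightarrow> vname \<Rightarrow> aexp \<Rightarrow> com" where
  "side_com U W C B R =
     For ''i'' (V ''edge_count'')
       (''u'' ::= Read U (V ''i'');;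
        Cond (Equal (Read ''seen'' (V ''u'')) (Num 0))
          (Write ''seen'' (V ''u'') (Num 1);; root_com U W C B R;; classes_com C B) Skip)"

lemma writes_node [simp]: "writes (node_com C B p q) = {C, B, ''cap'', ''flow''}"
  by (auto simp: node_com_def)
lemma writes_root [simp]: "writes (root_com U W C B R) = {C, B, ''cap'', ''flow'', ''idx'', ''j'', ''n''}"
  by (auto simp: root_com_def)
lemma writes_class [simp]: "writes (class_com C B) = {C, B, ''cap'', ''flow'', ''j'', ''n''}"
  by (auto simp: class_com_def)
lemma writes_classes [simp]: "writes (classes_com C B) = {C, B, ''cap'', ''flow'', ''j'', ''n'', ''c'', ''l'', ''z''}"
  by (auto simp: classes_com_def)
lemma writes_side [simp]: "writes (side_com U W C B R) =
    {C, B, ''cap'', ''flow'', ''j'', ''n'', ''c'', ''l'', ''z'', ''idx'', ''seen'', ''u'', ''i''}"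
  by (auto simp: side_com_def)

lemma straight_node [simp]: "straight (node_com C B p q)" by (simp add: node_com_def)

lemma tmax_node [simp]: "tmax (node_com C B p q) = 17 + acost p + acost q"
  by (simp add: node_com_def)

section \<open>Correctness and amortised time of the construction, for both sides at once\<close>

locale side_prog = side +
  fixes Ua Wa Ca Ba :: vname and Ra :: aexp
  assumes names: "(Ua, Wa, Ca, Ba) = (''edge_applicant'', ''edge_post'', ''tail'', ''head'') \<or>
      (Ua, Wa, Ca, Ba) = (''edge_post'', ''edge_applicant'', ''head'', ''tail'')"
    and Ra: "\<And>s. s ''edge_count'' 0 = m \<Longrightarrow> aval Ra s = r" "acost Ra \<le> 4"
begin

lemma Ua_neq [simp]:
  "Ua \<noteq> ''n''" "Ua \<noteq> ''u''" "Ua \<noteq> ''c''" "Ua \<noteq> ''i''" "Ua \<noteq> ''j''" "Ua \<noteq> ''z''" "Ua \<noteq> ''l''"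
  "Ua \<noteq> ''idx''" "Ua \<noteq> ''seen''" "Ua \<noteq> ''cap''" "Ua \<noteq> ''flow''" "Ua \<noteq> Ca" "Ua \<noteq> Ba"
  using names by auto

lemma Wa_neq [simp]:
  "Wa \<noteq> ''n''" "Wa \<noteq> ''u''" "Wa \<noteq> ''c''" "Wa \<noteq> ''i''" "Wa \<noteq> ''j''" "Wa \<noteq> ''z''" "Wa \<noteq> ''l''"
  "Wa \<noteq> ''idx''" "Wa \<noteq> ''seen''" "Wa \<noteq> ''cap''" "Wa \<noteq> ''flow''" "Wa \<noteq> Ca" "Wa \<noteq> Ba"
  using names by auto

lemma Ca_neq:
  "Ca \<noteq> ''n''" "Ca \<noteq> ''u''" "Ca \<noteq> ''c''" "Ca \<noteq> ''i''" "Ca \<noteq> ''j''" "Ca \<noteq> ''z''" "Ca \<noteq> ''l''"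
  "Ca \<noteq> ''idx''" "Ca \<noteq> ''seen''" "Ca \<noteq> ''cap''" "Ca \<noteq> ''flow''" "Ca \<noteq> Ba"
  "Ca \<noteq> ''edge_count''" "Ca \<noteq> ''quota''" "Ca \<noteq> ''class_count''" "Ca \<noteq> ''class_start''" "Ca \<noteq> ''class_quota''"
  "Ca \<noteq> ''member_count''" "Ca \<noteq> ''member_start''" "Ca \<noteq> ''member''"
  using names by auto

lemma Ba_neq:
  "Ba \<noteq> ''n''" "Ba \<noteq> ''u''" "Ba \<noteq> ''c''" "Ba \<noteq> ''i''" "Ba \<noteq> ''j''" "Ba \<noteq> ''z''" "Ba \<noteq> ''l''"
  "Ba \<noteq> ''idx''" "Ba \<noteq> ''seen''" "Ba \<noteq> ''cap''" "Ba \<noteq> ''flow''" "Ba \<noteq> Ca"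
  "Ba \<noteq> ''edge_count''" "Ba \<noteq> ''quota''" "Ba \<noteq> ''class_count''" "Ba \<noteq> ''class_start''" "Ba \<noteq> ''class_quota''"
  "Ba \<noteq> ''member_count''" "Ba \<noteq> ''member_start''" "Ba \<noteq> ''member''"
  using names by auto

lemmas neqs [simp] = Ca_neq Ba_neq Ca_neq [symmetric] Ba_neq [symmetric]

definition inp :: "state \<Rightarrow> bool" where
  "inp s \<longleftrightarrow> s ''edge_count'' 0 = m \<and> s Ua = U \<and> s Wa = W \<and> s ''quota'' = qu \<and>
     s ''class_count'' = cc \<and> s ''class_start'' = cs \<and> s ''class_quota'' = cq \<and>
     s ''member_count'' = mc \<and> s ''member_start'' = ms \<and> s ''member'' = mem"

definition PS :: "(nat \<times> nat option) set \<Rightarrow> state \<Rightarrow> bool" where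
  "PS K s \<longleftrightarrow> P K (s ''n'' 0) (s Ca) (s Ba) (s ''cap'') (s ''flow'')"

lemma PS_card: "PS K s \<Longrightarrow> s ''n'' 0 = n0 + card K"
  unfolding PS_def by (rule P_card)

lemma wp_class:
  assumes inp: "inp s" and P: "PS K s" and u: "u \<in> U ` {..<m}" "(u, None) \<in> K"
    and c: "c \<in> Cls u" "0 < mc c" "(u, Some c) \<notin> K"
    and size: "\<And>c'. (u, Some c') \<in> K \<Longrightarrow> c' \<in> Cls u \<and> mc c \<le> mc c'"
    and idx: "\<And>j. j < m \<Longrightarrow> U j = u \<Longrightarrow> s ''idx'' (W j) = j" and sc: "s ''c'' 0 = c"
  shows "wp (class_com Ca Ba) (\<lambda>t s'. t \<le> 40 * (m + 2) \<and> PS (insert (u, Some c) K) s' \<and> s' ''n'' 0 = s ''n'' 0 + 1) s"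
proof -
  let ?n = "s ''n'' 0"
  let ?w = "Write Ca (Read ''idx'' (Read ''member'' (Add (Read ''member_start'' (V ''c'')) (V ''j'')))) (V ''n'')"
  let ?node = "node_com Ca Ba (Read Ca (Read ''idx'' (Read ''member'' (Read ''member_start'' (V ''c'')))))
        (Read ''class_quota'' (V ''c''))"
  let ?x = "\<lambda>l. s ''idx'' (mem (ms c + l))"
  note inp' = inp[unfolded inp_def]
  have x: "?x ` {..<mc c} = E (u, Some c)"
  proof (rule set_eqI, rule iffI)
    fix j assume "j \<in> ?x ` {..<mc c}"
    then obtain l where l: "l < mc c" "j = ?x l" by auto
    then have "mem (ms c + l) \<in> Mem c" by (auto simp: Mem_def)
    moreover from this obtain i where "i < m" "U i = u" "W i = mem (ms c + l)"
      using mem_nbr[OF u(1), of c] c(1) unfolding Cls_def Mem_def by fastforce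
    ultimately show "j \<in> E (u, Some c)" using idx[of i] l by simp
  next
    fix j assume "j \<in> E (u, Some c)"
    then have j: "j < m" "U j = u" "W j \<in> Mem c" by auto
    then obtain y where y: "ms c \<le> y" "y < ms c + mc c" "W j = mem y" by (auto simp: Mem_def)
    then have "?x (y - ms c) = j" using idx[of j] j by simp
    then show "j \<in> ?x ` {..<mc c}" using y by (intro image_eqI[of _ _ "y - ms c"]) auto
  qed
  let ?s1 = "step ?node s"
  have s1: "?s1 Ca = (s Ca)(?n := s Ca (?x 0))" "?s1 Ba = (s Ba)(?n := ?n)"
    "?s1 ''cap'' = (s ''cap'')(?n := cq c + 1)" "?s1 ''flow'' = (s ''flow'')(?n := 1)"
    "\<And>y. y \<noteq> Ca \<Longrightarrow> y \<noteq> Ba \<Longrightarrow> y \<noteq> ''cap'' \<Longrightarrow> y \<noteq> ''flow'' \<Longrightarrow> ?s1 y = s y"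
    using inp' sc by (simp_all add: node_com_def)
  show ?thesis
    unfolding class_com_def
  proof (rule wp_straight_Seq, simp)
    fix t0 assume t0: "t0 \<le> tmax ?node"
    show "wp (For ''j'' (Read ''member_count'' (V ''c''))
        ?w;;
      ''n'' ::= Add (V ''n'') (Num 1))
      (\<lambda>t' s'. t0 + t' \<le> 40 * (m + 2) \<and> PS (insert (u, Some c) K) s' \<and> s' ''n'' 0 = s ''n'' 0 + 1) ?s1"
    proof (intro wp_Seq, rule wp_For_const[where n = "mc c" and b = 11 and
          I = "\<lambda>l s'. s' Ca = (\<lambda>y. if y \<in> ?x ` {..<l} then ?n else ?s1 Ca y)"])
      fix s' assume "\<And>y. y \<notin> insert ''j'' (writes ?w) \<Longrightarrow> s' y = ?s1 y"
      then show "aval (Read ''member_count'' (V ''c'')) s' = mc c" using s1(5) inp' sc by simp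
    next
      fix l s' assume l: "l < mc c" and I: "s' Ca = (\<lambda>y. if y \<in> ?x ` {..<l} then ?n else ?s1 Ca y)"
        and j: "s' ''j'' 0 = l"
        and fr: "\<And>y. y \<notin> insert ''j'' (writes ?w) \<Longrightarrow> s' y = ?s1 y"
      have "s' ''idx'' = s ''idx''" "s' ''member'' = mem" "s' ''member_start'' = ms" "s' ''c'' 0 = c" "s' ''n'' 0 = ?n"
        using fr s1(5) inp' sc by simp_all
      then show "wp ?w
          (\<lambda>t' s''. t' \<le> 11 \<and> (s''(''j'' := (s'' ''j'')(0 := Suc l))) Ca = (\<lambda>y. if y \<in> ?x ` {..<Suc l} then ?n else ?s1 Ca y)) s'"
        using I j by (intro wp_straight) (auto simp: lessThan_Suc fun_eq_iff)
    next
      fix t1 s' assume I: "s' Ca = (\<lambda>y. if y \<in> ?x ` {..<mc c} then ?n else ?s1 Ca y)"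
        and fr: "\<And>y. y \<notin> insert ''j'' (writes ?w) \<Longrightarrow> s' y = ?s1 y"
        and t1: "t1 \<le> Suc (mc c) * (11 + acost (Read ''member_count'' (V ''c'')) + 10)"
      have fs: "s' Ba = ?s1 Ba" "s' ''cap'' = ?s1 ''cap''" "s' ''flow'' = ?s1 ''flow''" "s' ''n'' = s ''n''"
        using fr s1(5) by simp_all
      have n: "n0 \<le> ?n" using P by (simp add: PS_def P_def)
      have Em: "y \<noteq> ?n" if "y \<in> E (u, Some c)" for y using E_less[OF that] n n0 by simp
      have "?x 0 \<in> E (u, Some c)" using x c(2) by blast
      then have "P (insert (u, Some c) K) (Suc ?n) (s' Ca) ((s Ba)(?n := ?n)) ((s ''cap'')(?n := cq c + 1)) ((s ''flow'')(?n := 1))"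
        using P u c size Em unfolding PS_def
        by (intro P_class[of K ?n "s Ca" _ _ _ u c "?x 0"]) (auto simp only: I x s1 fun_upd_apply simp_thms if_True if_False split: if_splits)
      then have "P (insert (u, Some c) K) (Suc ?n) (s' Ca) (s' Ba) (s' ''cap'') (s' ''flow'')"
        using fs s1 by simp
      moreover have "t0 + (t1 + t) \<le> 40 * (m + 2)" if "t \<le> 6" for t
        using t0 t1 that mc_le[OF u(1) c(1)] by simp
      ultimately show "wp (''n'' ::= Add (V ''n'') (Num 1)) (\<lambda>t' s'. t0 + (t1 + t') \<le> 40 * (m + 2) \<and>
          PS (insert (u, Some c) K) s' \<and> s' ''n'' 0 = ?n + 1) s'"
        using fs(4) by (intro wp_straight) (simp_all add: PS_def)
    qed simp_all
  qed
qed

lemma wp_root: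
  assumes inp: "inp s" and P: "PS K s" and u: "u \<notin> fst ` K" and su: "s ''u'' 0 = u"
  shows "wp (root_com Ua Wa Ca Ba Ra) (\<lambda>t s'. t \<le> 80 * (m + 2) \<and> PS (insert (u, None) K) s' \<and>
     s' ''n'' 0 = s ''n'' 0 + 1 \<and> (\<forall>j<m. U j = u \<longrightarrow> s' ''idx'' (W j) = j)) s"
proof -
  let ?n = "s ''n'' 0"
  let ?body = "Cond (Equal (Read Ua (V ''j'')) (V ''u''))
          (Write ''idx'' (Read Wa (V ''j'')) (V ''j'');; Write Ca (V ''j'') (V ''n'')) Skip"
  note inp' = inp[unfolded inp_def]
  show ?thesis
    unfolding root_com_def
  proof (intro wp_Seq, rule wp_For_const[where n = m and b = 30 and
      I = "\<lambda>k s'. s' Ca = (\<lambda>y. if y < k \<and> U y = u then ?n else s Ca y) \<and> (\<forall>j<k. U j = u \<longrightarrow> s' ''idx'' (W j) = j)"])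
    fix s' assume "\<And>y. y \<notin> insert ''j'' (writes ?body) \<Longrightarrow> s' y = s y"
    then show "aval (V ''edge_count'') s' = m" using inp' by simp
  next
    fix k s' assume k: "k < m"
      and I: "s' Ca = (\<lambda>y. if y < k \<and> U y = u then ?n else s Ca y) \<and> (\<forall>j<k. U j = u \<longrightarrow> s' ''idx'' (W j) = j)"
      and j: "s' ''j'' 0 = k" and fr: "\<And>y. y \<notin> insert ''j'' (writes ?body) \<Longrightarrow> s' y = s y"
    have fs: "s' Ua = U" "s' Wa = W" "s' ''u'' 0 = u" "s' ''n'' 0 = ?n" using fr inp' su by simp_all
    \<comment> \<open>Distinct edges at \<open>u\<close> have distinct other ends, so later writes
      do not destroy entries of \<open>idx\<close>.\<close>
    have ne: "W i \<noteq> W k" if "i < k" "U i = u" "U k = u" for i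
      using inj_onD[OF inj, of i k] that k by auto
    show "wp ?body (\<lambda>t' s''. t' \<le> 30 \<and>
        (s''(''j'' := (s'' ''j'')(0 := Suc k))) Ca = (\<lambda>y. if y < Suc k \<and> U y = u then ?n else s Ca y) \<and>
        (\<forall>j<Suc k. U j = u \<longrightarrow> (s''(''j'' := (s'' ''j'')(0 := Suc k))) ''idx'' (W j) = j)) s'"
      using I j fs ne by (intro wp_straight) (auto simp: fun_eq_iff less_Suc_eq)
  next
    fix t1 s' assume I: "s' Ca = (\<lambda>y. if y < m \<and> U y = u then ?n else s Ca y) \<and> (\<forall>j<m. U j = u \<longrightarrow> s' ''idx'' (W j) = j)"
      and fr: "\<And>y. y \<notin> insert ''j'' (writes ?body) \<Longrightarrow> s' y = s y"
      and t1: "t1 \<le> Suc m * (30 + acost (V ''edge_count'') + 10)"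
    let ?s2 = "step (node_com Ca Ba Ra (Read ''quota'' (V ''u''));; ''n'' ::= Add (V ''n'') (Num 1)) s'"
    have fs: "s' Ba = s Ba" "s' ''cap'' = s ''cap''" "s' ''flow'' = s ''flow''" "s' ''n'' = s ''n''"
      "s' ''u'' 0 = u" "s' ''quota'' = qu" "s' ''edge_count'' 0 = m"
      using fr inp' su by simp_all
    have s2: "?s2 Ca = (s' Ca)(?n := r)" "?s2 Ba = (s Ba)(?n := ?n)" "?s2 ''idx'' = s' ''idx''"
      "?s2 ''cap'' = (s ''cap'')(?n := qu u + 1)" "?s2 ''flow'' = (s ''flow'')(?n := 1)" "?s2 ''n'' 0 = Suc ?n"
      using fs Ra(1)[of s'] by (simp_all add: node_com_def)
    have n: "n0 \<le> ?n" using P by (simp add: PS_def P_def)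
    have "P (insert (u, None) K) (Suc ?n) ((s' Ca)(?n := r)) ((s Ba)(?n := ?n)) ((s ''cap'')(?n := qu u + 1)) ((s ''flow'')(?n := 1))"
      using P u n n0 unfolding PS_def by (intro P_root[of K ?n "s Ca"]) (auto simp: I)
    then have "PS (insert (u, None) K) ?s2" using s2 by (simp only: PS_def)
    moreover have "t1 + t \<le> 80 * (m + 2)" if "t \<le> 31" for t using t1 that by simp
    moreover have "tmax (node_com Ca Ba Ra (Read ''quota'' (V ''u''));; ''n'' ::= Add (V ''n'') (Num 1)) \<le> 31"
      using Ra(2) by simp
    ultimately show "wp (node_com Ca Ba Ra (Read ''quota'' (V ''u''));; ''n'' ::= Add (V ''n'') (Num 1))
        (\<lambda>t' s'. t1 + t' \<le> 80 * (m + 2) \<and> PS (insert (u, None) K) s' \<and> s' ''n'' 0 = ?n + 1 \<and>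
          (\<forall>j<m. U j = u \<longrightarrow> s' ''idx'' (W j) = j)) s'"
      using I s2 by (intro wp_straight) (simp_all del: step.simps tmax.simps)
  qed simp_all
qed

text \<open>Progress of the double loop. A class is inserted in round \<open>m - mc c\<close>, so
  larger classes come first, and the empty class, whose round would be \<open>m\<close>, is passed
  over.\<close>

definition KD :: "nat set \<Rightarrow> nat \<Rightarrow> nat \<Rightarrow> nat \<Rightarrow> (nat \<times> nat option) set" where
  "KD A u z l = insert (u, None) (keys A) \<union>
     {(u, Some c) | c. c \<in> Cls u \<and> 0 < mc c \<and> (m < mc c + z \<or> mc c + z = m \<and> c < cs u + l)}"

lemma inp_frame:
  assumes "inp s" "\<And>y. y \<in> {''edge_count'', Ua, Wa, ''quota'', ''class_count'', ''class_start'', ''class_quota'',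
     ''member_count'', ''member_start'', ''member''} \<Longrightarrow> s' y = s y"
  shows "inp s'"
  using assms by (simp add: inp_def)

text \<open>The node counter acts as a clock: an insertion takes at most \<open>40 * (m + 2)\<close>
  and creates one node, so only the scan of the class numbers appears as time. A worst-case bound
  for each of the \<open>m\<close> rounds would make the total cubic.\<close>

lemma wp_classes_inner:
  assumes inp: "inp s" and P: "PS (KD A u z 0) s" and u: "u \<in> U ` {..<m}" "u \<notin> A" and z: "z < m"
    and idx: "\<And>j. j < m \<Longrightarrow> U j = u \<Longrightarrow> s ''idx'' (W j) = j" and su: "s ''u'' 0 = u" and sz: "s ''z'' 0 = z"
  shows "wp (For ''l'' (Read ''class_count'' (V ''u''))
         (''c'' ::= Add (Read ''class_start'' (V ''u'')) (V ''l'');;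
          Cond (Equal (Add (Read ''member_count'' (V ''c'')) (V ''z'')) (V ''edge_count''))
            (class_com Ca Ba) Skip))
    (\<lambda>t s'. PS (KD A u z (cc u)) s' \<and> t + 40 * (m + 2) * s ''n'' 0 \<le> 50 * cc u + 13 + 40 * (m + 2) * s' ''n'' 0) s"
proof -
  let ?body = "''c'' ::= Add (Read ''class_start'' (V ''u'')) (V ''l'');;
          Cond (Equal (Add (Read ''member_count'' (V ''c'')) (V ''z'')) (V ''edge_count''))
            (class_com Ca Ba) Skip"
  let ?q = "Equal (Add (Read ''member_count'' (V ''c'')) (V ''z'')) (V ''edge_count'')" and ?a = "''c'' ::= Add (Read ''class_start'' (V ''u'')) (V ''l'')"
  note inp' = inp[unfolded inp_def]
  let ?I = "\<lambda>l t s'. PS (KD A u z l) s' \<and> t + 40 * (m + 2) * s ''n'' 0 \<le> 50 * l + 40 * (m + 2) * s' ''n'' 0"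
  show ?thesis
  proof (rule wp_For[where n = "cc u" and I = ?I])
    fix s' assume "\<And>y. y \<notin> insert ''l'' (writes ?body) \<Longrightarrow> s' y = s y"
    then show "aval (Read ''class_count'' (V ''u'')) s' = cc u" using inp' su by simp
  next
    fix l t s' assume l: "l < cc u" and I: "?I l t s'" and sl: "s' ''l'' 0 = l"
      and fr: "\<And>y. y \<notin> insert ''l'' (writes ?body) \<Longrightarrow> s' y = s y"
    let ?c = "cs u + l"
    let ?s1 = "step ?a s'"
    have "inp s'" by (rule inp_frame[OF inp]) (auto intro!: fr)
    then have inp1: "inp ?s1" by (simp add: inp_def)
    have fs: "s' ''u'' 0 = u" "s' ''z'' 0 = z" "s' ''class_start'' = cs" "s' ''idx'' = s ''idx''"
      using fr su sz inp' by simp_all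
    have s1: "?s1 ''c'' 0 = ?c" "?s1 ''z'' 0 = z" "?s1 ''n'' = s' ''n''" "?s1 ''idx'' = s ''idx''"
      using fs sl by simp_all
    have PS1: "PS (KD A u z l) ?s1" using I by (simp add: PS_def)
    have cond: "bval ?q ?s1 \<longleftrightarrow> mc ?c + z = m"
      using inp1 s1 unfolding inp_def by (simp del: step.simps)
    have cC: "?c \<in> Cls u" using l by (simp add: Cls_def)
    have KDl: "KD A u z (Suc l) = (if mc ?c + z = m then insert (u, Some ?c) (KD A u z l) else KD A u z l)"
      using z cC by (auto simp: KD_def less_Suc_eq)
    show "wp ?body (\<lambda>t' s''. ?I (Suc l) (t + t' + acost (Read ''class_count'' (V ''u'')) + 10) (s''(''l'' := (s'' ''l'')(0 := Suc l)))) s'"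
    proof (rule wp_straight_Seq, simp, rule wp_Cond)
      fix t1 assume t1: "t1 \<le> tmax ?a"
      assume "bval ?q ?s1"
      then have mc: "mc ?c + z = m" using cond by simp
      show "wp (class_com Ca Ba) (\<lambda>t' s''. ?I (Suc l) (t + (t1 + (1 + bcost ?q + t')) + acost (Read ''class_count'' (V ''u'')) + 10)
          (s''(''l'' := (s'' ''l'')(0 := Suc l)))) ?s1"
      proof (rule wp_mono[OF wp_class[OF inp1 PS1 u(1), of ?c]])
        show "(u, None) \<in> KD A u z l" by (simp add: KD_def)
        show "?c \<in> Cls u" by fact
        show "0 < mc ?c" using mc z by simp
        show "(u, Some ?c) \<notin> KD A u z l" using u(2) mc by (auto simp: KD_def keys_def)
        show "c' \<in> Cls u \<and> mc ?c \<le> mc c'" if "(u, Some c') \<in> KD A u z l" for c'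
          using that u(2) mc by (auto simp: KD_def keys_def)
        show "?s1 ''idx'' (W j) = j" if "j < m" "U j = u" for j using idx that s1 by simp
        show "?s1 ''c'' 0 = ?c" by (rule s1)
      next
        fix t2 s2 assume "t2 \<le> 40 * (m + 2) \<and> PS (insert (u, Some ?c) (KD A u z l)) s2 \<and> s2 ''n'' 0 = ?s1 ''n'' 0 + 1"
        then show "?I (Suc l) (t + (t1 + (1 + bcost ?q + t2)) + acost (Read ''class_count'' (V ''u'')) + 10)
          (s2(''l'' := (s2 ''l'')(0 := Suc l)))"
          using KDl mc I t1 s1(3) by (auto simp: PS_def algebra_simps)
      qed
    next
      fix t1 assume t1: "t1 \<le> tmax ?a"
      assume "\<not> bval ?q ?s1"
      then have mc: "mc ?c + z \<noteq> m" using cond by simp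
      show "wp Skip (\<lambda>t' s''. ?I (Suc l) (t + (t1 + (1 + bcost ?q + t')) + acost (Read ''class_count'' (V ''u'')) + 10)
          (s''(''l'' := (s'' ''l'')(0 := Suc l)))) ?s1"
        using KDl mc I t1 by (intro wp_straight) (simp_all add: PS_def)
    qed
  qed (use P in \<open>simp_all add: PS_def\<close>)
qed

lemma wp_classes:
  assumes inp: "inp s" and P: "PS (insert (u, None) (keys A)) s" and u: "u \<in> U ` {..<m}" "u \<notin> A"
    and idx: "\<And>j. j < m \<Longrightarrow> U j = u \<Longrightarrow> s ''idx'' (W j) = j" and su: "s ''u'' 0 = u"
  shows "wp (classes_com Ca Ba)
    (\<lambda>t s'. PS (keys (insert u A)) s' \<and> t + 40 * (m + 2) * s ''n'' 0 \<le> m * (50 * cc u + 25) + 12 + 40 * (m + 2) * s' ''n'' 0) s"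
proof -
  let ?inner = "For ''l'' (Read ''class_count'' (V ''u''))
         (''c'' ::= Add (Read ''class_start'' (V ''u'')) (V ''l'');;
          Cond (Equal (Add (Read ''member_count'' (V ''c'')) (V ''z'')) (V ''edge_count''))
            (class_com Ca Ba) Skip)"
  note inp' = inp[unfolded inp_def]
  \<comment> \<open>A class lies in a neighbourhood, so no size exceeds \<open>m\<close> and the
    first round misses nothing.\<close>
  have "\<not> m < mc c" if "c \<in> Cls u" for c using mc_le[OF u(1) that] by simp
  then have KD0: "KD A u 0 0 = insert (u, None) (keys A)" by (auto simp: KD_def Cls_def)
  have KDm: "KD A u m 0 = keys (insert u A)" by (auto simp: KD_def keys_def)
  have KDS: "KD A u (Suc z) 0 = KD A u z (cc u)" for z by (auto simp: KD_def Cls_def)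
  let ?I = "\<lambda>z t s'. PS (KD A u z 0) s' \<and> t + 40 * (m + 2) * s ''n'' 0 \<le> z * (50 * cc u + 25) + 40 * (m + 2) * s' ''n'' 0"
  show ?thesis
    unfolding classes_com_def
  proof (rule wp_For[where n = m and I = ?I])
    fix s' assume "\<And>y. y \<notin> insert ''z'' (writes ?inner) \<Longrightarrow> s' y = s y"
    then show "aval (V ''edge_count'') s' = m" using inp' by simp
  next
    fix z t s' assume z: "z < m" and I: "?I z t s'" and sz: "s' ''z'' 0 = z"
      and fr: "\<And>y. y \<notin> insert ''z'' (writes ?inner) \<Longrightarrow> s' y = s y"
    have inp1: "inp s'" by (rule inp_frame[OF inp]) (auto intro!: fr)
    have fs: "s' ''u'' 0 = u" "s' ''idx'' = s ''idx''" using fr su by simp_all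
    show "wp ?inner (\<lambda>t' s''. ?I (Suc z) (t + t' + acost (V ''edge_count'') + 10) (s''(''z'' := (s'' ''z'')(0 := Suc z)))) s'"
      by (rule wp_mono[OF wp_classes_inner[OF inp1 _ u z]])
        (use I KDS fs sz idx in \<open>auto simp: PS_def algebra_simps\<close>)
  qed (use P KD0 KDm in \<open>simp_all add: PS_def\<close>)
qed

lemma wp_side:
  assumes inp: "inp s" and P: "PS {} s" and seen: "\<And>u. u \<in> U ` {..<m} \<Longrightarrow> s ''seen'' u = 0"
  shows "wp (side_com Ua Wa Ca Ba Ra) (\<lambda>t s'. PS (keys (U ` {..<m})) s' \<and> t \<le> 500 * (m + 2) * (m + 2) \<and>
    (\<forall>u. u \<notin> U ` {..<m} \<longrightarrow> s' ''seen'' u = s ''seen'' u)) s"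
proof -
  let ?body = "''u'' ::= Read Ua (V ''i'');;
        Cond (Equal (Read ''seen'' (V ''u'')) (Num 0))
          (Write ''seen'' (V ''u'') (Num 1);; root_com Ua Wa Ca Ba Ra;; classes_com Ca Ba) Skip"
  let ?q = "Equal (Read ''seen'' (V ''u'')) (Num 0)" and ?a = "''u'' ::= Read Ua (V ''i'')"
  note inp' = inp[unfolded inp_def]
  define M where "M = m + 2"
  \<comment> \<open>A node is charged \<open>100 * M\<close>: its insertion takes
    \<open>40 * M\<close>, and the scans in all size rounds take \<open>50 * M\<close> per class
    number. The \<open>200 * M\<close> per edge pay for \<open>root_com\<close> and the overhead.
    There are at most \<open>3 * m\<close> new nodes in the end, so \<open>500 * M * m\<close>
    suffices.\<close>
  let ?I = "\<lambda>i t s'. PS (keys (U ` {..<i})) s' \<and> t + 100 * M * n0 \<le> 200 * M * i + 100 * M * s' ''n'' 0 \<and>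
     (\<forall>u. s' ''seen'' u = (if u \<in> U ` {..<i} then 1 else s ''seen'' u))"
  have n00: "s ''n'' 0 = n0" using PS_card[OF P] by simp
  show ?thesis
    unfolding side_com_def
  proof (rule wp_For[where n = m and I = ?I])
    fix s' assume "\<And>y. y \<notin> insert ''i'' (writes ?body) \<Longrightarrow> s' y = s y"
    then show "aval (V ''edge_count'') s' = m" using inp' by simp
  next
    fix i t s' assume i: "i < m" and I: "?I i t s'" and si: "s' ''i'' 0 = i"
      and fr: "\<And>y. y \<notin> insert ''i'' (writes ?body) \<Longrightarrow> s' y = s y"
    let ?u = "U i" and ?A = "U ` {..<i}"
    let ?s1 = "step ?a s'"
    have inp1: "inp s'" by (rule inp_frame[OF inp]) (auto intro!: fr)
    have su: "?s1 ''u'' 0 = ?u" using inp1 si by (simp add: inp_def)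
    have s1: "?s1 ''seen'' = s' ''seen''" "?s1 ''n'' = s' ''n''" "PS K ?s1 \<longleftrightarrow> PS K s'" for K by (simp_all add: PS_def)
    have ui: "?u \<in> U ` {..<m}" using i by simp
    show "wp ?body (\<lambda>t' s''. ?I (Suc i) (t + t' + acost (V ''edge_count'') + 10) (s''(''i'' := (s'' ''i'')(0 := Suc i)))) s'"
    proof (rule wp_straight_Seq, simp, rule wp_Cond)
      fix t1 assume t1: "t1 \<le> tmax ?a"
      assume "bval ?q ?s1"
      then have "s' ''seen'' ?u = 0" using su by (simp del: step.simps add: s1)
      then have new: "?u \<notin> ?A" using I by (metis zero_neq_one)
      let ?s2 = "step (Write ''seen'' (V ''u'') (Num 1)) ?s1"
      have inp2: "inp ?s2" using inp1 by (simp add: inp_def)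
      have su2: "?s2 ''u'' 0 = ?u" using su by simp
      have s2: "?s2 ''n'' = s' ''n''" "PS (keys ?A) ?s2" "?s2 ''seen'' = (s' ''seen'')(?u := 1)"
        using I su by (simp_all add: PS_def)
      have key: "?u \<notin> fst ` keys ?A" using new by (auto simp: keys_def)
      show "wp (Write ''seen'' (V ''u'') (Num 1);; root_com Ua Wa Ca Ba Ra;; classes_com Ca Ba)
        (\<lambda>t' s''. ?I (Suc i) (t + (t1 + (1 + bcost ?q + t')) + acost (V ''edge_count'') + 10)
          (s''(''i'' := (s'' ''i'')(0 := Suc i)))) ?s1"
      proof (rule wp_straight_Seq, simp, rule wp_Seq, rule wp_frame[OF wp_root[OF inp2 s2(2) key su2]], goal_cases)
        case (1 t2 t3 s3)
        note r3 = 1(2) and fr3 = 1(3)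
        have inp3: "inp s3" by (rule inp_frame[OF inp2], rule fr3) auto
        have su3: "s3 ''u'' 0 = ?u" using fr3[of "''u''"] su2 by simp
        have seen3: "s3 ''seen'' = (s' ''seen'')(?u := 1)" by (rule trans[OF fr3 s2(3)]) simp
        have t2: "t2 \<le> 4" using 1(1) by simp
        show ?case
        proof (rule wp_frame[OF wp_classes[OF inp3 _ ui new _ su3]], goal_cases)
          case 1 then show ?case using r3 by simp
        next
          case (2 j) then show ?case using r3 by simp
        next
          case (3 t4 s4)
          have eq: "insert ?u ?A = U ` {..<Suc i}" by (simp add: lessThan_Suc)
          have P4: "PS (keys (U ` {..<Suc i})) s4" using 3(1) eq by simp
          have "card (keys (U ` {..<Suc i})) \<ge> card (keys ?A) + cc ?u"
            using card_keys_insert[OF ui new] eq by simp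
          then have n4: "s' ''n'' 0 + cc ?u \<le> s4 ''n'' 0"
            using PS_card[of "keys ?A" s'] PS_card[OF P4] I by linarith
          have n3: "s3 ''n'' 0 = s' ''n'' 0 + 1" using r3 s2(1) by simp
          then have n34: "s3 ''n'' 0 \<le> s4 ''n'' 0"
          proof -
            have "card (insert (?u, None) (keys ?A)) \<le> card (keys (U ` {..<Suc i}))"
              by (rule card_mono[OF finite_keys]) (auto simp: keys_def)
            then show ?thesis
              using PS_card[of "insert (?u, None) (keys ?A)" s3] PS_card[OF P4] r3 by linarith
          qed
          obtain d where d: "s4 ''n'' 0 = s' ''n'' 0 + d" using n4 by (metis le_iff_add add.assoc)
          have "t4 \<le> m * (50 * cc ?u + 25) + 12 + 40 * M * d"
          proof -
            have "t4 + 40 * M * s3 ''n'' 0 \<le> m * (50 * cc ?u + 25) + 12 + 40 * M * s4 ''n'' 0"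
              using 3(1) by (simp add: M_def)
            then show ?thesis unfolding d n3 by (simp add: algebra_simps)
          qed
          moreover have "m * (50 * cc ?u + 25) \<le> M * (50 * d + 25)"
            by (rule mult_le_mono) (use n4 d in \<open>auto simp: M_def\<close>)
          moreover have "t3 \<le> 80 * M" using r3 by (simp add: M_def)
          moreover have "M \<ge> 2" by (simp add: M_def)
          moreover have "t + 100 * M * n0 \<le> 200 * M * i + 100 * M * s' ''n'' 0" using I by simp
          ultimately have "t + (t1 + (1 + bcost ?q + (t2 + (t3 + t4)))) + acost (V ''edge_count'') + 10
              + 100 * M * n0 \<le> 200 * M * Suc i + 100 * M * s4 ''n'' 0"
            using t1 t2 unfolding d by (simp add: algebra_simps)
          moreover have "s4 ''seen'' = (s' ''seen'')(?u := 1)" by (rule trans[OF 3(2) seen3]) simp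
          then have "\<forall>u. s4 ''seen'' u = (if u \<in> U ` {..<Suc i} then 1 else s ''seen'' u)"
            using I by (auto simp: lessThan_Suc)
          ultimately show ?case using P4 by (simp add: PS_def add.assoc)
        qed
      qed
    next
      fix t1 assume t1: "t1 \<le> tmax ?a"
      assume "\<not> bval ?q ?s1"
      then have "s' ''seen'' ?u \<noteq> 0" using su by (simp del: step.simps add: s1)
      then have "?u \<in> ?A" using I seen[OF ui] by metis
      then have eq: "U ` {..<Suc i} = ?A" by (auto simp: lessThan_Suc)
      have "M \<ge> 2" by (simp add: M_def)
      then show "wp Skip (\<lambda>t' s''. ?I (Suc i) (t + (t1 + (1 + bcost ?q + t')) + acost (V ''edge_count'') + 10)
          (s''(''i'' := (s'' ''i'')(0 := Suc i)))) ?s1"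
        using eq I t1 by (intro wp_straight) (simp_all add: PS_def)
    qed
  next
    fix t t' s' assume I: "?I m t s'" and t': "t' \<le> t + acost (V ''edge_count'') + 10"
    have "s' ''n'' 0 \<le> n0 + 3 * m"
      using PS_card[of "keys (U ` {..<m})" s'] card_keys_le I by linarith
    then have "100 * M * s' ''n'' 0 \<le> 100 * M * (n0 + 3 * m)" by simp
    then have "t \<le> 500 * M * m" using I by (simp add: algebra_simps)
    then show "PS (keys (U ` {..<m})) s' \<and> t' \<le> 500 * (m + 2) * (m + 2) \<and>
        (\<forall>u. u \<notin> U ` {..<m} \<longrightarrow> s' ''seen'' u = s ''seen'' u)"
      using I t' by (simp add: M_def algebra_simps)
  qed (use P n00 in \<open>simp_all add: PS_def keys_def\<close>)
qed

end

section \<open>Searching and augmenting\<close>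

text \<open>Comparing all pairs is quadratic but done only once; the incidence lists then make every
  search linear.\<close>

definition adj_com :: com where
  "adj_com =
     (''p'' ::= Num 0;;
      For ''x'' (V ''n'')
        (Write ''start'' (V ''x'') (V ''p'');;
         For ''j'' (V ''n'')
           (Cond (And (Neg (Equal (Read ''tail'' (V ''j'')) (V ''x''))) (Neg (Equal (Read ''head'' (V ''j'')) (V ''x''))))
             Skip (Write ''adj'' (V ''p'') (V ''j'');; ''p'' ::= Add (V ''p'') (Num 1))));;
      Write ''start'' (V ''n'') (V ''p''))"

text \<open>Levels start at 1, so that 0 in \<open>vis\<close> can mean unvisited. They also measure
  the way back to the source.\<close>

definition visit_com :: "aexp \<Rightarrow> com" where
  "visit_com a = (''y'' ::= a;; Write ''vis'' (V ''y'') (Add (Read ''vis'' (V ''x'')) (Num 1));;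
     Write ''pred'' (V ''y'') (V ''j'');; Write ''queue'' (V ''qt'') (V ''y'');; ''qt'' ::= Add (V ''qt'') (Num 1))"

text \<open>The body of one flat loop instead of two nested ones: a round inspects one incidence or
  passes to the next node. After the last node \<open>p\<close> is loaded from an arbitrary queue
  cell, but then the loop stops.\<close>

definition scan_com :: com where
  "scan_com =
     (''x'' ::= Read ''queue'' (V ''qh'');;
      Cond (Less (V ''p'') (Read ''start'' (Add (V ''x'') (Num 1))))
        (''j'' ::= Read ''adj'' (V ''p'');; ''p'' ::= Add (V ''p'') (Num 1);;
         Cond (And (Equal (Read ''tail'' (V ''j'')) (V ''x'')) (And (Less (Read ''flow'' (V ''j'')) (Read ''cap'' (V ''j'')))
                (And (Equal (Read ''frozen'' (V ''j'')) (Num 0)) (Equal (Read ''vis'' (Read ''head'' (V ''j''))) (Num 0)))))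
           (visit_com (Read ''head'' (V ''j'')))
           (Cond (And (Equal (Read ''head'' (V ''j'')) (V ''x'')) (And (Less (Num 0) (Read ''flow'' (V ''j'')))
                (And (Equal (Read ''frozen'' (V ''j'')) (Num 0)) (Equal (Read ''vis'' (Read ''tail'' (V ''j''))) (Num 0)))))
             (visit_com (Read ''tail'' (V ''j''))) Skip))
        (''qh'' ::= Add (V ''qh'') (Num 1);; ''p'' ::= Read ''start'' (Read ''queue'' (V ''qh''))))"

definition search_com :: com where
  "search_com =
     (For ''x'' (V ''n'') (Write ''vis'' (V ''x'') (Num 0));;
      (Write ''vis'' (V ''edge_count'') (Num 1);; ''qh'' ::= Num 0;; ''qt'' ::= Num 1;;
       Write ''queue'' (Num 0) (V ''edge_count'');; ''p'' ::= Read ''start'' (V ''edge_count''));;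
      While (Less (V ''qh'') (V ''qt'')) scan_com)"

definition augment_com :: com where
  "augment_com =
     (''y'' ::= Add (V ''edge_count'') (Num 1);;
      While (Neg (Equal (V ''y'') (V ''edge_count'')))
        (''j'' ::= Read ''pred'' (V ''y'');;
         Cond (Equal (Read ''head'' (V ''j'')) (V ''y''))
           (Write ''flow'' (V ''j'') (Add (Read ''flow'' (V ''j'')) (Num 1));; ''y'' ::= Read ''tail'' (V ''j''))
           (Write ''flow'' (V ''j'') (Sub (Read ''flow'' (V ''j'')) (Num 1));; ''y'' ::= Read ''head'' (V ''j''))))"

lemma writes_adj [simp]: "writes adj_com = {''p'', ''x'', ''start'', ''j'', ''adj''}"
  by (auto simp: adj_com_def)
lemma writes_visit [simp]: "writes (visit_com a) = {''y'', ''vis'', ''pred'', ''queue'', ''qt''}"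
  by (auto simp: visit_com_def)
lemma writes_scan [simp]: "writes scan_com = {''x'', ''j'', ''p'', ''qh'', ''y'', ''vis'', ''pred'', ''queue'', ''qt''}"
  by (auto simp: scan_com_def)
lemma writes_search [simp]: "writes search_com = {''x'', ''j'', ''p'', ''qh'', ''y'', ''vis'', ''pred'', ''queue'', ''qt''}"
  by (auto simp: search_com_def)
lemma writes_augment [simp]: "writes augment_com = {''y'', ''j'', ''flow''}"
  by (auto simp: augment_com_def)

section \<open>Incidence lists and breadth-first search\<close>

context net
begin

definition inc :: "nat \<Rightarrow> nat \<Rightarrow> bool" where "inc j x \<longleftrightarrow> tl j = x \<or> hd j = x"
definition dg :: "nat \<Rightarrow> nat \<Rightarrow> nat" where "dg x k = (\<Sum>j<k. if inc j x then 1 else 0)"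
definition S :: "nat \<Rightarrow> nat" where "S x = (\<Sum>y<x. dg y n2)"

definition csr :: "(nat \<Rightarrow> nat) \<Rightarrow> (nat \<Rightarrow> nat) \<Rightarrow> bool" where
  "csr start adj \<longleftrightarrow> (\<forall>y\<le>n2. start y = S y) \<and> (\<forall>q<S n2. adj q < n2) \<and>
     (\<forall>y<n2. \<forall>j<n2. inc j y \<longrightarrow> (\<exists>q. S y \<le> q \<and> q < S (Suc y) \<and> adj q = j))"

lemma dg_Suc: "dg x (Suc k) = dg x k + (if inc k x then 1 else 0)"
  by (simp add: dg_def)

lemma S_Suc: "S (Suc x) = S x + dg x n2"
  by (simp add: S_def)

text \<open>Double counting: a link has at most two ends.\<close>

lemma S_n2_le: "S n2 \<le> 2 * n2"
proof -
  have "S n2 = (\<Sum>j<n2. \<Sum>x<n2. if inc j x then 1 else 0)"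
    unfolding S_def dg_def by (rule sum.swap)
  also have "\<dots> \<le> (\<Sum>j<n2. 2)"
  proof (rule sum_mono)
    fix j
    have "(\<Sum>x<n2. if inc j x then 1 else 0) = card {x. x < n2 \<and> inc j x}"
      by (simp add: sum.If_cases Int_def)
    also have "\<dots> \<le> card {tl j, hd j}" by (rule card_mono) (auto simp: inc_def)
    also have "\<dots> \<le> 2" by (simp add: card_insert_if)
    finally show "(\<Sum>x<n2. if inc j x then 1 else 0) \<le> (2::nat)" .
  qed
  finally show ?thesis by simp
qed

lemma S_mono: "x \<le> y \<Longrightarrow> S x \<le> S y"
  unfolding S_def by (rule sum_mono2) auto

lemma wp_adj:
  assumes s: "s ''tail'' = tl" "s ''head'' = hd" "s ''n'' 0 = n2"
  shows "wp adj_com (\<lambda>t s'. csr (s' ''start'') (s' ''adj'') \<and> t \<le> 70 * (n2 + 1) * (n2 + 1)) s"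
proof -
  let ?ibody = "Cond (And (Neg (Equal (Read ''tail'' (V ''j'')) (V ''x''))) (Neg (Equal (Read ''head'' (V ''j'')) (V ''x''))))
             Skip (Write ''adj'' (V ''p'') (V ''j'');; ''p'' ::= Add (V ''p'') (Num 1))"
  let ?obody = "Write ''start'' (V ''x'') (V ''p'');; For ''j'' (V ''n'') ?ibody"
  define filled where "filled x adj \<longleftrightarrow>
      (\<forall>y<x. \<forall>j<n2. inc j y \<longrightarrow> (\<exists>q. S y \<le> q \<and> q < S (Suc y) \<and> adj q = j))" for x and adj :: "nat \<Rightarrow> nat"
  let ?I = "\<lambda>x s'. (\<forall>y<x. s' ''start'' y = S y) \<and> s' ''p'' 0 = S x \<and> filled x (s' ''adj'') \<and> (\<forall>q<S x. s' ''adj'' q < n2)"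
  show ?thesis
    unfolding adj_com_def
  proof (rule wp_straight_Seq, simp, rule wp_Seq, rule wp_For_const[where n = n2 and I = ?I and b = "50 * (n2 + 1)"])
    fix x s' assume x: "x < n2" and I: "?I x s'" and sx: "s' ''x'' 0 = x"
      and fr: "\<And>y. y \<notin> insert ''x'' (writes ?obody) \<Longrightarrow> s' y = step (''p'' ::= Num 0) s y"
    have fs: "s' ''tail'' = tl" "s' ''head'' = hd" "s' ''n'' 0 = n2" using fr s by simp_all
    let ?s1 = "step (Write ''start'' (V ''x'') (V ''p'')) s'"
    have s1: "?s1 ''tail'' = tl" "?s1 ''head'' = hd" "?s1 ''n'' 0 = n2" "?s1 ''x'' 0 = x" "?s1 ''p'' 0 = S x"
      "?s1 ''adj'' = s' ''adj''" "\<forall>y<Suc x. ?s1 ''start'' y = S y"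
      using fs sx I by (simp_all add: less_Suc_eq)
    let ?J = "\<lambda>k s2. s2 ''p'' 0 = S x + dg x k \<and> filled x (s2 ''adj'') \<and> (\<forall>q<S x + dg x k. s2 ''adj'' q < n2) \<and>
       (\<forall>j<k. inc j x \<longrightarrow> (\<exists>q. S x \<le> q \<and> q < S x + dg x k \<and> s2 ''adj'' q = j))"
    show "wp ?obody (\<lambda>t' s''. t' \<le> 50 * (n2 + 1) \<and> ?I (Suc x) (s''(''x'' := (s'' ''x'')(0 := Suc x)))) s'"
    proof (rule wp_straight_Seq, simp, rule wp_For_const[where n = n2 and I = ?J and b = 30])
      fix k s2 assume k: "k < n2" and J: "?J k s2" and sj: "s2 ''j'' 0 = k"
        and fr2: "\<And>y. y \<notin> insert ''j'' (writes ?ibody) \<Longrightarrow> s2 y = ?s1 y"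
      have fs2: "s2 ''tail'' = tl" "s2 ''head'' = hd" "s2 ''x'' 0 = x"
        using fr2[of "''tail''"] fr2[of "''head''"] fr2[of "''x''"] s1 by simp_all
      have bv: "bval (And (Neg (Equal (Read ''tail'' (V ''j'')) (V ''x''))) (Neg (Equal (Read ''head'' (V ''j'')) (V ''x'')))) s2 \<longleftrightarrow> \<not> inc k x"
        using fs2 sj by (simp add: inc_def)
      show "wp ?ibody (\<lambda>t' s''. t' \<le> 30 \<and> ?J (Suc k) (s''(''j'' := (s'' ''j'')(0 := Suc k)))) s2"
      proof (cases "inc k x")
        case False
        then have st: "step ?ibody s2 = s2" using bv by simp
        show ?thesis
          by (rule wp_straight) (use st J False in \<open>auto simp: dg_Suc less_Suc_eq simp del: step.simps\<close>)
      next
        case True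
        let ?a = "(s2 ''adj'')(S x + dg x k := k)"
        have st: "step ?ibody s2 ''adj'' = ?a" "step ?ibody s2 ''p'' 0 = Suc (S x + dg x k)"
          using True fs2 J sj by (auto simp: inc_def)
        have old: "?a q = s2 ''adj'' q" if "q < S x + dg x k" for q using that by simp
        have "filled x ?a"
          unfolding filled_def
        proof (intro allI impI)
          fix y j assume y: "y < x" and j: "j < n2" "inc j y"
          then obtain q where q: "S y \<le> q" "q < S (Suc y)" "s2 ''adj'' q = j"
            using J unfolding filled_def by blast
          then have "q < S x" using S_mono[of "Suc y" x] y by simp
          then show "\<exists>q. S y \<le> q \<and> q < S (Suc y) \<and> ?a q = j" using q old[of q] by (intro exI[of _ q]) simp
        qed
        moreover have "\<exists>q. S x \<le> q \<and> q < Suc (S x + dg x k) \<and> ?a q = j" if j: "j < Suc k" "inc j x" for j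
        proof (cases "j = k")
          case True
          then show ?thesis by (intro exI[of _ "S x + dg x k"]) simp
        next
          case False
          then have "j < k" using j(1) by simp
          then obtain q where "S x \<le> q" "q < S x + dg x k" "s2 ''adj'' q = j" using J j(2) by blast
          then show ?thesis using old[of q] by (intro exI[of _ q]) simp
        qed
        moreover have "\<forall>q<Suc (S x + dg x k). ?a q < n2" using J k by (simp add: less_Suc_eq)
        moreover have d: "S x + dg x (Suc k) = Suc (S x + dg x k)" using True by (simp add: dg_Suc)
        moreover have "tmax ?ibody \<le> 30" by simp
        ultimately show ?thesis
          by (intro wp_straight) (simp_all del: One_nat_def step.simps tmax.simps fun_upd_apply add: fun_upd_other st d)
      qed
    next
      fix t0 t1 s2
      assume t0: "t0 \<le> tmax (Write ''start'' (V ''x'') (V ''p''))" and J: "?J n2 s2"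
        and fr2: "\<And>y. y \<notin> insert ''j'' (writes ?ibody) \<Longrightarrow> s2 y = ?s1 y"
        and t1: "t1 \<le> Suc n2 * (30 + acost (V ''n'') + 10)"
      have "s2 ''start'' = ?s1 ''start''" by (rule fr2) simp
      then have "\<forall>y<Suc x. s2 ''start'' y = S y" using s1(7) by metis
      moreover have "filled (Suc x) (s2 ''adj'')"
        using J by (auto simp: filled_def less_Suc_eq S_Suc)
      ultimately show "t0 + t1 \<le> 50 * (n2 + 1) \<and> ?I (Suc x) (s2(''x'' := (s2 ''x'')(0 := Suc x)))"
        using J t0 t1 by (simp add: S_Suc)
    next
      fix s2 assume fr2: "\<And>y. y \<notin> insert ''j'' (writes ?ibody) \<Longrightarrow> s2 y = ?s1 y"
      show "aval (V ''n'') s2 = n2" using fr2[of "''n''"] s1(3) by simp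
    qed (use I in \<open>simp_all add: dg_def\<close>)
  next
    fix t0 t1 s' assume t0: "t0 \<le> tmax (''p'' ::= Num 0)" and I: "?I n2 s'"
      and fr: "\<And>y. y \<notin> insert ''x'' (writes ?obody) \<Longrightarrow> s' y = step (''p'' ::= Num 0) s y"
      and t1: "t1 \<le> Suc n2 * (50 * (n2 + 1) + acost (V ''n'') + 10)"
    have n: "s' ''n'' 0 = n2" using fr s by simp
    \<comment> \<open>The cell \<open>start n2\<close> marks the end of the last list, which the
      search reads as the start of the next one.\<close>
    have "csr ((s' ''start'')(n2 := S n2)) (s' ''adj'')"
      using I by (auto simp: csr_def filled_def le_less)
    moreover have "t0 + (t1 + t) \<le> 70 * (n2 + 1) * (n2 + 1)" if "t \<le> 5" for t
    proof -
      have "t0 + (t1 + t) \<le> Suc n2 * (50 * (n2 + 1) + 12) + 8" using t0 t1 that by simp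
      also have "\<dots> \<le> 70 * (n2 + 1) * (n2 + 1)"
      proof -
        have "n2 \<ge> 1" using n1 n2 by simp
        then have "n2 + 1 \<ge> 2" by simp
        have "8 \<le> 4 * (n2 + 1)" using \<open>n2 \<ge> 1\<close> by simp
        moreover have "(n2 + 1) * 2 \<le> (n2 + 1) * (n2 + 1)" using \<open>n2 + 1 \<ge> 2\<close> by (rule mult_le_mono2)
        ultimately show ?thesis by (simp add: algebra_simps)
      qed
      finally show ?thesis .
    qed
    ultimately show "wp (Write ''start'' (V ''n'') (V ''p''))
        (\<lambda>t' s'. csr (s' ''start'') (s' ''adj'') \<and> t0 + (t1 + t') \<le> 70 * (n2 + 1) * (n2 + 1)) s'"
      by (intro wp_straight) (use n I in simp_all)
  qed (use s in \<open>simp_all add: S_def filled_def\<close>)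
qed

lemma link_ends:
  assumes "j \<in> links"
  shows "tl j < n2" "hd j < n2" "tl j \<noteq> hd j" "j < n2"
proof -
  consider (E) "j < m" | (LL) "m + 2 \<le> j" "j < n1" | (RR) "n1 \<le> j" "j < n2"
    using assms n1 n2 by (fastforce simp: links_def tree_def)
  then show "tl j < n2" "hd j < n2" "tl j \<noteq> hd j" "j < n2"
    using edge[of j] left[of j] right[of j] n1 n2 by (cases; auto)+
qed

lemma trav_ends: "trav f cap fr j x y \<Longrightarrow> x < n2 \<and> y < n2 \<and> j < n2 \<and> inc j x \<and> j \<in> links"
  using link_ends[of j] by (auto simp: trav_def inc_def)

lemma trav_unique: "trav f cap fr j x y \<Longrightarrow> trav f' cap' fr' j x y' \<Longrightarrow> y = y'"
  using link_ends(3)[of j] by (auto simp: trav_def)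

lemma trav_same_link: "trav f cap fr j x y \<Longrightarrow> trav f' cap' fr' j x' y' \<Longrightarrow> x = x' \<and> y = y' \<or> x = y' \<and> y = x'"
  by (auto simp: trav_def)

definition tree_ok :: "(nat \<Rightarrow> nat) \<Rightarrow> (nat \<Rightarrow> nat) \<Rightarrow> (nat \<Rightarrow> nat) \<Rightarrow> (nat \<Rightarrow> nat) \<Rightarrow> (nat \<Rightarrow> nat) \<Rightarrow> bool" where
  "tree_ok f cap fr vis pred \<longleftrightarrow> vis m = 1 \<and>
     (\<forall>y<n2. vis y \<noteq> 0 \<and> y \<noteq> m \<longrightarrow> (\<exists>x. trav f cap fr (pred y) x y \<and> vis x \<noteq> 0 \<and> vis y = vis x + 1))"

text \<open>\<open>p\<close> is a position in the list of the front node and is constrained only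
  while the queue is nonempty. Bounding the levels by the queue length bounds the path that
  \<open>augment_com\<close> follows.\<close>

definition bfs where
  "bfs f cap fr adj qh qt p queue vis pred \<longleftrightarrow>
     inj_on queue {..<qt} \<and> queue ` {..<qt} = {y. y < n2 \<and> vis y \<noteq> 0} \<and> qh \<le> qt \<and>
     (\<forall>y<n2. vis y \<le> qt) \<and> tree_ok f cap fr vis pred \<and>
     (\<forall>i<qh. \<forall>j y. trav f cap fr j (queue i) y \<longrightarrow> vis y \<noteq> 0) \<and>
     (qh < qt \<longrightarrow> S (queue qh) \<le> p \<and> p \<le> S (Suc (queue qh)) \<and>
        (\<forall>q y. S (queue qh) \<le> q \<and> q < p \<and> trav f cap fr (adj q) (queue qh) y \<longrightarrow> vis y \<noteq> 0))"

lemma bfs_qt: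
  assumes "bfs f cap fr adj qh qt p queue vis pred"
  shows "qt \<le> n2"
proof -
  have "inj_on queue {..<qt}" using assms by (simp add: bfs_def)
  then have "card (queue ` {..<qt}) = qt" by (simp add: card_image)
  moreover have "queue ` {..<qt} \<subseteq> {..<n2}" using assms by (auto simp: bfs_def)
  ultimately show ?thesis by (metis card_lessThan card_mono finite_lessThan)
qed

lemma bfs_queue: "bfs f cap fr adj qh qt p queue vis pred \<Longrightarrow> i < qt \<Longrightarrow> queue i < n2 \<and> vis (queue i) \<noteq> 0"
  unfolding bfs_def by blast

lemma bfs_visit:
  assumes b: "bfs f cap fr adj qh qt p queue vis pred" and q: "qh < qt" "p < S (Suc (queue qh))"
    and tr: "trav f cap fr (adj p) (queue qh) y" and y: "vis y = 0"
  shows "bfs f cap fr adj qh (Suc qt) (Suc p) (queue(qt := y)) (vis(y := vis (queue qh) + 1)) (pred(y := adj p))"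
proof -
  let ?x = "queue qh" and ?vis = "vis(y := vis (queue qh) + 1)" and ?queue = "queue(qt := y)"
  have yn: "y < n2" using trav_ends[OF tr] by simp
  have x: "?x < n2" "vis ?x \<noteq> 0" using bfs_queue[OF b q(1)] by auto
  have ym: "y \<noteq> m" using b y by (auto simp: bfs_def tree_ok_def)
  have im: "queue ` {..<qt} = {y. y < n2 \<and> vis y \<noteq> 0}" using b by (simp add: bfs_def)
  have "?queue ` {..<qt} = queue ` {..<qt}" by (intro image_cong) auto
  then have "?queue ` {..<Suc qt} = {z. z < n2 \<and> ?vis z \<noteq> 0}"
    using im yn by (auto simp: lessThan_Suc)
  moreover have "inj_on ?queue {..<Suc qt}"
  proof -
    have "inj_on ?queue {..<qt}" using b by (subst inj_on_cong[of _ _ queue]) (auto simp: bfs_def)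
    moreover have "y \<notin> ?queue ` {..<qt}" using \<open>?queue ` {..<qt} = queue ` {..<qt}\<close> im y by auto
    ultimately show ?thesis by (auto simp: lessThan_Suc)
  qed
  moreover have "\<forall>z<n2. ?vis z \<le> Suc qt" using b x by (auto simp: bfs_def intro: le_SucI)
  moreover have "tree_ok f cap fr ?vis (pred(y := adj p))"
    unfolding tree_ok_def
  proof (intro conjI allI impI)
    show "?vis m = 1" using b ym by (simp add: bfs_def tree_ok_def)
    fix z assume z: "z < n2" "?vis z \<noteq> 0 \<and> z \<noteq> m"
    show "\<exists>x. trav f cap fr ((pred(y := adj p)) z) x z \<and> ?vis x \<noteq> 0 \<and> ?vis z = ?vis x + 1"
    proof (cases "z = y")
      case True
      then show ?thesis using tr x y by (intro exI[of _ ?x]) auto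
    next
      case False
      then obtain w where "trav f cap fr (pred z) w z" "vis w \<noteq> 0" "vis z = vis w + 1"
        using b z unfolding bfs_def tree_ok_def by auto
      then show ?thesis using False y by (intro exI[of _ w]) auto
    qed
  qed
  moreover have "\<forall>i<qh. \<forall>j z. trav f cap fr j (?queue i) z \<longrightarrow> ?vis z \<noteq> 0"
    using b q by (auto simp: bfs_def)
  moreover have "\<forall>k z. S ?x \<le> k \<and> k < Suc p \<and> trav f cap fr (adj k) ?x z \<longrightarrow> ?vis z \<noteq> 0"
  proof (intro allI impI)
    fix k z assume that: "S ?x \<le> k \<and> k < Suc p \<and> trav f cap fr (adj k) ?x z"
    show "?vis z \<noteq> 0"
    proof (cases "k = p")
      case True
      then show ?thesis using trav_unique[OF tr] that by auto
    next
      case False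
      then show ?thesis using b q that unfolding bfs_def by (auto simp: less_Suc_eq)
    qed
  qed
  moreover have "S ?x \<le> p" "qh \<le> qt" using b q by (auto simp: bfs_def)
  moreover have "?queue qh = ?x" using q by simp
  ultimately show ?thesis using q unfolding bfs_def by (simp del: fun_upd_apply)
qed

lemma bfs_skip:
  assumes b: "bfs f cap fr adj qh qt p queue vis pred" and q: "qh < qt" "p < S (Suc (queue qh))"
    and tr: "\<And>y. trav f cap fr (adj p) (queue qh) y \<Longrightarrow> vis y \<noteq> 0"
  shows "bfs f cap fr adj qh qt (Suc p) queue vis pred"
  using assms unfolding bfs_def by (auto simp: less_Suc_eq)

text \<open>By \<open>csr\<close>, every link at the front node occurs in its list, and the whole
  list has been inspected.\<close>

lemma bfs_next:
  assumes b: "bfs f cap fr adj qh qt p queue vis pred" and c: "csr start adj"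
    and q: "qh < qt" "\<not> p < S (Suc (queue qh))"
  shows "bfs f cap fr adj (Suc qh) qt (start (queue (Suc qh))) queue vis pred"
proof -
  let ?x = "queue qh"
  have p: "p = S (Suc ?x)" using b q by (auto simp: bfs_def)
  have "vis y \<noteq> 0" if tr: "trav f cap fr j ?x y" for j y
  proof -
    obtain k where "S ?x \<le> k" "k < S (Suc ?x)" "adj k = j"
      using c trav_ends[OF tr] unfolding csr_def by blast
    then show ?thesis using b q p tr unfolding bfs_def by blast
  qed
  then have "\<forall>i<Suc qh. \<forall>j y. trav f cap fr j (queue i) y \<longrightarrow> vis y \<noteq> 0"
    using b by (auto simp: bfs_def less_Suc_eq)
  moreover have "start (queue (Suc qh)) = S (queue (Suc qh))" if "Suc qh < qt"
    using c bfs_queue[OF b that] by (simp add: csr_def)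
  ultimately show ?thesis using b q S_mono[of _ "Suc _"] unfolding bfs_def by auto
qed

lemma bfs_init:
  assumes "m < n2" "start m = S m" "\<And>y. y < n2 \<Longrightarrow> vis y = (if y = m then 1 else 0)" "queue 0 = m"
  shows "bfs f cap fr adj 0 1 (start m) queue vis pred"
  using assms S_mono[of m "Suc m"] by (auto simp: bfs_def tree_ok_def lessThan_Suc split: if_splits)

text \<open>Number of list entries inspected so far. Passing to the next node leaves it unchanged,
  and as the queue has no repetitions it cannot exceed \<open>S n2\<close>.\<close>

definition processed :: "nat \<Rightarrow> nat \<Rightarrow> nat \<Rightarrow> (nat \<Rightarrow> nat) \<Rightarrow> nat" where
  "processed qh qt p queue = (\<Sum>i<qh. dg (queue i) n2) + (if qh < qt then p - S (queue qh) else 0)"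

lemma processed_bound:
  assumes b: "bfs f cap fr adj qh qt p queue vis pred" and q: "qh < qt" "p < S (Suc (queue qh))"
  shows "processed qh qt p queue < S n2"
proof -
  have "processed qh qt p queue < (\<Sum>i<Suc qh. dg (queue i) n2)"
    using b q S_Suc[of "queue qh"] by (auto simp: processed_def bfs_def)
  also have "\<dots> = (\<Sum>x\<in>queue ` {..<Suc qh}. dg x n2)"
    using b q by (subst sum.reindex) (auto simp: bfs_def intro: inj_on_subset)
  also have "\<dots> \<le> S n2"
    unfolding S_def using bfs_queue[OF b] q by (intro sum_mono2) auto
  finally show ?thesis .
qed

definition reach where
  "reach f cap fr vis pred \<longleftrightarrow> tree_ok f cap fr vis pred \<and> (\<forall>y<n2. vis y \<le> n2) \<and>
     (\<forall>j x y. trav f cap fr j x y \<longrightarrow> vis x \<noteq> 0 \<longrightarrow> vis y \<noteq> 0)"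

lemma bfs_reach:
  assumes b: "bfs f cap fr adj qh qt p queue vis pred" and q: "\<not> qh < qt"
  shows "reach f cap fr vis pred"
proof -
  have eq: "qh = qt" using b q by (auto simp: bfs_def)
  have "vis y \<noteq> 0" if tr: "trav f cap fr j x y" and x: "vis x \<noteq> 0" for j x y
  proof -
    have "x \<in> queue ` {..<qt}" using b x trav_ends[OF tr] by (auto simp: bfs_def)
    then obtain i where "i < qh" "x = queue i" using eq by auto
    then show ?thesis using b tr unfolding bfs_def by blast
  qed
  moreover have "\<forall>y<n2. vis y \<le> n2" using b bfs_qt[OF b] by (auto simp: bfs_def intro: order_trans)
  ultimately show ?thesis using b by (auto simp: reach_def bfs_def)
qed

definition arr :: "state \<Rightarrow> bool" where
  "arr s \<longleftrightarrow> s ''tail'' = tl \<and> s ''head'' = hd \<and> s ''n'' 0 = n2 \<and> s ''edge_count'' 0 = m \<and>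
     csr (s ''start'') (s ''adj'')"

text \<open>The numbers \<open>m\<close> and \<open>m + 1\<close> name nodes but no links, and yet
  they are scanned as links by \<open>adj_com\<close>. With flow and capacity 0 they can never be
  traversed.\<close>

definition idle :: "(nat \<Rightarrow> nat) \<Rightarrow> (nat \<Rightarrow> nat) \<Rightarrow> bool" where
  "idle f cap \<longleftrightarrow> (\<forall>j<n2. j \<notin> links \<longrightarrow> f j = 0 \<and> cap j = 0)"

lemma wp_search:
  assumes arr: "arr s" and idle: "idle (s ''flow'') (s ''cap'')"
  shows "wp search_com (\<lambda>t s'. reach (s ''flow'') (s ''cap'') (s ''frozen'') (s' ''vis'') (s' ''pred'') \<and>
     t \<le> 1000 * (n2 + 1)) s"
proof -
  let ?f = "s ''flow''" and ?cap = "s ''cap''" and ?fr = "s ''frozen''" and ?adj = "s ''adj''" and ?start = "s ''start''"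
  note arr' = arr[unfolded arr_def]
  have mn: "m < n2" using n1 n2 by simp
  have csr: "csr ?start ?adj" using arr' by simp
  let ?init = "Write ''vis'' (V ''edge_count'') (Num 1);; ''qh'' ::= Num 0;; ''qt'' ::= Num 1;;
       Write ''queue'' (Num 0) (V ''edge_count'');; ''p'' ::= Read ''start'' (V ''edge_count'')"
  let ?J = "\<lambda>s'. bfs ?f ?cap ?fr ?adj (s' ''qh'' 0) (s' ''qt'' 0) (s' ''p'' 0) (s' ''queue'') (s' ''vis'') (s' ''pred'')"
  let ?K = 300
  \<comment> \<open>Each round decreases one of the two differences, and \<open>?K\<close> covers
    the cost of a round including the test. The total is at most
    \<open>300 * (n2 + 2 * n2)\<close>.\<close>
  define \<Phi> where "\<Phi> s' = ?K * ((n2 - s' ''qh'' 0) + (S n2 - processed (s' ''qh'' 0) (s' ''qt'' 0) (s' ''p'' 0) (s' ''queue'')))" for s' :: state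
  have \<Phi>_le: "\<Phi> s' \<le> 900 * n2" for s' using S_n2_le by (simp add: \<Phi>_def)
  have tm: "tmax scan_com + 1 + bcost (Less (V ''qh'') (V ''qt'')) \<le> ?K"
    by (simp add: scan_com_def visit_com_def)
  have scan: "?J (step scan_com s') \<and> ?K + \<Phi> (step scan_com s') \<le> \<Phi> s'"
    if J: "?J s'" and q: "s' ''qh'' 0 < s' ''qt'' 0"
      and fr: "s' ''tail'' = tl" "s' ''head'' = hd" "s' ''flow'' = ?f" "s' ''cap'' = ?cap" "s' ''frozen'' = ?fr"
        "s' ''adj'' = ?adj" "s' ''start'' = ?start" for s'
  proof -
    let ?qh = "s' ''qh'' 0" and ?qt = "s' ''qt'' 0" and ?p = "s' ''p'' 0"
    let ?x = "s' ''queue'' ?qh"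
    let ?j = "?adj ?p"
    have x: "?x < n2" using bfs_queue[OF J q] by simp
    then have st: "?start (Suc ?x) = S (Suc ?x)" using csr by (simp add: csr_def)
    have qn: "?qh < n2" using bfs_qt[OF J] q by simp
    show ?thesis
    proof (cases "?p < S (Suc ?x)")
      case False
      let ?s = "step scan_com s'"
      have s: "?s ''qh'' 0 = Suc ?qh" "?s ''qt'' = s' ''qt''" "?s ''p'' 0 = ?start (s' ''queue'' (Suc ?qh))"
        "?s ''queue'' = s' ''queue''" "?s ''vis'' = s' ''vis''" "?s ''pred'' = s' ''pred''"
        using False fr st by (simp_all add: scan_com_def)
      have J': "?J ?s" unfolding s by (rule bfs_next[OF J csr q False])
      have "?p = S (Suc ?x)" using J q False by (auto simp: bfs_def)
      then have "processed (Suc ?qh) ?qt (?start (s' ''queue'' (Suc ?qh))) (s' ''queue'') = processed ?qh ?qt ?p (s' ''queue'')"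
        using q S_Suc[of ?x] csr bfs_queue[OF J, of "Suc ?qh"] by (auto simp: processed_def csr_def)
      then show ?thesis using J' qn by (simp add: \<Phi>_def s)
    next
      case True
      have pn: "?p < S n2" using True S_mono[of "Suc ?x" n2] x by simp
      then have jn: "?j < n2" using csr by (simp add: csr_def)
      \<comment> \<open>The program does not test for the two numbers that are not links;
        \<open>idle\<close> rules them out.\<close>
      have jl: "?j \<in> links" if "?f ?j < ?cap ?j \<or> 0 < ?f ?j"
        using idle jn that unfolding idle_def by fastforce
      have pb: "processed ?qh ?qt ?p (s' ''queue'') < S n2" by (rule processed_bound[OF J q True])
      have Sp: "S ?x \<le> ?p" using J q by (auto simp: bfs_def)
      have pS: "processed ?qh qt' (Suc ?p) queue' = Suc (processed ?qh ?qt ?p (s' ''queue''))"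
        if "?qh < qt'" "\<And>i. i \<le> ?qh \<Longrightarrow> queue' i = s' ''queue'' i" for qt' queue'
        using that q Sp by (simp add: processed_def)
      have visit: ?thesis
        if s: "step scan_com s' ''qh'' 0 = ?qh" "step scan_com s' ''qt'' 0 = Suc ?qt" "step scan_com s' ''p'' 0 = Suc ?p"
          "step scan_com s' ''queue'' = (s' ''queue'')(?qt := y)" "step scan_com s' ''vis'' = (s' ''vis'')(y := s' ''vis'' ?x + 1)"
          "step scan_com s' ''pred'' = (s' ''pred'')(y := ?j)"
          and tr: "trav ?f ?cap ?fr ?j ?x y" and y: "s' ''vis'' y = 0" for y
      proof -
        have "?J (step scan_com s')" unfolding s by (rule bfs_visit[OF J q True tr y])
        moreover have "processed ?qh (Suc ?qt) (Suc ?p) ((s' ''queue'')(?qt := y)) = Suc (processed ?qh ?qt ?p (s' ''queue''))"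
          by (rule pS) (use q in auto)
        ultimately show ?thesis using pb by (simp add: \<Phi>_def s)
      qed
      define F where "F \<longleftrightarrow> tl ?j = ?x \<and> ?f ?j < ?cap ?j \<and> ?fr ?j = 0 \<and> s' ''vis'' (hd ?j) = 0"
      define G where "G \<longleftrightarrow> hd ?j = ?x \<and> 0 < ?f ?j \<and> ?fr ?j = 0 \<and> s' ''vis'' (tl ?j) = 0"
      consider (fwd) F | (bwd) "\<not> F" G | (none) "\<not> F" "\<not> G" by blast
      then show ?thesis
      proof cases
        case fwd
        show ?thesis
          by (rule visit[of "hd ?j"])
            (use fwd True fr st jl in \<open>simp_all add: F_def scan_com_def visit_com_def trav_def\<close>)
      next
        case bwd
        then show ?thesis
          by (intro visit[of "tl ?j"])
            (use bwd True fr st jl in \<open>auto simp: F_def G_def scan_com_def visit_com_def trav_def\<close>)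
      next
        case none
        let ?s = "step scan_com s'"
        have s: "?s ''qh'' 0 = ?qh" "?s ''qt'' = s' ''qt''" "?s ''p'' 0 = Suc ?p"
          "?s ''queue'' = s' ''queue''" "?s ''vis'' = s' ''vis''" "?s ''pred'' = s' ''pred''"
          using none True fr st by (auto simp: F_def G_def scan_com_def)
        have "?J ?s" unfolding s by (rule bfs_skip[OF J q True]) (use none in \<open>auto simp: F_def G_def trav_def\<close>)
        moreover have "processed ?qh ?qt (Suc ?p) (s' ''queue'') = Suc (processed ?qh ?qt ?p (s' ''queue''))"
          by (rule pS) (use q in auto)
        ultimately show ?thesis using pb by (simp add: \<Phi>_def s)
      qed
    qed
  qed
  show ?thesis
    unfolding search_com_def
  proof (rule wp_Seq, rule wp_For_const[where n = n2 and b = 4 and I = "\<lambda>k s'. \<forall>y<k. s' ''vis'' y = 0"])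
    fix t1 s1 assume v: "\<forall>y<n2. s1 ''vis'' y = 0"
      and fr: "\<And>y. y \<notin> insert ''x'' (writes (Write ''vis'' (V ''x'') (Num 0))) \<Longrightarrow> s1 y = s y"
      and t1: "t1 \<le> Suc n2 * (4 + acost (V ''n'') + 10)"
    let ?s2 = "step ?init s1"
    have fs1: "s1 ''edge_count'' 0 = m" "s1 ''start'' = ?start" using fr arr' by simp_all
    have s2: "?s2 ''qh'' 0 = 0" "?s2 ''qt'' 0 = 1" "?s2 ''p'' 0 = ?start m" "?s2 ''queue'' 0 = m"
      "\<And>y. y < n2 \<Longrightarrow> ?s2 ''vis'' y = (if y = m then 1 else 0)"
      using fs1 v by simp_all
    have fs2: "?s2 y = s y" if "y \<in> {''tail'', ''head'', ''flow'', ''cap'', ''frozen'', ''adj'', ''start''}" for y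
    proof -
      have "?s2 y = s1 y" using that by auto
      also have "s1 y = s y" by (rule fr) (use that in auto)
      finally show ?thesis .
    qed
    show "wp (?init;; While (Less (V ''qh'') (V ''qt'')) scan_com)
        (\<lambda>t' s'. reach ?f ?cap ?fr (s' ''vis'') (s' ''pred'') \<and> t1 + t' \<le> 1000 * (n2 + 1)) s1"
    proof (rule wp_straight_Seq, simp, rule wp_While[where J = ?J and \<Phi> = \<Phi>])
      show "?J ?s2"
        unfolding s2 using mn csr s2(4,5) by (intro bfs_init) (simp_all add: csr_def del: step.simps)
      fix s' assume J: "?J s'" and b: "bval (Less (V ''qh'') (V ''qt'')) s'"
        and fr': "\<And>y. y \<notin> writes scan_com \<Longrightarrow> s' y = ?s2 y"
      have fs': "s' y = s y" if "y \<in> {''tail'', ''head'', ''flow'', ''cap'', ''frozen'', ''adj'', ''start''}" for y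
      proof -
        have "s' y = ?s2 y" by (rule fr') (use that in auto)
        then show ?thesis using fs2[OF that] by (rule trans)
      qed
      have "?J (step scan_com s') \<and> ?K + \<Phi> (step scan_com s') \<le> \<Phi> s'"
        by (rule scan[OF J]) (use b arr' in \<open>simp_all add: fs'\<close>)
      then show "wp scan_com (\<lambda>t s''. ?J s'' \<and> t + 1 + bcost (Less (V ''qh'') (V ''qt'')) + \<Phi> s'' \<le> \<Phi> s') s'"
        using tm by (intro wp_straight) (auto simp: scan_com_def visit_com_def simp del: step.simps tmax.simps bcost.simps)
    next
      fix t0 t s' assume t0: "t0 \<le> tmax ?init" and J: "?J s'" and b: "\<not> bval (Less (V ''qh'') (V ''qt'')) s'"
        and t: "t \<le> \<Phi> ?s2 + 1 + bcost (Less (V ''qh'') (V ''qt''))"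
      have "reach ?f ?cap ?fr (s' ''vis'') (s' ''pred'')" by (rule bfs_reach[OF J]) (use b in simp)
      moreover have "t1 + (t0 + t) \<le> 1000 * (n2 + 1)"
      proof -
        have "t0 \<le> 20" using t0 by simp
        moreover have "t \<le> 900 * n2 + 6" using t \<Phi>_le[of ?s2] by simp
        ultimately show ?thesis using t1 by simp
      qed
      ultimately show "reach ?f ?cap ?fr (s' ''vis'') (s' ''pred'') \<and> t1 + (t0 + t) \<le> 1000 * (n2 + 1)" by simp
    qed
  next
    fix s' assume "\<And>y. y \<notin> insert ''x'' (writes (Write ''vis'' (V ''x'') (Num 0))) \<Longrightarrow> s' y = s y"
    then show "aval (V ''n'') s' = n2" using arr' by simp
  next
    fix k :: nat and s' :: state assume "\<forall>y<k. s' ''vis'' y = 0" "s' ''x'' 0 = k"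
    then show "wp (Write ''vis'' (V ''x'') (Num 0)) (\<lambda>t' s''. t' \<le> 4 \<and> (\<forall>y<Suc k. (s''(''x'' := (s'' ''x'')(0 := Suc k))) ''vis'' y = 0)) s'"
      by (intro wp_straight) (auto simp: less_Suc_eq)
  qed simp_all
qed

section \<open>Augmentation along the search tree\<close>

text \<open>
  The augmenting path is followed backwards from the sink; \<open>y\<close> is the current node and \<open>f\<close> the
  flow after the changes made so far.  The levels \<open>vis\<close> decrease along the path, so it uses no link twice.
\<close>

definition walk where
  "walk f0 cap fr vis pred y f \<longleftrightarrow> y < n2 \<and> vis y \<noteq> 0 \<and> balanced f y \<and>
     (\<Sum>i<m. int (f i)) - appl_side y = (\<Sum>i<m. int (f0 i)) \<and> (\<forall>j\<in>links. f j \<le> cap j) \<and>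
     (\<forall>j. fr j \<noteq> 0 \<or> j \<notin> links \<longrightarrow> f j = f0 j) \<and>
     (\<forall>z<n2. vis z \<noteq> 0 \<and> z \<noteq> m \<and> vis z \<le> vis y \<longrightarrow> f (pred z) = f0 (pred z))"

lemma walk_step:
  assumes w: "walk f0 cap fr vis pred y f" and t: "tree_ok f0 cap fr vis pred" and ym: "y \<noteq> m"
    and j: "j = pred y"
    and new: "if hd j = y then y' = tl j \<and> v = f j + 1 else y' = hd j \<and> v = f j - 1"
  shows "walk f0 cap fr vis pred y' (f(j := v)) \<and> vis y = Suc (vis y')"
proof -
  have y: "y < n2" "vis y \<noteq> 0" and bal: "balanced f y"
    and sum: "(\<Sum>i<m. int (f i)) - appl_side y = (\<Sum>i<m. int (f0 i))" and le: "\<forall>j\<in>links. f j \<le> cap j"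
    and same: "\<And>j. fr j \<noteq> 0 \<or> j \<notin> links \<Longrightarrow> f j = f0 j"
    and low: "\<And>z. z < n2 \<Longrightarrow> vis z \<noteq> 0 \<Longrightarrow> z \<noteq> m \<Longrightarrow> vis z \<le> vis y \<Longrightarrow> f (pred z) = f0 (pred z)"
    using w unfolding walk_def by blast+
  obtain x where tr: "trav f0 cap fr j x y" and x: "vis x \<noteq> 0" "vis y = vis x + 1"
    using t y ym j unfolding tree_ok_def by blast
  \<comment> \<open>The residual capacity found by the search is still there, because only links
    chosen at higher levels have been changed.\<close>
  have f0: "f j = f0 j" using low[of y] y ym j by simp
  have jl: "j \<in> links" "x < n2" using trav_ends[OF tr] by auto
  have cases: "hd j = y \<and> tl j = x \<and> f j < cap j \<or> hd j \<noteq> y \<and> hd j = x \<and> tl j = y \<and> 0 < f j"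
    using tr f0 link_ends(3)[OF jl(1)] by (auto simp: trav_def)
  then have y': "y' = x" using new by auto
  have st: "y = hd j \<and> y' = tl j \<and> v = f j + 1 \<or> y = tl j \<and> y' = hd j \<and> f j > 0 \<and> v = f j - 1"
    using cases new by auto
  note bs = balanced_step[OF bal jl(1) st]
  have "v \<le> cap j" using cases new le jl(1) by auto
  then have "\<forall>i\<in>links. (f(j := v)) i \<le> cap i" using le by simp
  moreover have "(f(j := v)) i = f0 i" if "fr i \<noteq> 0 \<or> i \<notin> links" for i
    using that same tr by (auto simp: trav_def)
  moreover have "(f(j := v)) (pred z) = f0 (pred z)" if z: "z < n2" "vis z \<noteq> 0" "z \<noteq> m" "vis z \<le> vis x" for z
  proof -
    obtain w where wz: "trav f0 cap fr (pred z) w z" "vis z = vis w + 1"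
      using t z unfolding tree_ok_def by blast
    \<comment> \<open>Otherwise \<open>z\<close> would be an end of link \<open>j\<close>: either
      \<open>y\<close>, whose level is too high, or \<open>x\<close> with predecessor
      \<open>y\<close>, whose level exceeds that of \<open>x\<close>.\<close>
    have "pred z \<noteq> j"
    proof
      assume "pred z = j"
      then have "x = w \<and> y = z \<or> x = z \<and> y = w" using trav_same_link[OF tr, of f0 cap fr w z] wz(1) by simp
      then show False using x wz(2) z(4) by auto
    qed
    then show ?thesis using low[of z] z x(2) by simp
  qed
  ultimately show ?thesis
    using bs sum y' x jl unfolding walk_def by simp
qed

lemma wp_augment:
  assumes arr: "arr s" and r: "reach (s ''flow'') (s ''cap'') fr (s ''vis'') (s ''pred'')"
    and bal: "balanced (s ''flow'') m" and le: "\<forall>j\<in>links. s ''flow'' j \<le> s ''cap'' j"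
    and snk: "s ''vis'' (m + 1) \<noteq> 0"
  shows "wp augment_com (\<lambda>t s'. t \<le> 100 * (n2 + 1) \<and> balanced (s' ''flow'') m \<and>
     (\<forall>j\<in>links. s' ''flow'' j \<le> s ''cap'' j) \<and> (\<forall>j. fr j \<noteq> 0 \<or> j \<notin> links \<longrightarrow> s' ''flow'' j = s ''flow'' j) \<and>
     (\<Sum>i<m. s' ''flow'' i) = Suc (\<Sum>i<m. s ''flow'' i)) s"
proof -
  let ?f = "s ''flow''" and ?cap = "s ''cap''" and ?vis = "s ''vis''" and ?pred = "s ''pred''"
  note arr' = arr[unfolded arr_def]
  have t: "tree_ok ?f ?cap fr ?vis ?pred" using r by (simp add: reach_def)
  have mn: "m + 1 < n2" using n1 n2 by simp
  let ?b = "Neg (Equal (V ''y'') (V ''edge_count''))"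
  let ?body = "''j'' ::= Read ''pred'' (V ''y'');;
         Cond (Equal (Read ''head'' (V ''j'')) (V ''y''))
           (Write ''flow'' (V ''j'') (Add (Read ''flow'' (V ''j'')) (Num 1));; ''y'' ::= Read ''tail'' (V ''j''))
           (Write ''flow'' (V ''j'') (Sub (Read ''flow'' (V ''j'')) (Num 1));; ''y'' ::= Read ''head'' (V ''j''))"
  let ?J = "\<lambda>s'. walk ?f ?cap fr ?vis ?pred (s' ''y'' 0) (s' ''flow'')"
  let ?\<Phi> = "\<lambda>s'. 60 * ?vis (s' ''y'' 0)"
  let ?s1 = "step (''y'' ::= Add (V ''edge_count'') (Num 1)) s"
  have s1: "?s1 ''y'' 0 = m + 1" "?s1 ''flow'' = ?f" using arr' by simp_all
  show ?thesis
    unfolding augment_com_def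
  proof (rule wp_straight_Seq, simp, rule wp_While[where J = ?J and \<Phi> = ?\<Phi>])
    \<comment> \<open>Source and sink lie outside every subtree, so the cuts do not distinguish
      them. Only \<open>appl_side\<close> does, and it makes the number of used edges grow by one on
      the way back.\<close>
    have "balanced ?f (m + 1)" using bal g_ends unfolding balanced_def by simp
    moreover have "appl_side (m + 1) = 0" by (simp add: appl_side_def)
    ultimately show "?J ?s1" unfolding s1 walk_def using mn snk le by auto
  next
    fix s' assume J: "?J s'" and b: "bval ?b s'" and fr: "\<And>x. x \<notin> writes ?body \<Longrightarrow> s' x = ?s1 x"
    have fs: "s' ''edge_count'' 0 = m" "s' ''pred'' = ?pred" "s' ''head'' = hd" "s' ''tail'' = tl"
      using fr arr' by simp_all
    let ?y = "s' ''y'' 0"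
    let ?j = "?pred ?y"
    let ?y' = "if hd ?j = ?y then tl ?j else hd ?j"
    let ?v = "if hd ?j = ?y then s' ''flow'' ?j + 1 else s' ''flow'' ?j - 1"
    have ym: "?y \<noteq> m" using b fs by simp
    have st: "step ?body s' ''y'' 0 = ?y'" "step ?body s' ''flow'' = (s' ''flow'')(?j := ?v)"
      using fs by simp_all
    have "walk ?f ?cap fr ?vis ?pred ?y' ((s' ''flow'')(?j := ?v)) \<and> ?vis ?y = Suc (?vis ?y')"
      by (rule walk_step[OF J t ym refl]) simp
    then have "?J (step ?body s') \<and> 60 + ?\<Phi> (step ?body s') = ?\<Phi> s'"
      unfolding st by simp
    moreover have "tmax ?body + 1 + bcost ?b \<le> 60" by simp
    ultimately show "wp ?body (\<lambda>t s''. ?J s'' \<and> t + 1 + bcost ?b + ?\<Phi> s'' \<le> ?\<Phi> s') s'"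
      by (intro wp_straight) (simp, linarith)
  next
    fix t0 t1 s' assume t0: "t0 \<le> tmax (''y'' ::= Add (V ''edge_count'') (Num 1))" and J: "?J s'"
      and b: "\<not> bval ?b s'" and fr: "\<And>x. x \<notin> writes ?body \<Longrightarrow> s' x = ?s1 x"
      and t1: "t1 \<le> ?\<Phi> ?s1 + 1 + bcost ?b"
    have "s' ''edge_count'' 0 = m" using fr arr' by simp
    then have y: "s' ''y'' 0 = m" using b by simp
    have "?vis (m + 1) \<le> n2" using r mn by (simp add: reach_def)
    then have "?\<Phi> ?s1 \<le> 60 * n2" unfolding s1 by simp
    then have "t0 + t1 \<le> 100 * (n2 + 1)" using t0 t1 by simp
    moreover have "appl_side m = 1" by (simp add: appl_side_def)
    then have "(\<Sum>i<m. int (s' ''flow'' i)) = 1 + (\<Sum>i<m. int (?f i))"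
      using J unfolding walk_def y by simp
    then have "int (\<Sum>i<m. s' ''flow'' i) = int (Suc (\<Sum>i<m. ?f i))" by simp
    then have "(\<Sum>i<m. s' ''flow'' i) = Suc (\<Sum>i<m. ?f i)" by (simp only: of_nat_eq_iff)
    ultimately show "t0 + t1 \<le> 100 * (n2 + 1) \<and> balanced (s' ''flow'') m \<and>
     (\<forall>j\<in>links. s' ''flow'' j \<le> ?cap j) \<and> (\<forall>j. fr j \<noteq> 0 \<or> j \<notin> links \<longrightarrow> s' ''flow'' j = ?f j) \<and>
     (\<Sum>i<m. s' ''flow'' i) = Suc (\<Sum>i<m. ?f i)"
      using J unfolding walk_def y by blast
  qed
qed

end

section \<open>The stages of the algorithm\<close>

text \<open>Flags are only ever set, never cleared. The same pass opens the edges of the next rank;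
  one that has been frozen stays empty in spite of its new capacity.\<close>

definition freeze_com :: com where
  "freeze_com =
     For ''j'' (V ''n'')
       (Cond (And (Less (V ''j'') (V ''edge_count'')) (Less (V ''k'') (Read ''edge_rank'' (V ''j''))))
         (Cond (And (Neg (Equal (Read ''vis'' (Read ''tail'' (V ''j''))) (Num 0))) (Equal (Read ''vis'' (Read ''head'' (V ''j''))) (Num 0)))
            Skip (Write ''frozen'' (V ''j'') (Num 1));;
          Cond (Equal (Read ''edge_rank'' (V ''j'')) (Add (V ''k'') (Num 1))) (Write ''cap'' (V ''j'') (Num 1)) Skip)
         (Cond (Equal (Read ''vis'' (Read ''tail'' (V ''j''))) (Num 0))
           (Cond (Equal (Read ''vis'' (Read ''head'' (V ''j''))) (Num 0)) Skip (Write ''frozen'' (V ''j'') (Num 1)))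
           (Cond (Equal (Read ''vis'' (Read ''head'' (V ''j''))) (Num 0)) (Write ''frozen'' (V ''j'') (Num 1)) Skip)))"

definition init_com :: com where
  "init_com = For ''j'' (V ''edge_count'')
     (Cond (Equal (Read ''edge_rank'' (V ''j'')) (Num 1)) (Write ''cap'' (V ''j'') (Num 1)) Skip)"

text \<open>Every search leads to an augmentation or to the end of a stage, so a single loop
  suffices and both events draw on one potential.\<close>

definition stages_com :: com where
  "stages_com =
     (''k'' ::= Num 1;;
      While (Less (V ''k'') (Add (V ''edge_count'') (Num 1)))
        (search_com;;
         Cond (Equal (Read ''vis'' (Add (V ''edge_count'') (Num 1))) (Num 0))
           (freeze_com;; ''k'' ::= Add (V ''k'') (Num 1)) augment_com))"

definition output_com :: com where
  "output_com = For ''j'' (V ''edge_count'')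
     (Cond (Equal (Read ''flow'' (V ''j'')) (Num 1))
       (Write ''out_applicant'' (V ''out_count'') (Read ''edge_applicant'' (V ''j''));;
        Write ''out_post'' (V ''out_count'') (Read ''edge_post'' (V ''j''));;
        ''out_count'' ::= Add (V ''out_count'') (Num 1)) Skip)"

definition main_com :: com where
  "main_com =
     (''n'' ::= Add (V ''edge_count'') (Num 2);;
      side_com ''edge_applicant'' ''edge_post'' ''tail'' ''head'' (V ''edge_count'');;
      side_com ''edge_post'' ''edge_applicant'' ''head'' ''tail'' (Add (V ''edge_count'') (Num 1));;
      adj_com;; init_com;; stages_com;; output_com)"

lemma writes_freeze [simp]: "writes freeze_com = {''j'', ''frozen'', ''cap''}"
  by (auto simp: freeze_com_def)
lemma writes_init [simp]: "writes init_com = {''j'', ''cap''}"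
  by (auto simp: init_com_def)
lemma writes_stages [simp]: "writes stages_com =
    {''k'', ''x'', ''j'', ''p'', ''qh'', ''y'', ''vis'', ''pred'', ''queue'', ''qt'', ''frozen'', ''cap'', ''flow''}"
  by (auto simp: stages_com_def)

context net
begin

lemma wp_freeze:
  assumes s: "s ''tail'' = tl" "s ''head'' = hd" "s ''n'' 0 = n2" "s ''edge_count'' 0 = m" "s ''edge_rank'' = rank"
    "s ''k'' 0 = k"
  shows "wp freeze_com (\<lambda>t s'. t \<le> 200 * (n2 + 1) \<and>
     (\<forall>j<n2. s' ''frozen'' j = (if freeze k (s ''vis'') j then 1 else s ''frozen'' j) \<and>
        s' ''cap'' j = (if j < m \<and> rank j = Suc k then 1 else s ''cap'' j))) s"
  unfolding freeze_com_def
proof (rule wp_For_const[where n = n2 and b = 150 and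
    I = "\<lambda>i s'. \<forall>j. s' ''frozen'' j = (if j < i \<and> freeze k (s ''vis'') j then 1 else s ''frozen'' j) \<and>
        s' ''cap'' j = (if j < i \<and> j < m \<and> rank j = Suc k then 1 else s ''cap'' j)"], goal_cases)
  case (2 s') then show ?case using s by simp
next
  case (4 i s')
  have fs: "s' ''tail'' = tl" "s' ''head'' = hd" "s' ''edge_count'' 0 = m" "s' ''edge_rank'' = rank" "s' ''k'' 0 = k"
    "s' ''vis'' = s ''vis''" using 4(4) s by simp_all
  show ?case
    by (rule wp_straight)
      (use 4(2,3) fs in \<open>auto simp: freeze_def less_Suc_eq\<close>)
next
  case (5 t s')
  then show ?case by simp
qed simp_all

lemma stage_sum_le:
  assumes "stage k f cap fr"
  shows "(\<Sum>i<m. f i) \<le> m"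
proof -
  have "f i \<le> 1" if "i < m" for i
  proof -
    have le: "\<forall>j\<in>links. f j \<le> cap j" and cap: "\<forall>j<m. cap j = (if rank j \<le> k then 1 else 0)"
      using assms unfolding stage_def by blast+
    have "f i \<le> cap i" using le that by (simp add: links_def)
    also have "cap i \<le> 1" using cap that by simp
    finally show ?thesis .
  qed
  then have "(\<Sum>i<m. f i) \<le> (\<Sum>i<m. 1)" by (intro sum_mono) auto
  then show ?thesis by simp
qed

lemma wp_stages:
  assumes arr: "arr s" and rk: "s ''edge_rank'' = rank" and id: "idle (s ''flow'') (s ''cap'')"
    and st: "stage 1 (s ''flow'') (s ''cap'') (s ''frozen'')"
  shows "wp stages_com (\<lambda>t s'. t \<le> 3000 * (n2 + 1) * (m + 1) \<and>
    (\<exists>cap fr. stage (Suc m) (s' ''flow'') cap fr)) s"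
proof -
  let ?b = "Less (V ''k'') (Add (V ''edge_count'') (Num 1))"
  let ?c = "Equal (Read ''vis'' (Add (V ''edge_count'') (Num 1))) (Num 0)"
  let ?body = "search_com;; Cond ?c (freeze_com;; ''k'' ::= Add (V ''k'') (Num 1)) augment_com"
  let ?K = "1300 * (n2 + 1)"
  let ?J = "\<lambda>s'. arr s' \<and> s' ''edge_rank'' = rank \<and> idle (s' ''flow'') (s' ''cap'') \<and>
     stage (s' ''k'' 0) (s' ''flow'') (s' ''cap'') (s' ''frozen'') \<and> 1 \<le> s' ''k'' 0 \<and> s' ''k'' 0 \<le> Suc m"
  \<comment> \<open>Each round advances the stage or the number of used edges, and each of these at
    most \<open>m\<close> times. \<open>?K\<close> covers a search at
    \<open>1000 * (n2 + 1)\<close>, a freezing pass at \<open>200 * (n2 + 1)\<close> or an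
    augmentation at \<open>100 * (n2 + 1)\<close>, and the tests.\<close>
  let ?\<Phi> = "\<lambda>s'. ?K * ((Suc m - s' ''k'' 0) + (m - (\<Sum>i<m. s' ''flow'' i)))"
  have mn: "m + 1 < n2" using n1 n2 by simp
  have tot: "?K * (q + r) \<le> 3000 * (n2 + 1) * (m + 1) - 20" if "q \<le> m" "r \<le> m" for q r
  proof -
    have "?K * (q + r) \<le> ?K * (m + m)" by (rule mult_le_mono2) (use that in simp)
    also have "\<dots> = 2600 * (n2 + 1) * m" by (simp add: algebra_simps)
    also have "\<dots> \<le> 3000 * (n2 + 1) * (m + 1) - 20" by (simp add: algebra_simps)
    finally show ?thesis .
  qed
  show ?thesis
    unfolding stages_com_def
  proof (rule wp_straight_Seq, simp, rule wp_While[where J = ?J and \<Phi> = ?\<Phi>], goal_cases)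
    case (1 t)
    then show ?case using arr rk id st by (simp add: arr_def)
  next
    case (2 t0 s')
    note J = 2(2) and b = 2(3)
    let ?k = "s' ''k'' 0"
    have arr1: "arr s'" and rk1: "s' ''edge_rank'' = rank" and id1: "idle (s' ''flow'') (s' ''cap'')"
      and st1: "stage ?k (s' ''flow'') (s' ''cap'') (s' ''frozen'')" and k1: "1 \<le> ?k" using J by auto
    have ec: "s' ''edge_count'' 0 = m" using arr1 by (simp add: arr_def)
    have km: "?k < Suc m" using b ec by simp
    show ?case
    proof (rule wp_Seq, rule wp_frame[OF wp_search[OF arr1 id1]], goal_cases)
      case (1 t1 s1)
      note r = 1(1)[THEN conjunct1] and t1 = 1(1)[THEN conjunct2] and fr = 1(2)
      have f1: "s1 y = s' y" if "y \<in> {''tail'', ''head'', ''n'', ''edge_count'', ''start'', ''adj'', ''edge_rank'', ''flow'', ''cap'', ''frozen'', ''k''}" for y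
        by (rule fr) (use that in auto)
      have arr2: "arr s1" using arr1 unfolding arr_def by (simp add: f1)
      show ?case
      proof (rule wp_Cond)
        assume "bval ?c s1"
        then have snk: "s1 ''vis'' (m + 1) = 0" using ec f1 by simp
        show "wp (freeze_com;; ''k'' ::= Add (V ''k'') (Num 1))
          (\<lambda>t s''. ?J s'' \<and> t1 + (1 + bcost ?c + t) + 1 + bcost ?b + ?\<Phi> s'' \<le> ?\<Phi> s') s1"
        proof (rule wp_Seq, rule wp_frame[OF wp_freeze[where k = ?k]], goal_cases)
          case (7 t2 s2)
          let ?s3 = "step (''k'' ::= Add (V ''k'') (Num 1)) s2"
          have f2: "s2 y = s' y" if "y \<in> {''tail'', ''head'', ''n'', ''edge_count'', ''start'', ''adj'', ''edge_rank'', ''flow'', ''k''}" for y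
          proof -
            have "s2 y = s1 y" by (rule 7(2)) (use that in auto)
            also have "\<dots> = s' y" by (rule f1) (use that in auto)
            finally show ?thesis .
          qed
          have fc: "s2 ''frozen'' j = (if freeze ?k (s1 ''vis'') j then 1 else s' ''frozen'' j)"
            "s2 ''cap'' j = (if j < m \<and> rank j = Suc ?k then 1 else s' ''cap'' j)" if "j < n2" for j
            using 7(1) that f1 by simp_all
          have arr3: "arr ?s3" using arr1 unfolding arr_def by (simp add: f2)
          have id3: "idle (s2 ''flow'') (s2 ''cap'')"
            using id1 fc(2) f2 unfolding idle_def by (auto simp: links_def)
          have st3: "stage (Suc ?k) (s' ''flow'') (s2 ''cap'') (s2 ''frozen'')"
          proof (rule stage_freeze[OF st1 k1])
            fix j x y assume "trav (s' ''flow'') (s' ''cap'') (s' ''frozen'') j x y" "s1 ''vis'' x \<noteq> 0"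
            then show "s1 ''vis'' y \<noteq> 0" using r unfolding reach_def by blast
          next
            show "s1 ''vis'' m \<noteq> 0" using r by (simp add: reach_def tree_ok_def)
            show "s1 ''vis'' (m + 1) = 0" by fact
            fix j assume "j \<in> links"
            then have jn: "j < n2" using link_ends(4) by simp
            show "s2 ''cap'' j = (if j < m \<and> rank j = Suc ?k then 1 else s' ''cap'' j)" by (rule fc(2)[OF jn])
            show "(s2 ''frozen'' j = 0) = (s' ''frozen'' j = 0 \<and> \<not> freeze ?k (s1 ''vis'') j)"
              using fc(1)[OF jn] by simp
          qed
          have "Suc m - ?k = Suc (Suc m - Suc ?k)" using km by simp
          then have "?\<Phi> s' = ?K + ?K * ((Suc m - Suc ?k) + (m - (\<Sum>i<m. s' ''flow'' i)))"
            by (simp add: algebra_simps)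
          moreover have "t2 \<le> 200 * (n2 + 1)" using 7(1) by simp
          ultimately show ?case
            using t1 arr3 id3 st3 km f2 rk1 by (intro wp_straight) simp_all
        qed (use arr2 rk1 f1 in \<open>simp_all add: arr_def\<close>)
      next
        assume "\<not> bval ?c s1"
        then have snk: "s1 ''vis'' (m + 1) \<noteq> 0" using ec f1 by simp
        show "wp augment_com
          (\<lambda>t s''. ?J s'' \<and> t1 + (1 + bcost ?c + t) + 1 + bcost ?b + ?\<Phi> s'' \<le> ?\<Phi> s') s1"
        proof (rule wp_frame[OF wp_augment[OF arr2, where fr = "s' ''frozen''"]], goal_cases)
          case (5 t2 s2)
          have f2: "s2 y = s' y" if "y \<in> {''tail'', ''head'', ''n'', ''edge_count'', ''start'', ''adj'', ''edge_rank'', ''cap'', ''frozen'', ''k''}" for y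
          proof -
            have "s2 y = s1 y" by (rule 5(2)) (use that in auto)
            also have "\<dots> = s' y" by (rule f1) (use that in auto)
            finally show ?thesis .
          qed
          have arr3: "arr s2" using arr1 unfolding arr_def by (simp add: f2)
          have st3: "stage ?k (s2 ''flow'') (s' ''cap'') (s' ''frozen'')"
            by (rule stage_augment[OF st1]) (use 5(1) f1 in auto)
          have id3: "idle (s2 ''flow'') (s' ''cap'')"
            using id1 5(1) f1 unfolding idle_def by auto
          have "(\<Sum>i<m. s2 ''flow'' i) = Suc (\<Sum>i<m. s' ''flow'' i)" using 5(1) f1 by simp
          then have "m - (\<Sum>i<m. s' ''flow'' i) = Suc (m - (\<Sum>i<m. s2 ''flow'' i))"
            using stage_sum_le[OF st3] by simp
          then have "?\<Phi> s' = ?K + ?K * ((Suc m - ?k) + (m - (\<Sum>i<m. s2 ''flow'' i)))"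
            by (simp add: algebra_simps)
          moreover have "t2 \<le> 100 * (n2 + 1)" using 5(1) by simp
          ultimately show ?case using t1 arr3 st3 id3 f2 J by simp
        qed (use st1 r snk f1 in \<open>auto simp: stage_def\<close>)
      qed
    qed
  next
    case (3 t0 t s')
    have "s' ''k'' 0 = Suc m" using 3(2,3) by (auto simp: arr_def)
    then have "stage (Suc m) (s' ''flow'') (s' ''cap'') (s' ''frozen'')" using 3(2) by simp
    moreover have "t0 + t \<le> 3000 * (n2 + 1) * (m + 1)"
    proof -
      have "t0 \<le> 3" using 3(1) by simp
      moreover have "t \<le> ?K * ((Suc m - 1) + (m - (\<Sum>i<m. s ''flow'' i))) + 8" using 3(5) by simp
      moreover have "?K * ((Suc m - 1) + (m - (\<Sum>i<m. s ''flow'' i))) \<le> 3000 * (n2 + 1) * (m + 1) - 20"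
        by (rule tot) auto
      moreover have "3000 * (n2 + 1) * (m + 1) \<ge> 20" by simp
      ultimately show ?thesis by linarith
    qed
    ultimately show ?case by blast
  qed
qed

end

lemma wp_init:
  assumes "s ''edge_count'' 0 = m"
  shows "wp init_com (\<lambda>t s'. t \<le> 50 * (m + 1) \<and>
     (\<forall>j. s' ''cap'' j = (if j < m \<and> s ''edge_rank'' j = 1 then 1 else s ''cap'' j))) s"
  unfolding init_com_def
proof (rule wp_For_const[where n = m and b = 20 and
    I = "\<lambda>i s'. \<forall>j. s' ''cap'' j = (if j < i \<and> s ''edge_rank'' j = 1 then 1 else s ''cap'' j)"], goal_cases)
  case (4 i s')
  have "s' ''edge_rank'' = s ''edge_rank''" using 4(4) by simp
  then show ?case using 4(2,3) by (intro wp_straight) (auto simp: less_Suc_eq)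
qed (use assms in simp_all)

lemma wp_output:
  assumes "s ''edge_count'' 0 = m" "s ''out_count'' 0 = 0"
  shows "wp output_com (\<lambda>t s'. t \<le> 100 * (m + 1) \<and>
     output_edges s' = (\<lambda>j. (s ''edge_applicant'' j, s ''edge_post'' j)) ` {j. j < m \<and> s ''flow'' j = 1}) s"
  unfolding output_com_def
proof (rule wp_For_const[where n = m and b = 50 and
    I = "\<lambda>i s'. output_edges s' = (\<lambda>j. (s ''edge_applicant'' j, s ''edge_post'' j)) ` {j. j < i \<and> s ''flow'' j = 1}"], goal_cases)
  case (4 i s')
  have fs: "s' ''flow'' = s ''flow''" "s' ''edge_applicant'' = s ''edge_applicant''" "s' ''edge_post'' = s ''edge_post''"
    using 4(4) by simp_all
  let ?body = "Cond (Equal (Read ''flow'' (V ''j'')) (Num 1))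
       (Write ''out_applicant'' (V ''out_count'') (Read ''edge_applicant'' (V ''j''));;
        Write ''out_post'' (V ''out_count'') (Read ''edge_post'' (V ''j''));;
        ''out_count'' ::= Add (V ''out_count'') (Num 1)) Skip"
  have out: "output_edges (x(''j'' := w)) = output_edges x" for x w by (simp add: output_edges_def)
  have img: "output_edges x = (\<lambda>i. (x ''out_applicant'' i, x ''out_post'' i)) ` {..<x ''out_count'' 0}" for x
    by (auto simp: output_edges_def)
  have upd: "(\<lambda>i. ((A(c := a)) i, (B(c := b)) i)) ` {..<Suc c} = insert (a, b) ((\<lambda>i. (A i, B i)) ` {..<c})"
    for A B :: "nat \<Rightarrow> nat" and a b c
  proof -
    have "(\<lambda>i. ((A(c := a)) i, (B(c := b)) i)) ` {..<c} = (\<lambda>i. (A i, B i)) ` {..<c}" by (intro image_cong) auto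
    then show ?thesis by (simp add: lessThan_Suc)
  qed
  have "output_edges (step ?body s') =
      (if s ''flow'' i = 1 then insert (s ''edge_applicant'' i, s ''edge_post'' i) (output_edges s') else output_edges s')"
  proof (cases "s ''flow'' i = 1")
    case True
    let ?c = "s' ''out_count'' 0"
    have "step ?body s' ''out_applicant'' = (s' ''out_applicant'')(?c := s ''edge_applicant'' i)"
      "step ?body s' ''out_post'' = (s' ''out_post'')(?c := s ''edge_post'' i)"
      "step ?body s' ''out_count'' 0 = Suc ?c"
      using True fs 4(3) by simp_all
    then show ?thesis using True unfolding img by (simp only: upd if_True simp_thms)
  qed (use fs 4(3) in simp)
  moreover have "{j. j < Suc i \<and> s ''flow'' j = 1} = (if s ''flow'' i = 1 then insert i {j. j < i \<and> s ''flow'' j = 1} else {j. j < i \<and> s ''flow'' j = 1})"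
    by (auto simp: less_Suc_eq)
  ultimately have "output_edges (step ?body s') = (\<lambda>j. (s ''edge_applicant'' j, s ''edge_post'' j)) ` {j. j < Suc i \<and> s ''flow'' j = 1}"
    using 4(2) by simp
  then show ?case by (intro wp_straight) (simp_all add: out del: step.simps One_nat_def)
qed (use assms in \<open>simp_all add: output_edges_def\<close>)

section \<open>From instances to networks\<close>

context side
begin

lemma P_empty: "P {} n0 C0 B0 cap0 f0"
  by (simp add: P_def bij_betw_def)

text \<open>Edges can be counted instead of partners because \<open>W\<close> is injective on the
  edges at a vertex. The omitted empty classes hold for every \<open>X\<close>.\<close>

lemma keys_fit_iff:
  assumes X: "X \<subseteq> {..<m}"
  shows "(\<forall>k\<in>keys (U ` {..<m}). card (X \<inter> E k) \<le> Qk k) \<longleftrightarrow>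
    (\<forall>u\<in>U ` {..<m}. card (W ` {j\<in>X. U j = u}) \<le> qu u \<and>
       (\<forall>c\<in>Cls u. card (W ` {j\<in>X. U j = u} \<inter> Mem c) \<le> cq c))"
proof -
  have injW: "inj_on W {j\<in>X. U j = u}" for u
  proof (rule inj_onI)
    fix x y assume "x \<in> {j\<in>X. U j = u}" "y \<in> {j\<in>X. U j = u}" "W x = W y"
    then show "x = y" using inj_onD[OF inj, of x y] X by auto
  qed
  have 1: "card (W ` {j\<in>X. U j = u}) = card (X \<inter> E (u, None))" for u
  proof -
    have "X \<inter> E (u, None) = {j\<in>X. U j = u}" using X by auto
    then show ?thesis using card_image[OF injW] by simp
  qed
  have 2: "card (W ` {j\<in>X. U j = u} \<inter> Mem c) = card (X \<inter> E (u, Some c))" for u c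
  proof -
    have "W ` {j\<in>X. U j = u} \<inter> Mem c = W ` (X \<inter> E (u, Some c))" using X by auto
    moreover have "inj_on W (X \<inter> E (u, Some c))" by (rule inj_on_subset[OF injW[of u]]) auto
    ultimately show ?thesis by (simp only: card_image)
  qed
  have 3: "X \<inter> E (u, Some c) = {}" if "mc c = 0" for u c using that by (simp add: Mem_def)
  show ?thesis
    unfolding 1 2
  proof (intro iffI ballI conjI)
    fix u assume A: "\<forall>k\<in>keys (U ` {..<m}). card (X \<inter> E k) \<le> Qk k" and u: "u \<in> U ` {..<m}"
    have "(u, None) \<in> keys (U ` {..<m})" using u by (simp add: keys_def)
    then show "card (X \<inter> E (u, None)) \<le> qu u" using A Qk.simps(1)[of u] by metis
    fix c assume c: "c \<in> Cls u"
    show "card (X \<inter> E (u, Some c)) \<le> cq c"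
    proof (cases "mc c = 0")
      case True
      then show ?thesis using 3[of c u] by (simp only: card.empty)
    next
      case False
      then have "(u, Some c) \<in> keys (U ` {..<m})" using u c by (auto simp: keys_def)
      then show ?thesis using A Qk.simps(2)[of u c] by metis
    qed
  next
    fix k assume A: "\<forall>u\<in>U ` {..<m}. card (X \<inter> E (u, None)) \<le> qu u \<and> (\<forall>c\<in>Cls u. card (X \<inter> E (u, Some c)) \<le> cq c)"
      and k: "k \<in> keys (U ` {..<m})"
    then consider u where "k = (u, None)" "u \<in> U ` {..<m}" | u c where "k = (u, Some c)" "u \<in> U ` {..<m}" "c \<in> Cls u"
      unfolding keys_def by blast
    then show "card (X \<inter> E k) \<le> Qk k" using A Qk.simps by cases metis+
  qed
qed

end

text \<open>Index 1 marks the arrays after the pass over the applicants, index 2 after that over the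
  posts. The second pass starts from what the first left behind, continues the numbering at
  \<open>n1\<close>, and exchanges the roles of tail and head.\<close>

locale two_sides = A: side m "m + 2" m U W qu cc cs cq mc ms mem tA hA cA fA +
  B: side m n1 "m + 1" W U qu cc cs cq mc ms mem h1 t1 c1 f1
  for m n1 :: nat and U W qu cc cs cq mc ms mem tA hA cA fA t1 h1 c1 f1 +
  fixes n2 :: nat and t2 h2 c2 f2 rank :: "nat \<Rightarrow> nat"
  assumes PA: "A.P (A.keys (U ` {..<m})) n1 t1 h1 c1 f1"
    and PB: "B.P (B.keys (W ` {..<m})) n2 h2 t2 c2 f2"
    and rk: "\<And>j. j < m \<Longrightarrow> 1 \<le> rank j \<and> rank j \<le> m"
begin

definition labs :: "(nat \<Rightarrow> nat \<times> nat option) \<Rightarrow> (nat \<Rightarrow> nat \<times> nat option) \<Rightarrow> bool" where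
  "labs lA lB \<longleftrightarrow> bij_betw lA {m + 2..<n1} (A.keys (U ` {..<m})) \<and> bij_betw lB {n1..<n2} (B.keys (W ` {..<m})) \<and>
     (\<forall>x. m + 2 \<le> x \<and> x < n1 \<longrightarrow> h2 x = x \<and> (t2 x = m \<or> m + 2 \<le> t2 x \<and> t2 x < x) \<and> f2 x = 1 \<and> c2 x = A.Qk (lA x) + 1) \<and>
     (\<forall>x. n1 \<le> x \<and> x < n2 \<longrightarrow> t2 x = x \<and> (h2 x = m + 1 \<or> n1 \<le> h2 x \<and> h2 x < x) \<and> f2 x = 1 \<and> c2 x = B.Qk (lB x) + 1) \<and>
     (\<forall>j<m. m + 2 \<le> t2 j \<and> t2 j < n1 \<and> n1 \<le> h2 j \<and> h2 j < n2 \<and>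
        (\<forall>x. m + 2 \<le> x \<and> x < n1 \<longrightarrow> (x \<in> anc (m + 2) t2 (t2 j) \<longleftrightarrow> j \<in> A.E (lA x))) \<and>
        (\<forall>x. n1 \<le> x \<and> x < n2 \<longrightarrow> (x \<in> anc n1 h2 (h2 j) \<longleftrightarrow> j \<in> B.E (lB x))))"

lemma fst_keys: "u \<in> A \<Longrightarrow> u \<in> fst ` side.keys cc cs mc A"
  unfolding A.keys_def by force

lemma bounds: "m + 2 \<le> n1" "n1 \<le> n2"
  by (rule PA[unfolded A.P_def, THEN conjunct1] PB[unfolded B.P_def, THEN conjunct1])+

lemma labs_exist: "\<exists>lA lB. labs lA lB"
proof -
  obtain lA where A1: "bij_betw lA {m + 2..<n1} (A.keys (U ` {..<m}))"
    and A2: "\<forall>x. m + 2 \<le> x \<and> x < n1 \<longrightarrow> (t1 x = m \<or> m + 2 \<le> t1 x \<and> t1 x < x) \<and> h1 x = x \<and> f1 x = 1 \<and> c1 x = A.Qk (lA x) + 1"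
    and A3: "\<forall>j. j < m \<and> U j \<in> fst ` A.keys (U ` {..<m}) \<longrightarrow> m + 2 \<le> t1 j \<and> t1 j < n1 \<and>
          (\<forall>x. m + 2 \<le> x \<and> x < n1 \<longrightarrow> (x \<in> anc (m + 2) t1 (t1 j) \<longleftrightarrow> j \<in> A.E (lA x)))"
    using PA unfolding A.P_def by (elim conjE exE) (rule that)
  obtain lB where B1: "bij_betw lB {n1..<n2} (B.keys (W ` {..<m}))"
    and B2: "\<forall>x. n1 \<le> x \<and> x < n2 \<longrightarrow> (h2 x = m + 1 \<or> n1 \<le> h2 x \<and> h2 x < x) \<and> t2 x = x \<and> f2 x = 1 \<and> c2 x = B.Qk (lB x) + 1"
    and B3: "\<forall>j. j < m \<and> W j \<in> fst ` B.keys (W ` {..<m}) \<longrightarrow> n1 \<le> h2 j \<and> h2 j < n2 \<and>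
          (\<forall>x. n1 \<le> x \<and> x < n2 \<longrightarrow> (x \<in> anc n1 h2 (h2 j) \<longleftrightarrow> j \<in> B.E (lB x)))"
    and old: "\<forall>y. m \<le> y \<and> y < n1 \<longrightarrow> h2 y = h1 y" "\<forall>y<n1. t2 y = t1 y \<and> c2 y = c1 y \<and> f2 y = f1 y"
    using PB unfolding B.P_def by (elim conjE exE) (rule that)
  have t: "t2 y = t1 y" if "y < n1" for y using old(2) that by simp
  \<comment> \<open>The second pass leaves all tails below \<open>n1\<close> alone, so root paths in
    the applicant forest survive.\<close>
  have "anc (m + 2) t2 (t2 j) = anc (m + 2) t1 (t1 j)" if "j < m" "t1 j < n1" for j
  proof -
    have "t2 j = t1 j" using that bounds by (intro t) simp
    then show ?thesis using that by (auto intro!: anc_cong t)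
  qed
  then have "labs lA lB"
    unfolding labs_def using A1 A2 A3 B1 B2 B3 old fst_keys bounds by auto
  then show ?thesis by blast
qed

sublocale N: net m n1 n2 t2 h2 "\<lambda>x. c2 x - 1" rank
proof -
  obtain lA lB where l: "labs lA lB" using labs_exist by blast
  show "net m n1 n2 t2 h2 rank"
    by unfold_locales (use l bounds rk in \<open>auto simp: labs_def\<close>)
qed

text \<open>Edges, source and sink take \<open>m + 2\<close> numbers, and each of the two forests at
  most \<open>3 * m\<close>.\<close>

lemma n2_le: "n2 \<le> 7 * m + 2"
  using A.P_card[OF PA] B.P_card[OF PB] A.card_keys_le B.card_keys_le by linarith

lemma low:
  assumes "j < m + 2"
  shows "f2 j = fA j \<and> c2 j = cA j"
proof -
  have "\<forall>y<m + 2. h1 y = hA y \<and> c1 y = cA y \<and> f1 y = fA y" using PA unfolding A.P_def by (elim conjE)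
  moreover have "\<forall>y<n1. t2 y = t1 y \<and> c2 y = c1 y \<and> f2 y = f1 y" using PB unfolding B.P_def by (elim conjE)
  ultimately show ?thesis using assms bounds by simp
qed

lemma tree_init: "x \<in> N.tree \<Longrightarrow> f2 x = 1 \<and> 0 < c2 x"
proof -
  assume "x \<in> N.tree"
  obtain lA lB where l: "labs lA lB" using labs_exist by blast
  from \<open>x \<in> N.tree\<close> consider "m + 2 \<le> x" "x < n1" | "n1 \<le> x" "x < n2"
    unfolding N.tree_def by fastforce
  then show ?thesis using l unfolding labs_def by cases auto
qed

lemma fits_iff:
  "N.fits X \<longleftrightarrow> X \<subseteq> {..<m} \<and> (\<forall>k\<in>A.keys (U ` {..<m}). card (X \<inter> A.E k) \<le> A.Qk k) \<and>
     (\<forall>k\<in>B.keys (W ` {..<m}). card (X \<inter> B.E k) \<le> B.Qk k)"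
proof -
  obtain lA lB where l: "labs lA lB" using labs_exist by blast
  have LA: "N.L x = A.E (lA x)" "c2 x - 1 = A.Qk (lA x)" if "m + 2 \<le> x" "x < n1" for x
  proof -
    show "N.L x = A.E (lA x)"
      using l that A.E_less[of _ "lA x"] unfolding N.L_def labs_def by fastforce
    show "c2 x - 1 = A.Qk (lA x)" using l that unfolding labs_def by simp
  qed
  have LB: "N.L x = B.E (lB x)" "c2 x - 1 = B.Qk (lB x)" if "n1 \<le> x" "x < n2" for x
  proof -
    show "N.L x = B.E (lB x)"
      using l that B.E_less[of _ "lB x"] unfolding N.L_def labs_def by fastforce
    show "c2 x - 1 = B.Qk (lB x)" using l that unfolding labs_def by simp
  qed
  have tree: "N.tree = {m + 2..<n1} \<union> {n1..<n2}" using bounds by (auto simp: N.tree_def)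
  have KA: "A.keys (U ` {..<m}) = lA ` {m + 2..<n1}" and KB: "B.keys (W ` {..<m}) = lB ` {n1..<n2}"
    using l by (simp_all add: labs_def bij_betw_def)
  have "(\<forall>x\<in>{m + 2..<n1}. card (X \<inter> N.L x) \<le> c2 x - 1) \<longleftrightarrow> (\<forall>x\<in>{m + 2..<n1}. card (X \<inter> A.E (lA x)) \<le> A.Qk (lA x))"
    by (rule ball_cong) (use LA in auto)
  moreover have "(\<forall>x\<in>{n1..<n2}. card (X \<inter> N.L x) \<le> c2 x - 1) \<longleftrightarrow> (\<forall>x\<in>{n1..<n2}. card (X \<inter> B.E (lB x)) \<le> B.Qk (lB x))"
    by (rule ball_cong) (use LB in auto)
  ultimately show ?thesis unfolding N.fits_def tree KA KB ball_Un by blast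
qed

end

text \<open>Tie groups are nonempty and disjoint, so choosing one element from each is injective. It
  follows that no rank exceeds the number of edges, and that \<open>m\<close> stages reach all
  ranks.\<close>

lemma preference_list_length:
  assumes "preference_list gs X" "finite X"
  shows "length gs \<le> card X"
proof -
  define h where "h i = (SOME x. x \<in> gs ! i)" for i
  have h: "h i \<in> gs ! i" if "i < length gs" for i
  proof -
    have "gs ! i \<noteq> {}" using assms(1) that nth_mem[OF that] unfolding preference_list_def by metis
    then show ?thesis unfolding h_def by (simp add: some_in_eq)
  qed
  have "inj_on h {..<length gs}"
  proof (rule inj_onI)
    fix i j assume ij: "i \<in> {..<length gs}" "j \<in> {..<length gs}" "h i = h j"
    then have "h i \<in> gs ! i \<inter> gs ! j" using h[of i] h[of j] by auto
    then show "i = j" using assms(1) ij unfolding preference_list_def by blast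
  qed
  moreover have "h ` {..<length gs} \<subseteq> X"
    using h assms(1) nth_mem unfolding preference_list_def by fastforce
  ultimately show ?thesis using card_inj_on_le[of h "{..<length gs}" X] assms(2) by simp
qed

lemma has_rank_unique:
  assumes "preference_list (pref I (fst e)) X" "has_rank I e k" "has_rank I e k'"
  shows "k = k'"
proof -
  have "k - 1 < length (pref I (fst e))" "k' - 1 < length (pref I (fst e))" "1 \<le> k" "1 \<le> k'"
    "snd e \<in> pref I (fst e) ! (k - 1) \<inter> pref I (fst e) ! (k' - 1)"
    using assms(2,3) by (auto simp: has_rank_def)
  then have "k - 1 = k' - 1" using assms(1) unfolding preference_list_def by blast
  then show ?thesis using \<open>1 \<le> k\<close> \<open>1 \<le> k'\<close> by simp
qed

section \<open>Reading the encoded instance\<close>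

locale encoded =
  fixes I :: cm_instance and s :: state and es :: "(nat \<times> nat) list"
  assumes valid: "valid_instance I" and enc: "encodes I s"
    and es: "distinct es" "set es = edges I" "s ''edge_count'' 0 = length es"
    and ends: "stores s ''edge_applicant'' 0 (map fst es)" "stores s ''edge_post'' 0 (map snd es)"
    and ranks: "\<And>i. i < length es \<Longrightarrow> has_rank I (es ! i) (s ''edge_rank'' i)"
begin

abbreviation "m \<equiv> length es"
abbreviation "U \<equiv> s ''edge_applicant''"
abbreviation "W \<equiv> s ''edge_post''"
abbreviation "rk \<equiv> s ''edge_rank''"
abbreviation "qu \<equiv> s ''quota''"
abbreviation "cc \<equiv> s ''class_count''"
abbreviation "cs \<equiv> s ''class_start''"
abbreviation "cq \<equiv> s ''class_quota''"
abbreviation "mc \<equiv> s ''member_count''"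
abbreviation "ms \<equiv> s ''member_start''"
abbreviation "mem \<equiv> s ''member''"

definition edg :: "nat set \<Rightarrow> (nat \<times> nat) set" where
  "edg X = (\<lambda>j. (U j, W j)) ` X"

lemma es_nth: "j < m \<Longrightarrow> es ! j = (U j, W j)"
  using ends by (auto simp: stores_def intro: prod_eqI)

lemma edges_eq: "edges I = edg {..<m}"
  unfolding es(2)[symmetric] edg_def using es_nth by (force simp: set_conv_nth)

lemma card_edges: "card (edges I) = m"
  using es distinct_card by fastforce

lemma sides: "edges I \<subseteq> applicants I \<times> posts I" "applicants I \<inter> posts I = {}"
  using valid by (auto simp: valid_instance_def)

lemma edge_ends: "j < m \<Longrightarrow> U j \<in> applicants I \<and> W j \<in> posts I"
  using sides(1) edges_eq by (auto simp: edg_def)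

lemma inj_edge: "inj_on (\<lambda>j. (U j, W j)) {..<m}"
proof (rule inj_onI)
  fix i j assume ij: "i \<in> {..<m}" "j \<in> {..<m}" "(U i, W i) = (U j, W j)"
  then have "es ! i = es ! j" using es_nth by simp
  then show "i = j" using es(1) ij by (simp add: nth_eq_iff_index_eq)
qed

lemma partners_applicant:
  assumes "X \<subseteq> {..<m}" "a \<in> applicants I"
  shows "partners (edg X) a = W ` {j\<in>X. U j = a}"
  using assms edge_ends sides(2) by (auto simp: partners_def edg_def)

lemma partners_post:
  assumes "X \<subseteq> {..<m}" "p \<in> posts I"
  shows "partners (edg X) p = U ` {j\<in>X. W j = p}"
  using assms edge_ends sides(2) by (auto simp: partners_def edg_def)

lemma class_facts:
  assumes "u \<in> vertices I"
  shows "\<exists>Cs. distinct Cs \<and> set Cs = classes I u \<and> cc u = length Cs \<and>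
    (\<forall>j<length Cs. cq (cs u + j) = class_quota I u (Cs ! j) \<and>
       mem ` {ms (cs u + j)..<ms (cs u + j) + mc (cs u + j)} = Cs ! j \<and>
       inj_on mem {ms (cs u + j)..<ms (cs u + j) + mc (cs u + j)})"
proof -
  obtain Cs where Cs: "distinct Cs" "set Cs = classes I u" "cc u = length Cs"
    "\<forall>j<length Cs. let c = cs u + j in cq c = class_quota I u (Cs ! j) \<and>
           (\<exists>xs. distinct xs \<and> set xs = Cs ! j \<and> mc c = length xs \<and> stores s ''member'' (ms c) xs)"
    using enc assms unfolding encodes_def by blast
  have "mem ` {k..<k + length xs} = set xs \<and> inj_on mem {k..<k + length xs}"
    if "stores s ''member'' k xs" "distinct xs" for k xs
  proof -
    have nth: "mem (k + i) = xs ! i" if "i < length xs" for i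
      using \<open>stores s ''member'' k xs\<close> that by (simp add: stores_def)
    have eq: "{k..<k + length xs} = (+) k ` {..<length xs}"
      by (simp add: lessThan_atLeast0 add.commute)
    have "mem ` {k..<k + length xs} = (\<lambda>i. xs ! i) ` {..<length xs}"
      unfolding eq image_image using nth by (intro image_cong) auto
    moreover have "\<dots> = set xs" by (auto simp: set_conv_nth)
    moreover have "inj_on (mem \<circ> (+) k) {..<length xs}"
      using nth \<open>distinct xs\<close> by (auto simp: inj_on_def nth_eq_iff_index_eq)
    then have "inj_on mem {k..<k + length xs}" unfolding eq by (rule inj_on_imageI)
    ultimately show ?thesis by simp
  qed
  then show ?thesis using Cs unfolding Let_def by (intro exI[of _ Cs]) (metis (no_types, lifting))
qed

lemma side_intro:
  assumes "r < n0" "m \<le> n0" and injUW: "inj_on (\<lambda>j. (A j, B j)) {..<m}"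
    and A: "\<And>u. u \<in> A ` {..<m} \<Longrightarrow> u \<in> vertices I \<and> partners (edges I) u = B ` {j. j < m \<and> A j = u}"
  shows "side m n0 r A B cc cs mc ms mem"
proof
  show "r < n0" "m \<le> n0" by fact+
  show "inj_on (\<lambda>j. (A j, B j)) {..<m}" by fact
  fix u assume u: "u \<in> A ` {..<m}"
  then have uV: "u \<in> vertices I" using A by blast
  obtain Cs where Cs: "distinct Cs" "set Cs = classes I u" "cc u = length Cs"
    and cl: "\<And>j. j < length Cs \<Longrightarrow> cq (cs u + j) = class_quota I u (Cs ! j) \<and>
       mem ` {ms (cs u + j)..<ms (cs u + j) + mc (cs u + j)} = Cs ! j \<and>
       inj_on mem {ms (cs u + j)..<ms (cs u + j) + mc (cs u + j)}"
    using class_facts[OF uV] by blast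
  have ex: "\<exists>j<length Cs. c = cs u + j" if "cs u \<le> c" "c < cs u + cc u" for c
    using that Cs(3) by (intro exI[of _ "c - cs u"]) auto
  show "inj_on mem {ms c..<ms c + mc c}" if "cs u \<le> c" "c < cs u + cc u" for c
    using ex[OF that] cl by blast
  show "mem ` {ms c..<ms c + mc c} \<subseteq> B ` {j. j < m \<and> A j = u}" if c: "cs u \<le> c" "c < cs u + cc u" for c
  proof -
    obtain j where "j < length Cs" "c = cs u + j" using ex[OF c] by blast
    then have "mem ` {ms c..<ms c + mc c} \<in> classes I u" using cl Cs(2) by auto
    then show ?thesis using valid uV A[OF u] unfolding valid_instance_def by blast
  qed
  show "inj_on (\<lambda>c. mem ` {ms c..<ms c + mc c}) {cs u..<cs u + cc u}"
  proof (rule inj_onI)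
    fix c d assume cd: "c \<in> {cs u..<cs u + cc u}" "d \<in> {cs u..<cs u + cc u}"
      and eq: "mem ` {ms c..<ms c + mc c} = mem ` {ms d..<ms d + mc d}"
    obtain i where i: "i < length Cs" "c = cs u + i" using ex[of c] cd by auto
    obtain j where j: "j < length Cs" "d = cs u + j" using ex[of d] cd by auto
    have "Cs ! i = Cs ! j" using cl[OF i(1)] cl[OF j(1)] eq i(2) j(2) by metis
    then show "c = d" using Cs(1) i j by (simp add: nth_eq_iff_index_eq)
  qed
  have "(\<lambda>c. mem ` {ms c..<ms c + mc c}) ` {cs u..<cs u + cc u} \<subseteq> classes I u"
  proof
    fix X assume "X \<in> (\<lambda>c. mem ` {ms c..<ms c + mc c}) ` {cs u..<cs u + cc u}"
    then obtain c where c: "cs u \<le> c" "c < cs u + cc u" "X = mem ` {ms c..<ms c + mc c}" by auto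
    then obtain j where "j < length Cs" "c = cs u + j" using ex by blast
    then show "X \<in> classes I u" using cl c(3) Cs(2) by auto
  qed
  moreover have "laminar (classes I u)" using valid uV by (simp add: valid_instance_def)
  ultimately show "laminar ((\<lambda>c. mem ` {ms c..<ms c + mc c}) ` {cs u..<cs u + cc u})"
    unfolding laminar_def by (meson subsetD)
qed

lemma sideA: "m + 2 \<le> n0 \<Longrightarrow> side m n0 m U W cc cs mc ms mem"
proof (rule side_intro)
  fix u assume u: "u \<in> U ` {..<m}"
  then have "u \<in> applicants I" using edge_ends by auto
  then show "u \<in> vertices I \<and> partners (edges I) u = W ` {j. j < m \<and> U j = u}"
    using partners_applicant[of "{..<m}" u] edges_eq by (simp add: vertices_def)
qed (use inj_edge in auto)

lemma sideB: "m + 2 \<le> n0 \<Longrightarrow> side m n0 (m + 1) W U cc cs mc ms mem"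
proof (rule side_intro)
  fix u assume u: "u \<in> W ` {..<m}"
  then have "u \<in> posts I" using edge_ends by auto
  then show "u \<in> vertices I \<and> partners (edges I) u = U ` {j. j < m \<and> W j = u}"
    using partners_post[of "{..<m}" u] edges_eq by (simp add: vertices_def)
qed (use inj_edge in \<open>auto simp: inj_on_def\<close>)

lemma class_quota_iff:
  assumes "u \<in> vertices I"
  shows "(\<forall>C\<in>classes I u. card (Y \<inter> C) \<le> class_quota I u C) \<longleftrightarrow>
    (\<forall>c\<in>{cs u..<cs u + cc u}. card (Y \<inter> mem ` {ms c..<ms c + mc c}) \<le> cq c)"
proof -
  obtain Cs where Cs: "distinct Cs" "set Cs = classes I u" "cc u = length Cs"
    and cl: "\<And>j. j < length Cs \<Longrightarrow> cq (cs u + j) = class_quota I u (Cs ! j) \<and>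
       mem ` {ms (cs u + j)..<ms (cs u + j) + mc (cs u + j)} = Cs ! j"
    using class_facts[OF assms] by blast
  have "(\<forall>C\<in>classes I u. card (Y \<inter> C) \<le> class_quota I u C) \<longleftrightarrow>
      (\<forall>j<length Cs. card (Y \<inter> Cs ! j) \<le> class_quota I u (Cs ! j))"
    unfolding Cs(2)[symmetric] by (simp add: all_set_conv_all_nth)
  also have "\<dots> \<longleftrightarrow> (\<forall>j<length Cs. card (Y \<inter> mem ` {ms (cs u + j)..<ms (cs u + j) + mc (cs u + j)}) \<le> cq (cs u + j))"
    using cl by metis
  also have "\<dots> \<longleftrightarrow> (\<forall>c\<in>{cs u..<cs u + cc u}. card (Y \<inter> mem ` {ms c..<ms c + mc c}) \<le> cq c)"
  proof -
    have "{cs u..<cs u + cc u} = (+) (cs u) ` {..<length Cs}" by (simp add: lessThan_atLeast0 Cs(3) add.commute)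
    then show ?thesis by (simp only: ball_simps lessThan_iff Ball_def[of "{..<_}"])
  qed
  finally show ?thesis .
qed

lemma quota_eq: "u \<in> vertices I \<Longrightarrow> qu u = quota I u"
  using enc by (simp add: encodes_def)

text \<open>A vertex without edges has no partners and meets all its quotas, so it is enough to look
  at the end points of edges, the only vertices that the program sees.\<close>

lemma feasible_iff:
  assumes X: "X \<subseteq> {..<m}"
  shows "feasible I (edg X) \<longleftrightarrow>
    (\<forall>u\<in>U ` {..<m}. card (W ` {j\<in>X. U j = u}) \<le> qu u \<and>
       (\<forall>c\<in>{cs u..<cs u + cc u}. card (W ` {j\<in>X. U j = u} \<inter> mem ` {ms c..<ms c + mc c}) \<le> cq c)) \<and>
    (\<forall>u\<in>W ` {..<m}. card (U ` {j\<in>X. W j = u}) \<le> qu u \<and>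
       (\<forall>c\<in>{cs u..<cs u + cc u}. card (U ` {j\<in>X. W j = u} \<inter> mem ` {ms c..<ms c + mc c}) \<le> cq c))"
proof -
  define ok where "ok u Y \<longleftrightarrow> card Y \<le> qu u \<and>
    (\<forall>c\<in>{cs u..<cs u + cc u}. card (Y \<inter> mem ` {ms c..<ms c + mc c}) \<le> cq c)" for u Y
  have sub: "edg X \<subseteq> edges I" using X edges_eq by (auto simp: edg_def)
  have "feasible I (edg X) \<longleftrightarrow> (\<forall>u\<in>vertices I. ok u (partners (edg X) u))"
    unfolding feasible_def ok_def using sub quota_eq class_quota_iff by simp
  also have "\<dots> \<longleftrightarrow> (\<forall>u\<in>applicants I. ok u (W ` {j\<in>X. U j = u})) \<and> (\<forall>u\<in>posts I. ok u (U ` {j\<in>X. W j = u}))"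
    unfolding vertices_def ball_Un using partners_applicant[OF X] partners_post[OF X] by simp
  also have "(\<forall>u\<in>applicants I. ok u (W ` {j\<in>X. U j = u})) \<longleftrightarrow> (\<forall>u\<in>U ` {..<m}. ok u (W ` {j\<in>X. U j = u}))"
  proof -
    have "ok u (W ` {j\<in>X. U j = u})" if "u \<notin> U ` {..<m}" for u
    proof -
      have "{j\<in>X. U j = u} = {}" using that X by auto
      then show ?thesis by (simp only: image_empty) (simp add: ok_def)
    qed
    then show ?thesis using edge_ends by blast
  qed
  also have "(\<forall>u\<in>posts I. ok u (U ` {j\<in>X. W j = u})) \<longleftrightarrow> (\<forall>u\<in>W ` {..<m}. ok u (U ` {j\<in>X. W j = u}))"
  proof -
    have "ok u (U ` {j\<in>X. W j = u})" if "u \<notin> W ` {..<m}" for u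
    proof -
      have "{j\<in>X. W j = u} = {}" using that X by auto
      then show ?thesis by (simp only: image_empty) (simp add: ok_def)
    qed
    then show ?thesis using edge_ends by blast
  qed
  finally show ?thesis unfolding ok_def .
qed

lemma pref_ok:
  assumes "j < m"
  shows "preference_list (pref I (U j)) (partners (edges I) (U j))" "card (partners (edges I) (U j)) \<le> m"
    "finite (partners (edges I) (U j))"
proof -
  have a: "U j \<in> applicants I" using edge_ends assms by simp
  then show "preference_list (pref I (U j)) (partners (edges I) (U j))"
    using valid by (simp add: valid_instance_def)
  have eq: "partners (edges I) (U j) = W ` {i\<in>{..<m}. U i = U j}"
    using partners_applicant[OF order_refl a] edges_eq by simp
  then show "finite (partners (edges I) (U j))" by simp
  have "card (W ` {i\<in>{..<m}. U i = U j}) \<le> card {i\<in>{..<m}. U i = U j}" by (intro card_image_le) simp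
  also have "\<dots> \<le> card {..<m}" by (intro card_mono) auto
  finally show "card (partners (edges I) (U j)) \<le> m" using eq by simp
qed

lemma rank_iff:
  assumes "j < m"
  shows "has_rank I (U j, W j) k \<longleftrightarrow> k = rk j"
proof -
  have "has_rank I (U j, W j) (rk j)" using ranks[OF assms] es_nth[OF assms] by simp
  then show ?thesis using has_rank_unique[of I "(U j, W j)"] pref_ok(1)[OF assms] by auto
qed

lemma rank_bounds:
  assumes "j < m"
  shows "1 \<le> rk j \<and> rk j \<le> m"
proof -
  have "has_rank I (U j, W j) (rk j)" using rank_iff[OF assms] by simp
  then have "1 \<le> rk j" "rk j \<le> length (pref I (U j))" by (auto simp: has_rank_def)
  moreover have "length (pref I (U j)) \<le> m"
    using preference_list_length[OF pref_ok(1,3)[OF assms]] pref_ok(2)[OF assms] by simp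
  ultimately show ?thesis by simp
qed

lemma max_rank_le: "max_rank I \<le> m"
proof -
  have "{k. \<exists>e\<in>edges I. has_rank I e k} \<subseteq> {..m}"
    using rank_iff rank_bounds unfolding edges_eq edg_def by auto
  moreover from this have "finite {k. \<exists>e\<in>edges I. has_rank I e k}" using finite_subset by blast
  ultimately show ?thesis unfolding max_rank_def by (subst Max_le_iff) auto
qed

lemma signature_nth:
  assumes "X \<subseteq> {..<m}" "i < max_rank I"
  shows "signature I (edg X) ! i = card {j\<in>X. rk j = Suc i}"
proof -
  have "{e \<in> edg X. has_rank I e (Suc i)} = (\<lambda>j. (U j, W j)) ` {j\<in>X. rk j = Suc i}"
    using rank_iff assms(1) by (fastforce simp: edg_def)
  moreover have "inj_on (\<lambda>j. (U j, W j)) {j\<in>X. rk j = Suc i}"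
    by (rule inj_on_subset[OF inj_edge]) (use assms in auto)
  ultimately have "card {e \<in> edg X. has_rank I e (Suc i)} = card {j\<in>X. rk j = Suc i}"
    by (simp only: card_image)
  then show ?thesis using assms(2) unfolding signature_def by (simp del: upt_Suc)
qed

text \<open>Any competing feasible matching is given by a set of edge numbers that fits the network,
  so \<open>stage_final\<close> applies to it. Position \<open>k\<close> of a signature counts the
  edges of rank \<open>Suc k\<close>.\<close>

lemma rank_maximalI:
  assumes T: "two_sides m n1 U W qu cc cs cq mc ms mem tA hA cA fA t1 h1 c1 f1 n2 t2 h2 c2 f2 rk"
    and st: "net.stage m n1 n2 t2 h2 (\<lambda>x. c2 x - 1) rk (Suc m) f cap fr"
  shows "rank_maximal I (edg {j. j < m \<and> f j = 1})"
proof -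
  interpret two_sides m n1 U W qu cc cs cq mc ms mem tA hA cA fA t1 h1 c1 f1 n2 t2 h2 c2 f2 rk
    by (rule T)
  let ?M = "N.chosen f"
  have M: "?M = {j. j < m \<and> f j = 1}" by (simp add: N.chosen_def)
  have fits: "N.fits X \<longleftrightarrow> feasible I (edg X)" if "X \<subseteq> {..<m}" for X
    unfolding fits_iff A.keys_fit_iff[OF that] B.keys_fit_iff[OF that] feasible_iff[OF that]
      A.Cls_def A.Mem_def using that by blast
  have sub: "?M \<subseteq> {..<m}" by (auto simp: M)
  have "feasible I (edg ?M)" using N.stage_fits[OF st] fits[OF sub] by blast
  moreover have False if M': "feasible I M'" "lex_larger (signature I M') (signature I (edg ?M))" for M'
  proof -
    define X where "X = {j. j < m \<and> (U j, W j) \<in> M'}"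
    have X: "X \<subseteq> {..<m}" by (auto simp: X_def)
    have "M' \<subseteq> edg {..<m}" using M'(1) edges_eq by (simp add: feasible_def)
    then have M'X: "M' = edg X" by (auto simp: X_def edg_def)
    have fX: "N.fits X" using fits[OF X] M'(1) M'X by simp
    have len: "length (signature I Z) = max_rank I" for Z by (simp add: signature_def)
    obtain k where k: "k < max_rank I" "\<And>i. i < k \<Longrightarrow> signature I (edg X) ! i = signature I (edg ?M) ! i"
      "signature I (edg X) ! k > signature I (edg ?M) ! k"
      using M'(2) unfolding lex_larger_def len M'X by blast
    have cnt: "signature I (edg Z) ! i = N.count (Suc i) Z" if "Z \<subseteq> {..<m}" "i < max_rank I" for Z i
      using signature_nth[OF that] by (simp add: N.count_def)
    have "N.count (Suc k) X \<le> N.count (Suc k) ?M"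
    proof (rule N.stage_final[OF st fX])
      show "Suc k \<le> m" using k(1) max_rank_le by simp
      fix i assume "1 \<le> i" "i < Suc k"
      then obtain l where l: "i = Suc l" "l < k" by (cases i) auto
      then show "N.count i X = N.count i ?M" using k(2)[of l] cnt[OF X, of l] cnt[OF sub, of l] k(1) by simp
    qed simp
    then show False using k(3) cnt[OF X k(1)] cnt[OF sub k(1)] by simp
  qed
  ultimately show ?thesis unfolding rank_maximal_def M by blast
qed

section \<open>The whole program\<close>

lemma wp_main: "wp main_com (\<lambda>t s'. t \<le> 30000 * (m + 2) * (m + 2) \<and> rank_maximal I (output_edges s')) s"
proof -
  let ?s0 = "step (''n'' ::= Add (V ''edge_count'') (Num 2)) s"
  have zero: "s x i = 0" if "x \<notin> input_arrays" for x i using enc that by (simp add: encodes_def)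
  have s0n: "?s0 ''n'' 0 = m + 2" using es(3) by simp
  have s0: "?s0 y = s y" if "y \<noteq> ''n''" for y using that by simp
  interpret A: side_prog m "m + 2" m U W qu cc cs cq mc ms mem "s ''tail''" "s ''head''" "s ''cap''" "s ''flow''"
    "''edge_applicant''" "''edge_post''" "''tail''" "''head''" "V ''edge_count''"
    by (intro side_prog.intro sideA side_prog_axioms.intro) auto
  have inp0: "A.inp ?s0" using es(3) by (simp add: A.inp_def)
  have PS0: "A.PS {} ?s0" using A.P_empty unfolding A.PS_def s0n by (simp add: s0 del: step.simps)
  have seen0: "?s0 ''seen'' u = 0" for u using zero by (simp add: input_arrays_def)
  show ?thesis
    unfolding main_com_def
  proof (rule wp_straight_Seq, simp, rule wp_Seq, rule wp_frame[OF A.wp_side[OF inp0 PS0 seen0]], goal_cases)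
    case (1 t0 t1 s1)
    note t0 = 1(1) and r1 = 1(2) and fr1 = 1(3)
    obtain n1 where n1_def: "s1 ''n'' 0 = n1" by blast
    have PA: "A.P (A.keys (U ` {..<m})) n1 (s1 ''tail'') (s1 ''head'') (s1 ''cap'') (s1 ''flow'')"
      using r1 by (simp add: A.PS_def n1_def)
    have n1: "m + 2 \<le> n1" using PA unfolding A.P_def by (rule conjunct1)
    interpret B: side_prog m n1 "m + 1" W U qu cc cs cq mc ms mem "s1 ''head''" "s1 ''tail''" "s1 ''cap''" "s1 ''flow''"
      "''edge_post''" "''edge_applicant''" "''head''" "''tail''" "Add (V ''edge_count'') (Num 1)"
      by (intro side_prog.intro sideB[OF n1] side_prog_axioms.intro) auto
    have f1: "s1 y = s y" if "y \<in> input_arrays \<union> {''frozen'', ''out_count''}" for y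
    proof -
      have "s1 y = ?s0 y" by (rule fr1) (use that in \<open>auto simp: input_arrays_def\<close>)
      also have "\<dots> = s y" by (rule s0) (use that in \<open>auto simp: input_arrays_def\<close>)
      finally show ?thesis .
    qed
    have inp1: "B.inp s1" using es(3) unfolding B.inp_def by (simp add: f1 input_arrays_def)
    have PS1: "B.PS {} s1" using B.P_empty unfolding B.PS_def n1_def .
    \<comment> \<open>Both passes use the same array \<open>seen\<close>. Applicants and posts are
      disjoint, so the first pass has left the cells of the posts at 0.\<close>
    have seen1: "s1 ''seen'' u = 0" if "u \<in> W ` {..<m}" for u
    proof -
      have "u \<notin> U ` {..<m}" using that edge_ends sides(2) by fastforce
      then show ?thesis using r1 seen0 by metis
    qed
    show ?case
    proof (rule wp_Seq, rule wp_frame[OF B.wp_side[OF inp1 PS1 seen1]], goal_cases)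
      case (2 t2 s2)
      note r2 = 2(1) and fr2 = 2(2)
      obtain n2 where n2_def: "s2 ''n'' 0 = n2" by blast
      let ?tl = "s2 ''tail''" and ?hd = "s2 ''head''" and ?c = "s2 ''cap''" and ?f = "s2 ''flow''"
      have PB: "B.P (B.keys (W ` {..<m})) n2 ?hd ?tl ?c ?f" using r2 unfolding B.PS_def n2_def by blast
      have T: "two_sides m n1 U W qu cc cs cq mc ms mem (s ''tail'') (s ''head'') (s ''cap'') (s ''flow'')
          (s1 ''tail'') (s1 ''head'') (s1 ''cap'') (s1 ''flow'') n2 ?tl ?hd ?c ?f rk"
        using PA PB rank_bounds
        by (intro two_sides.intro two_sides_axioms.intro A.side_axioms B.side_axioms) auto
      interpret T: two_sides m n1 U W qu cc cs cq mc ms mem "s ''tail''" "s ''head''" "s ''cap''" "s ''flow''"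
          "s1 ''tail''" "s1 ''head''" "s1 ''cap''" "s1 ''flow''" n2 ?tl ?hd ?c ?f rk
        by (rule T)
      have f2: "s2 y = s y" if "y \<in> input_arrays \<union> {''frozen'', ''out_count''}" for y
      proof -
        have "s2 y = s1 y" by (rule fr2) (use that in \<open>auto simp: input_arrays_def\<close>)
        also have "\<dots> = s y" by (rule f1[OF that])
        finally show ?thesis .
      qed
      have n2m: "m + 1 < n2" using T.bounds by simp
      show ?case
      proof (rule wp_Seq, rule wp_frame[OF T.N.wp_adj], goal_cases)
        case (4 t3 s3)
        note r3 = 4(1) and fr3 = 4(2)
        have f3: "s3 y = s2 y" if "y \<in> input_arrays \<union> {''frozen'', ''out_count'', ''tail'', ''head'', ''cap'', ''flow'', ''n''}" for y
          by (rule fr3) (use that in \<open>auto simp: input_arrays_def\<close>)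
        have ec3: "s3 ''edge_count'' 0 = m" using f3[of "''edge_count''"] f2[of "''edge_count''"] es(3) by (simp add: input_arrays_def)
        show ?case
        proof (rule wp_Seq, rule wp_frame[OF wp_init[of s3 m, OF ec3]], goal_cases)
          case (1 t4 s4)
          note r4 = 1(1) and fr4 = 1(2)
          have f4: "s4 y = s2 y" if "y \<in> input_arrays \<union> {''frozen'', ''out_count'', ''tail'', ''head'', ''flow'', ''n''}" for y
          proof -
            have "s4 y = s3 y" by (rule fr4) (use that in \<open>auto simp: input_arrays_def\<close>)
            also have "\<dots> = s2 y" by (rule f3) (use that in auto)
            finally show ?thesis .
          qed
          have fs4: "s4 ''tail'' = ?tl" "s4 ''head'' = ?hd" "s4 ''flow'' = ?f" "s4 ''n'' 0 = n2"
            "s4 ''edge_rank'' = rk" "s4 ''frozen'' = s ''frozen''" "s4 ''edge_count'' 0 = m"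
            using f4 f2 es(3) by (simp_all add: n2_def input_arrays_def)
          have sa: "s4 ''start'' = s3 ''start''" "s4 ''adj'' = s3 ''adj''" by (rule fr4; simp)+
          have cap4: "s4 ''cap'' j = (if j < m \<and> rk j = 1 then 1 else ?c j)" for j
            using r4 f3[of "''cap''"] f3[of "''edge_rank''"] f2[of "''edge_rank''"] by (simp add: input_arrays_def)
          have arr: "T.N.arr s4" using fs4 sa r3 by (simp add: T.N.arr_def)
          have lowz: "?f j = 0" "?c j = 0" if "j < m + 2" for j
            using T.low[OF that] zero by (simp_all add: input_arrays_def)
          have idle: "T.N.idle (s4 ''flow'') (s4 ''cap'')"
            using lowz T.bounds by (auto simp: T.N.idle_def T.N.links_def T.N.tree_def fs4 cap4)
          have st: "T.N.stage 1 (s4 ''flow'') (s4 ''cap'') (s4 ''frozen'')"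
          proof (rule T.N.stage_init)
            show "s4 ''flow'' j = 0" if "j < m" for j using lowz[of j] that fs4 by simp
            show "s4 ''flow'' x = 1" if "x \<in> T.N.tree" for x using T.tree_init[OF that] fs4 by simp
            show "s4 ''frozen'' j = 0" for j using fs4 zero by (simp add: input_arrays_def)
            show "s4 ''cap'' j = (if rk j \<le> 1 then 1 else 0)" if "j < m" for j
              using cap4[of j] lowz[of j] that rank_bounds[OF that] by auto
            show "s4 ''cap'' x = ?c x - 1 + 1" if x: "x \<in> T.N.tree" for x
              using cap4[of x] T.tree_init[OF x] x by (auto simp: T.N.tree_def)
          qed
          show ?case
          proof (rule wp_Seq, rule wp_frame[OF T.N.wp_stages[OF arr fs4(5) idle st]], goal_cases)
            case (1 t5 s5)
            note r5 = 1(1) and fr5 = 1(2)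
            have f5: "s5 y = s y" if "y \<in> input_arrays \<union> {''out_count''}" for y
            proof -
              have "s5 y = s4 y" by (rule fr5) (use that in \<open>auto simp: input_arrays_def\<close>)
              also have "\<dots> = s2 y" by (rule f4) (use that in auto)
              also have "\<dots> = s y" by (rule f2) (use that in auto)
              finally show ?thesis .
            qed
            have e5: "s5 ''edge_count'' 0 = m" "s5 ''out_count'' 0 = 0" "s5 ''edge_applicant'' = U" "s5 ''edge_post'' = W"
              using f5 es(3) zero by (simp_all add: input_arrays_def)
            obtain cap fr where "T.N.stage (Suc m) (s5 ''flow'') cap fr" using r5 by blast
            then have rm: "rank_maximal I (edg {j. j < m \<and> s5 ''flow'' j = 1})" by (rule rank_maximalI[OF T])
            show ?case
            proof (rule wp_mono[OF wp_output[of s5 m, OF e5(1,2)]])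
              fix t6 s6 assume r6: "t6 \<le> 100 * (m + 1) \<and>
                output_edges s6 = (\<lambda>j. (s5 ''edge_applicant'' j, s5 ''edge_post'' j)) ` {j. j < m \<and> s5 ''flow'' j = 1}"
              then have "rank_maximal I (output_edges s6)" using rm by (simp add: edg_def e5)
              moreover have "t0 + (t1 + (t2 + (t3 + (t4 + (t5 + t6))))) \<le> 30000 * (m + 2) * (m + 2)"
              proof -
                \<comment> \<open>The dominating terms are \<open>70 * 49\<close> for the incidence
                  lists and \<open>3000 * 7\<close> for the stages, where 7 comes from the size of
                  the network.\<close>
                define M where "M = m + 2"
                have n2M: "n2 + 1 \<le> 7 * M" using T.n2_le by (simp add: M_def)
                have MM: "M \<le> M * M" by (simp add: M_def)
                have "t3 \<le> 70 * (n2 + 1) * (n2 + 1)" using r3 by simp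
                also have "\<dots> \<le> 70 * (7 * M) * (7 * M)" by (intro mult_le_mono n2M) auto
                finally have "t3 \<le> 3430 * (M * M)" by simp
                moreover have "t5 \<le> 3000 * (n2 + 1) * (m + 1)" using r5 by simp
                then have "t5 \<le> 3000 * (7 * M) * M"
                  using mult_le_mono[OF mult_le_mono[OF order_refl n2M], of "m + 1" M 3000] by (simp add: M_def)
                then have "t5 \<le> 21000 * (M * M)" by simp
                moreover have "t1 \<le> 500 * (M * M)" "t2 \<le> 500 * (M * M)" using r1 r2 unfolding M_def mult.assoc by blast+
                moreover have "t4 \<le> 50 * M" "t6 \<le> 100 * M" using r4 r6 by (simp_all add: M_def)
                moreover have "t0 \<le> 6" "6 \<le> 6 * M" using t0 by (simp_all add: M_def)
                ultimately have "t0 + (t1 + (t2 + (t3 + (t4 + (t5 + t6))))) \<le> 30000 * (M * M)"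
                  using MM by linarith
                then show ?thesis unfolding M_def mult.assoc .
              qed
              ultimately show "t0 + (t1 + (t2 + (t3 + (t4 + (t5 + t6))))) \<le> 30000 * (m + 2) * (m + 2) \<and>
                  rank_maximal I (output_edges s6)" by blast
            qed
          qed
        qed
      qed (simp_all add: n2_def)
    qed
  qed
qed

end

theorem theorem1:
  shows "\<exists>(c :: com) (T :: nat \<Rightarrow> nat).
    (\<lambda>m. real (T m)) \<in> O(\<lambda>m. real m ^ 2) \<and>
    (\<forall>I s. valid_instance I \<and> encodes I s \<longrightarrow>
      (\<exists>t s'. exec c s t s' \<and> t \<le> T (card (edges I)) \<and> rank_maximal I (output_edges s')))"
proof (rule exI[of _ main_com], rule exI[of _ "\<lambda>m. 30000 * (m + 2) * (m + 2)"], intro conjI allI impI)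
  show "(\<lambda>m. real (30000 * (m + 2) * (m + 2))) \<in> O(\<lambda>m. real m ^ 2)"
  \<comment> \<open>The constant is \<open>9 * 30000\<close>, since \<open>m + 2 \<le> 3 * m\<close>
    for positive \<open>m\<close>.\<close>
  proof (rule bigoI[where c = 270000])
    have "real (30000 * (m + 2) * (m + 2)) \<le> 270000 * real m ^ 2" if "m \<ge> 1" for m :: nat
    proof -
      have "(m + 2) * (m + 2) \<le> (3 * m) * (3 * m)" using that by (intro mult_le_mono) auto
      then have "30000 * (m + 2) * (m + 2) \<le> 270000 * m ^ 2" by (simp add: power2_eq_square algebra_simps)
      then have "real (30000 * (m + 2) * (m + 2)) \<le> real (270000 * m ^ 2)" by (simp only: of_nat_le_iff)
      then show ?thesis by simp
    qed
    then show "\<forall>\<^sub>F m in sequentially. norm (real (30000 * (m + 2) * (m + 2))) \<le> 270000 * norm (real m ^ 2)"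
      by (intro eventually_sequentiallyI[of 1]) simp
  qed
next
  fix I s assume Is: "valid_instance I \<and> encodes I s"
  then obtain es where "encoded I s es" unfolding encoded_def encodes_def by blast
  then interpret encoded I s es .
  show "\<exists>t s'. exec main_com s t s' \<and> t \<le> 30000 * (card (edges I) + 2) * (card (edges I) + 2) \<and>
      rank_maximal I (output_edges s')"
    using wp_main unfolding wp_def card_edges .
qed

end
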